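(* Let $(p_k)_{k\ge0}$, $\mathbf f$, $q$, $\mathbf P$, $\beta$, $\gamma$, $(X_n)_{n\ge0}$, $\mathbb P$ and $\Delta_n$ be as in the context. Then: (i) the laws of $(\Delta_n/n^{1/\gamma})_{n\ge1}$ under $\mathbb P$ are tight; (ii) the laws of $(|X_n|/n^{\gamma})_{n\ge1}$ under $\mathbb P$ are tight; (iii) $\displaystyle\lim_{n\to\infty}\frac{\ln|X_n|}{\ln n}=\gamma$, $\mathbb P$-almost surely.
   Context: Let $(p_k)_{k\ge0}$ be a probability distribution on $\{0,1,2,\dots\}$ with generating function $\mathbf f(z)=\sum_k p_kz^k$ such that $p_0>0$, $\mathbf m:=\mathbf f'(1)=\sum_k kp_k\in(1,\infty)$ and $\sum_k k^2p_k<\infty$. Let $q\in(0,1)$ be the extinction probability (the smallest solution of $\mathbf f(q)=q$ in $[0,1]$); then $0<\mathbf f'(q)<1$. Let $\mathbf P$ be the law of a Galton–Watson tree $T$ with offspring distribution $(p_k)$ and root $0$, conditioned on non-extinction. For a vertex $u$, $|u|$ is its graph distance to $0$. Fix $\beta>1/\mathbf f'(q)$ and set $\gamma=-\ln \mathbf f'(q)/\ln\beta\in(0,1)$. Given $T$, $(X_n)_{n\ge0}$ is the Markov chain on the vertices of $T$ with $X_0=0$ which, from a vertex $u\ne0$ with $k$ children and parent $\overleftarrow u$, jumps to $\overleftarrow u$ with probability $1/(1+\beta k)$ and to each child with probability $\beta/(1+\beta k)$, and from $0$ jumps to each child of $0$ with equal probability. $P^\omega$ is its law given $T$ and $\mathbb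 P=\mathbf P\times P^\omega$ is the averaged law (first choose $T$ under $\mathbf P$, then the walk under $P^\omega$). Finally $\Delta_n=\inf\{i\ge0:|X_i|=n\}$ is the hitting time of level $n$. *)

theory Defs
  imports "HOL-Probability.Probability"
begin

definition gen_fun :: "nat pmf \<Rightarrow> real \<Rightarrow> real" where
  "gen_fun p z = (\<Sum>k. pmf p k * z ^ k)"

definition gen_fun_deriv :: "nat pmf \<Rightarrow> real \<Rightarrow> real" where
  "gen_fun_deriv p z = (\<Sum>k. pmf p k * real k * z ^ (k - 1))"

text \<open>Vertices are finite sequences of naturals; the root is the empty list,
  the children of u are u @ [i], the parent of u is butlast u, and |u| = length u.
  A family xi :: nat list => nat of numbers of offspring determines the tree:
  u is a vertex iff each of its entries is smaller than the number of children
  of the corresponding ancestor.\<close>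
definition gw_tree :: "(nat list \<Rightarrow> nat) \<Rightarrow> nat list set" where
  "gw_tree \<xi> = {u. \<forall>j < length u. u ! j < \<xi> (take j u)}"

definition gw_law :: "nat pmf \<Rightarrow> (nat list \<Rightarrow> nat) measure" where
  "gw_law p = PiM UNIV (\<lambda>_. measure_pmf p)"

definition gw_law_surv :: "nat pmf \<Rightarrow> (nat list \<Rightarrow> nat) measure" where
  "gw_law_surv p = uniform_measure (gw_law p) {\<xi>. infinite (gw_tree \<xi>)}"

text \<open>One step of the walk from vertex u, driven by a uniform variable r in [0,1].
  From u ~= root with k children: parent with probability 1/(1+beta k),
  each child with probability beta/(1+beta k). From the root: uniform child.\<close>
definition walk_step :: "real \<Rightarrow> (nat list \<Rightarrow> nat) \<Rightarrow> nat list \<Rightarrow> real \<Rightarrow> nat list" where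
  "walk_step \<beta> \<xi> u r =
     (let k = \<xi> u in
      if u = [] then
        (if k = 0 then u else u @ [min (k - 1) (nat \<lfloor>r * real k\<rfloor>)])
      else
        (let a = 1 / (1 + \<beta> * real k) in
         if k = 0 \<or> r < a then butlast u
         else u @ [min (k - 1) (nat \<lfloor>(r - a) / (\<beta> * a)\<rfloor>)]))"

primrec walk :: "real \<Rightarrow> (nat list \<Rightarrow> nat) \<Rightarrow> (nat \<Rightarrow> real) \<Rightarrow> nat \<Rightarrow> nat list" where
  "walk \<beta> \<xi> U 0 = []"
| "walk \<beta> \<xi> U (Suc n) = walk_step \<beta> \<xi> (walk \<beta> \<xi> U n) (U n)"

definition noise_law :: "(nat \<Rightarrow> real) measure" where
  "noise_law = PiM UNIV (\<lambda>_. uniform_measure lborel {0..1::real})"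

definition annealed :: "nat pmf \<Rightarrow> ((nat list \<Rightarrow> nat) \<times> (nat \<Rightarrow> real)) measure" where
  "annealed p = gw_law_surv p \<Otimes>\<^sub>M noise_law"

definition X :: "real \<Rightarrow> ((nat list \<Rightarrow> nat) \<times> (nat \<Rightarrow> real)) \<Rightarrow> nat \<Rightarrow> nat list" where
  "X \<beta> \<omega> n = walk \<beta> (fst \<omega>) (snd \<omega>) n"

text \<open>Hitting time Delta_n of level n (convention: 0 if level n is never hit,
  which is a null event).\<close>
definition hit_time :: "real \<Rightarrow> ((nat list \<Rightarrow> nat) \<times> (nat \<Rightarrow> real)) \<Rightarrow> nat \<Rightarrow> nat" where
  "hit_time \<beta> \<omega> n = (if \<exists>i. length (X \<beta> \<omega> i) = n then (LEAST i. length (X \<beta> \<omega> i) = n) else 0)"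

end

theory Submission
  imports Defs "HOL-Real_Asymp.Real_Asymp"
begin

text \<open>
  The backbone of the tree consists of the vertices with infinitely many descendants; finite trees,
  the traps, are attached to it. Along the backbone the walk has an upward drift that is bounded
  below uniformly in the environment: \<open>\<beta>\<close> to the power minus the backbone height is superharmonic.
  Hence the walk visits on average at most \<open>\<beta> / (\<beta> - 1)\<close> backbone vertices of each level and is
  exponentially unlikely to fall back by many backbone levels. Whether \<open>u\<close> is ever hit does not
  depend on the subtree of \<open>u\<close>, so averages over the vertices of a level factorise into the number
  of hits and the mean of a functional of a fresh tree.

  With \<open>\<mu> = f'(q)\<close>, a trap reaches height \<open>h\<close> with probability of order \<open>\<mu> ^ h\<close> and holds the walk
  for a time of order \<open>\<beta> ^ h\<close>. Choosing \<open>\<beta> ^ h\<close> of order \<open>t\<close>, so that \<open>\<mu> ^ h\<close> is of order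
  \<open>t powr (- \<gamma>)\<close>, the first moment of the time spent in traps of height below \<open>h\<close>, together with
  the probability of meeting a higher one, bounds the probability of staying below level \<open>m\<close> up
  to time \<open>t\<close> by a multiple of \<open>m t powr (- \<gamma>)\<close>. Conversely, let the walk be killed at each step
  with probability \<open>1 / (n + 1)\<close>; every new backbone level then costs a factor \<open>1 - c \<mu> ^ h\<close> with
  \<open>\<beta> ^ h\<close> of order \<open>n\<close>, which bounds the probability of reaching level \<open>m\<close> by time \<open>n\<close> by a multiple
  of \<open>n powr \<gamma> / m\<close>. Both bounds give tightness, and Borel-Cantelli along \<open>n = 2 ^ i\<close> gives the exponent.
\<close>

section \<open>Trees\<close>

text \<open>Every quenched quantity is a finite-horizon recursion for the one-step operator
  \<open>step_op\<close>, and every bound on it is an induction over the horizon against an explicit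
  comparison function; stopping times and the strong Markov property never enter. The obstacle is
  that the traps at a backbone vertex influence how often the walk comes back to it. Therefore each
  instant is charged to the last backbone ancestor of the position: the time charged to
  \<open>u\<close> is at most the chance of hitting \<open>u\<close> times a function of the subtree
  of \<open>u\<close>, and it is this product form that can be averaged. In the other direction the
  times do not add up independently, so transforms of hitting times take their place: with killing,
  the mass that reaches the next level is at most a sum, over the first entrance point, of a hitting
  factor times a subtree factor. The two scales match for the following reason. The time truncated
  at trap height \<open>h\<close> has mean of order \<open>(\<beta> * \<mu>) ^ h\<close>, dominated
  by the deepest traps because \<open>\<beta> * \<mu>\<close> exceeds one; divided by a time of
  order \<open>\<beta> ^ h\<close> it is of order \<open>\<mu> ^ h\<close>, the chance of a deeper
  trap.\<close>

definition subtree :: "nat list \<Rightarrow> (nat list \<Rightarrow> nat) \<Rightarrow> nat list \<Rightarrow> nat" where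
  "subtree u T w = T (u @ w)"

text \<open>Reaching generation \<open>h\<close> is defined by recursion over the children of the
  root, not by the existence of a vertex, so that measurability and the generating function
  recursion become plain inductions; \<open>alive_iff\<close> recovers the vertices.\<close>

primrec alive :: "nat \<Rightarrow> (nat list \<Rightarrow> nat) \<Rightarrow> bool" where
  "alive 0 T = True"
| "alive (Suc h) T = (\<exists>i<T []. alive h (subtree [i] T))"

definition surv :: "(nat list \<Rightarrow> nat) \<Rightarrow> bool" where
  "surv T = (\<forall>h. alive h T)"

abbreviation backbone :: "(nat list \<Rightarrow> nat) \<Rightarrow> nat list \<Rightarrow> bool" where
  "backbone T u \<equiv> surv (subtree u T)"

lemma subtree_subtree [simp]: "subtree w (subtree u T) = subtree (u @ w) T"
  by (simp add: subtree_def fun_eq_iff)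

lemma subtree_Nil [simp]: "subtree [] T = T"
  by (simp add: subtree_def fun_eq_iff)

lemma subtree_root [simp]: "subtree u T [] = T u"
  by (simp add: subtree_def)

lemma alive_Suc_imp: "alive (Suc h) T \<Longrightarrow> alive h T"
proof (induction h arbitrary: T)
  case (Suc h)
  from Suc.prems obtain i where "i < T []" "alive (Suc h) (subtree [i] T)"
    by (subst (asm) alive.simps(2)) blast
  with Suc.IH[of "subtree [i] T"] show ?case by (metis alive.simps(2))
qed simp

lemma alive_antimono: "h \<le> h' \<Longrightarrow> alive h' T \<Longrightarrow> alive h T"
  by (induction h' rule: dec_induct) (use alive_Suc_imp in blast)+

text \<open>A compactness argument: the root has finitely many children, so if each of their
  subtrees dies out by some height, the sum of these heights works for all of them at once.\<close>

lemma surv_iff: "surv T \<longleftrightarrow> (\<exists>i<T []. surv (subtree [i] T))"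
proof
  assume s: "surv T"
  show "\<exists>i<T []. surv (subtree [i] T)"
  proof (rule ccontr)
    assume "\<not> ?thesis"
    then have "\<forall>i. \<exists>h. i < T [] \<longrightarrow> \<not> alive h (subtree [i] T)"
      by (auto simp: surv_def)
    then obtain H where H: "\<And>i. i < T [] \<Longrightarrow> \<not> alive (H i) (subtree [i] T)"
      by metis
    define M where "M = (\<Sum>i<T []. H i)"
    have "H i \<le> M" if "i < T []" for i
      unfolding M_def using that by (intro member_le_sum) auto
    then have "\<not> alive (Suc M) T"
      using H alive_antimono by auto blast
    with s show False by (auto simp: surv_def simp del: alive.simps)
  qed
next
  assume "\<exists>i<T []. surv (subtree [i] T)"
  then obtain i where i: "i < T []" "surv (subtree [i] T)" by blast
  show "surv T" unfolding surv_def
  proof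
    fix h show "alive h T"
      using i by (cases h) (auto simp: surv_def)
  qed
qed

lemma backbone_iff: "backbone T u \<longleftrightarrow> (\<exists>i<T u. backbone T (u @ [i]))"
  by (subst surv_iff) simp

lemma Nil_in_gw_tree [simp]: "[] \<in> gw_tree T"
  by (simp add: gw_tree_def)

lemma gw_tree_snoc [simp]: "u @ [i] \<in> gw_tree T \<longleftrightarrow> u \<in> gw_tree T \<and> i < T u"
  by (auto simp: gw_tree_def nth_append less_Suc_eq)

lemma gw_tree_append: "u @ w \<in> gw_tree T \<longleftrightarrow> u \<in> gw_tree T \<and> w \<in> gw_tree (subtree u T)"
proof (induction w rule: rev_induct)
  case (snoc i w)
  then show ?case
    by (simp flip: append_assoc) (auto simp: subtree_def)
qed simp

lemma gw_tree_Cons: "i # w \<in> gw_tree T \<longleftrightarrow> i < T [] \<and> w \<in> gw_tree (subtree [i] T)"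
  using gw_tree_append[of "[i]" w T] gw_tree_snoc[of "[]" i T] by simp

lemma gw_tree_take: "u \<in> gw_tree T \<Longrightarrow> take j u \<in> gw_tree T"
  by (metis append_take_drop_id gw_tree_append)

lemma gw_tree_butlast: "u \<in> gw_tree T \<Longrightarrow> butlast u \<in> gw_tree T"
  by (simp add: butlast_conv_take gw_tree_take)

lemma alive_iff: "alive h T \<longleftrightarrow> (\<exists>u\<in>gw_tree T. length u = h)"
proof (induction h arbitrary: T)
  case (Suc h)
  show ?case
  proof
    assume "alive (Suc h) T"
    then obtain i w where "i < T []" "w \<in> gw_tree (subtree [i] T)" "length w = h"
      using Suc.IH by auto
    then show "\<exists>u\<in>gw_tree T. length u = Suc h"
      by (intro bexI[of _ "i # w"]) (auto simp: gw_tree_Cons)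
  next
    assume "\<exists>u\<in>gw_tree T. length u = Suc h"
    then obtain i w where "i # w \<in> gw_tree T" "length w = h"
      by (auto simp: length_Suc_conv)
    then show "alive (Suc h) T"
      using Suc.IH by (auto simp: gw_tree_Cons)
  qed
qed (auto intro: bexI[of _ "[]"])

definition level :: "(nat list \<Rightarrow> nat) \<Rightarrow> nat \<Rightarrow> nat list set" where
  "level T n = {u \<in> gw_tree T. length u = n}"

lemma finite_level: "finite (level T n)"
proof (induction n)
  case (Suc n)
  have "level T (Suc n) \<subseteq> (\<Union>u\<in>level T n. (\<lambda>i. u @ [i]) ` {..<T u})"
  proof
    fix x assume "x \<in> level T (Suc n)"
    then show "x \<in> (\<Union>u\<in>level T n. (\<lambda>i. u @ [i]) ` {..<T u})"
      by (cases x rule: rev_cases) (auto simp: level_def)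
  qed
  with Suc show ?case by (auto intro: finite_subset)
qed (auto simp: level_def intro: finite_subset[of _ "{[]}"])

text \<open>Connects the recursive notion of survival with the conditioning event in
  \<open>gw_law_surv\<close>; the content is that levels are finite, so a tree of bounded height is
  finite.\<close>

lemma surv_iff_infinite: "surv T \<longleftrightarrow> infinite (gw_tree T)"
proof
  assume s: "surv T"
  show "infinite (gw_tree T)"
  proof
    assume "finite (gw_tree T)"
    then have "finite (length ` gw_tree T)" by simp
    moreover have "length ` gw_tree T = UNIV"
      using s by (auto simp: surv_def alive_iff image_iff) metis
    ultimately show False by simp
  qed
next
  assume inf: "infinite (gw_tree T)"
  show "surv T"
  proof (rule ccontr)
    assume "\<not> surv T"
    then obtain h where h: "\<not> alive h T" by (auto simp: surv_def)
    have "gw_tree T \<subseteq> (\<Union>n<h. level T n)"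
    proof
      fix u assume u: "u \<in> gw_tree T"
      then have "alive (length u) T" by (auto simp: alive_iff)
      with h alive_antimono[of h "length u"] have "length u < h" by (meson linorder_not_less)
      with u show "u \<in> (\<Union>n<h. level T n)" by (auto simp: level_def)
    qed
    moreover have "finite (\<Union>n<h. level T n)" by (auto simp: finite_level)
    ultimately show False using inf finite_subset by blast
  qed
qed

lemma backbone_take:
  assumes "w \<in> gw_tree T" "backbone T w"
  shows "backbone T (take j w)"
  using assms
proof (induction w arbitrary: j rule: rev_induct)
  case (snoc i w)
  then have "backbone T w" "w \<in> gw_tree T" by (auto simp: backbone_iff[of w T])
  with snoc show ?case by (cases "j \<le> length w") auto
qed simp

text \<open>For a vertex of the tree this is the level of its last ancestor on the backbone.\<close>
definition backbone_height :: "(nat list \<Rightarrow> nat) \<Rightarrow> nat list \<Rightarrow> nat" where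
  "backbone_height T w = (\<Sum>j<length w. if backbone T (take (Suc j) w) then 1 else 0)"

lemma backbone_height_Nil [simp]: "backbone_height T [] = 0"
  by (simp add: backbone_height_def)

lemma backbone_height_snoc: "backbone_height T (w @ [i]) = backbone_height T w + (if backbone T (w @ [i]) then 1 else 0)"
proof -
  have "(\<Sum>j<length w. if backbone T (take (Suc j) (w @ [i])) then 1 else 0) = backbone_height T w"
    unfolding backbone_height_def by (intro sum.cong) auto
  then show ?thesis by (simp add: backbone_height_def)
qed

lemma backbone_height_le_length: "backbone_height T w \<le> length w"
  by (induction w rule: rev_induct) (auto simp: backbone_height_snoc)

text \<open>Inside the tree every ancestor of a backbone vertex is a backbone vertex, so the
  backbone vertices on the path to \<open>w\<close> form an initial segment; counting them therefore
  gives the level at which the path leaves the backbone.\<close>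

lemma le_backbone_height_iff:
  assumes "surv T" "w \<in> gw_tree T"
  shows "m \<le> backbone_height T w \<longleftrightarrow> m \<le> length w \<and> backbone T (take m w)"
  using assms(2)
proof (induction w arbitrary: m rule: rev_induct)
  case Nil
  then show ?case using assms(1) by auto
next
  case (snoc i w)
  have w: "w \<in> gw_tree T" using snoc.prems by simp
  show ?case
  proof (cases "backbone T (w @ [i])")
    case True
    then have "backbone T w" using w snoc.prems backbone_iff[of w T] by auto
    with snoc.IH[OF w, of "length w"] have "length w = backbone_height T w"
      using backbone_height_le_length[of T w] by auto
    with True backbone_take[OF snoc.prems True] show ?thesis
      by (simp add: backbone_height_snoc)
  next
    case False
    have "Suc (length w) \<le> m \<Longrightarrow> \<not> m \<le> backbone_height T w"
      using backbone_height_le_length[of T w] by simp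
    then show ?thesis using False snoc.IH[OF w, of m]
      by (cases "m \<le> length w"; cases "m = Suc (length w)") (auto simp: backbone_height_snoc)
  qed
qed

lemma backbone_height_backbone: "surv T \<Longrightarrow> w \<in> gw_tree T \<Longrightarrow> backbone T w \<Longrightarrow> backbone_height T w = length w"
  using le_backbone_height_iff[of T w "length w"] backbone_height_le_length[of T w] by auto

lemma backbone_iff_backbone_height: "surv T \<Longrightarrow> w \<in> gw_tree T \<Longrightarrow> backbone T w \<longleftrightarrow> backbone_height T w = length w"
  using le_backbone_height_iff[of T w "length w"] backbone_height_le_length[of T w] by auto

lemma backbone_height_butlast: "w \<noteq> [] \<Longrightarrow> backbone_height T w = backbone_height T (butlast w) + (if backbone T w then 1 else 0)"
  using backbone_height_snoc[of T "butlast w" "last w"] by simp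

lemma backbone_take_backbone_height: "surv T \<Longrightarrow> w \<in> gw_tree T \<Longrightarrow> backbone T (take (backbone_height T w) w)"
  using le_backbone_height_iff[of T w "backbone_height T w"] by auto

definition backbone_level :: "(nat list \<Rightarrow> nat) \<Rightarrow> nat \<Rightarrow> nat list set" where
  "backbone_level T n = {u \<in> level T n. backbone T u}"

lemma finite_backbone_level [simp]: "finite (backbone_level T n)"
  unfolding backbone_level_def using finite_level by simp

lemma bblD: "u \<in> backbone_level T n \<Longrightarrow> u \<in> gw_tree T \<and> length u = n \<and> backbone T u"
  by (simp add: backbone_level_def level_def)

lemma backbone_height_backbone_level: "surv T \<Longrightarrow> u \<in> backbone_level T n \<Longrightarrow> backbone_height T u = n"
  using bblD backbone_height_backbone by blast

section \<open>The transition operator\<close>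

text \<open>The transition operator of the chain on functions. A childless root holds the walk in
  place, in agreement with \<open>walk_step\<close>.\<close>

definition step_op :: "real \<Rightarrow> (nat list \<Rightarrow> nat) \<Rightarrow> (nat list \<Rightarrow> real) \<Rightarrow> nat list \<Rightarrow> real" where
  "step_op \<beta> T f w =
     (if w = [] then (if T [] = 0 then f [] else (\<Sum>i<T []. f [i]) / real (T []))
      else (f (butlast w) + \<beta> * (\<Sum>i<T w. f (w @ [i]))) / (1 + \<beta> * real (T w)))"

lemma step_op_mono:
  assumes b: "\<beta> > 0" and w: "w \<in> gw_tree T" and r: "T [] > 0"
    and 1: "w \<noteq> [] \<Longrightarrow> f (butlast w) \<le> g (butlast w)"
    and 2: "\<And>i. i < T w \<Longrightarrow> f (w @ [i]) \<le> g (w @ [i])"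
  shows "step_op \<beta> T f w \<le> step_op \<beta> T g w"
proof (cases "w = []")
  case True
  then have "(\<Sum>i<T []. f [i]) \<le> (\<Sum>i<T []. g [i])"
    using 2 by (intro sum_mono) auto
  then show ?thesis using True r by (simp add: step_op_def divide_right_mono)
next
  case False
  have "(\<Sum>i<T w. f (w @ [i])) \<le> (\<Sum>i<T w. g (w @ [i]))"
    using 2 by (intro sum_mono) auto
  moreover have "0 \<le> \<beta> * real (T w)" using b by simp
  ultimately show ?thesis using False 1 b
    by (auto simp: step_op_def intro!: divide_right_mono add_mono mult_left_mono)
qed

lemma step_op_cong:
  assumes "w = [] \<Longrightarrow> T [] = 0 \<Longrightarrow> f [] = g []" "w \<noteq> [] \<Longrightarrow> f (butlast w) = g (butlast w)"
    and "\<And>i. i < T w \<Longrightarrow> f (w @ [i]) = g (w @ [i])"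
  shows "step_op \<beta> T f w = step_op \<beta> T g w"
proof -
  have "(\<Sum>i<T w. f (w @ [i])) = (\<Sum>i<T w. g (w @ [i]))"
    using assms(3) by (intro sum.cong) auto
  then show ?thesis using assms(1,2) by (auto simp: step_op_def)
qed

lemma step_op_const [simp]: "\<beta> > 0 \<Longrightarrow> step_op \<beta> T (\<lambda>_. c) w = c"
proof -
  assume b: "\<beta> > 0"
  have "1 + \<beta> * real (T w) > 0" using b by (simp add: add_pos_nonneg)
  then have "(c + \<beta> * (real (T w) * c)) / (1 + \<beta> * real (T w)) = c"
    by (simp add: field_simps)
  then show ?thesis by (simp add: step_op_def)
qed

lemma step_op_cmult: "step_op \<beta> T (\<lambda>w. c * f w) w = c * step_op \<beta> T f w"
  by (simp add: step_op_def sum_distrib_left[symmetric] algebra_simps add_divide_distrib)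

lemma step_op_sum: "step_op \<beta> T (\<lambda>w. \<Sum>u\<in>S. f u w) w = (\<Sum>u\<in>S. step_op \<beta> T (f u) w)"
proof -
  have 1: "(\<Sum>i<k. \<Sum>u\<in>S. f u (v @ [i])) = (\<Sum>u\<in>S. \<Sum>i<k. f u (v @ [i]))" for v k
    by (rule sum.swap)
  consider "w = []" "T [] = 0" | "w = []" "T [] > 0" | "w \<noteq> []" by auto
  then show ?thesis
  proof cases
    case 2
    then show ?thesis using 1[where v="[]"] by (simp add: step_op_def sum_divide_distrib)
  next
    case 3
    then show ?thesis unfolding step_op_def 1
      by (simp add: sum_divide_distrib[symmetric] sum.distrib sum_distrib_left)
  qed (simp add: step_op_def)
qed

lemma step_op_nonneg:
  assumes "\<beta> > 0" "\<And>v. f v \<ge> 0"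
  shows "step_op \<beta> T f w \<ge> 0"
  using assms by (auto simp: step_op_def intro!: divide_nonneg_nonneg add_nonneg_nonneg mult_nonneg_nonneg sum_nonneg)

text \<open>Since \<open>butlast [] = []\<close>, the criterion also covers the root: there it bounds the lazy walk
  that stays put with weight one, and removing the laziness only increases the drift.\<close>
lemma step_op_le_drift:
  assumes b: "\<beta> > 0" and r: "w \<noteq> [] \<or> T [] > 0" and c: "c \<ge> 0"
    and le: "f (butlast w) + \<beta> * (\<Sum>i<T w. f (w @ [i])) \<le> (1 + \<beta> * real (T w)) * (f w - c)"
  shows "step_op \<beta> T f w \<le> f w - c"
proof (cases "w = []")
  case False
  have "1 + \<beta> * real (T w) > 0" using b by (simp add: add_pos_nonneg)
  with le False show ?thesis
    by (simp add: step_op_def pos_divide_le_eq mult.commute)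
next
  case True
  with r have k: "real (T []) > 0" by simp
  have "\<beta> * (\<Sum>i<T []. f [i]) \<le> \<beta> * (real (T []) * (f [] - c)) - c"
    using le True by (simp add: algebra_simps)
  also have "\<dots> \<le> \<beta> * (real (T []) * (f [] - c))" using c by simp
  finally have "(\<Sum>i<T []. f [i]) \<le> real (T []) * (f [] - c)"
    using b by simp
  with True k show ?thesis by (simp add: step_op_def pos_divide_le_eq mult.commute)
qed

text \<open>The expectation of \<open>s ^ \<tau>\<close> on the event that the walk started at \<open>w\<close> enters \<open>A\<close>, at time
  \<open>\<tau> \<le> n\<close>, before entering \<open>D\<close>.\<close>
primrec hit_prob :: "real \<Rightarrow> real \<Rightarrow> (nat list \<Rightarrow> nat) \<Rightarrow> nat list set \<Rightarrow> nat list set \<Rightarrow> nat \<Rightarrow> nat list \<Rightarrow> real" where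
  "hit_prob \<beta> s T A D 0 = (\<lambda>w. if w \<in> A then 1 else 0)"
| "hit_prob \<beta> s T A D (Suc n) = (\<lambda>w. if w \<in> A then 1 else if w \<in> D then 0 else s * step_op \<beta> T (hit_prob \<beta> s T A D n) w)"

lemma hit_prob_in [simp]: "w \<in> A \<Longrightarrow> hit_prob \<beta> s T A D n w = 1"
  by (cases n) auto

lemma hit_prob_out [simp]: "w \<notin> A \<Longrightarrow> w \<in> D \<Longrightarrow> hit_prob \<beta> s T A D n w = 0"
  by (cases n) auto

lemma hit_prob_nonneg: "\<beta> > 0 \<Longrightarrow> s \<ge> 0 \<Longrightarrow> hit_prob \<beta> s T A D n w \<ge> 0"
  by (induction n arbitrary: w) (auto intro!: mult_nonneg_nonneg step_op_nonneg)

lemma step_op_le_const: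
  assumes "\<beta> > 0" "\<And>v. f v \<le> c"
  shows "step_op \<beta> T f w \<le> c"
proof (cases "w = [] \<and> T [] = 0")
  case False
  then have k: "w = [] \<Longrightarrow> 0 < real (T [])" by simp
  have "(\<Sum>i<T w. f (w @ [i])) \<le> (\<Sum>i<T w. c)"
    by (intro sum_mono assms(2))
  then have "step_op \<beta> T f w \<le> step_op \<beta> T (\<lambda>_. c) w"
    using False assms k unfolding step_op_def
    by (auto simp: pos_divide_le_eq mult.commute intro!: divide_right_mono add_mono mult_left_mono add_nonneg_nonneg)
  with assms(1) show ?thesis by simp
qed (use assms in \<open>auto simp: step_op_def\<close>)

lemma hit_prob_le_1:
  assumes "\<beta> > 0" "s \<ge> 0" "s \<le> 1"
  shows "hit_prob \<beta> s T A D n w \<le> 1"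
proof (induction n arbitrary: w)
  case (Suc n)
  have "step_op \<beta> T (hit_prob \<beta> s T A D n) w \<le> 1"
    using assms Suc by (intro step_op_le_const) auto
  with assms have "s * step_op \<beta> T (hit_prob \<beta> s T A D n) w \<le> 1"
    using mult_mono[of s 1 "step_op \<beta> T (hit_prob \<beta> s T A D n) w" 1]
      step_op_nonneg[of \<beta> "hit_prob \<beta> s T A D n"] hit_prob_nonneg[of \<beta> s] by auto
  then show ?case by simp
qed auto

section \<open>Quenched estimates\<close>

lemma surv_root_pos: "surv T \<Longrightarrow> T [] > 0"
  by (subst (asm) surv_iff) auto

lemma backbone_child_pos: "backbone T u \<Longrightarrow> T u > 0"
  using surv_root_pos[of "subtree u T"] by simp

lemma step_op_mono_tree:
  assumes "\<beta> > 0" "surv T" "w \<in> gw_tree T" "\<And>v. v \<in> gw_tree T \<Longrightarrow> f v \<le> g v"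
  shows "step_op \<beta> T f w \<le> step_op \<beta> T g w"
  using assms by (intro step_op_mono) (auto simp: surv_root_pos gw_tree_butlast)

text \<open>With \<open>take_butlast_neq\<close> this says that the subtree of \<open>u\<close> can
  only be entered from outside through \<open>u\<close> itself.\<close>

lemma take_snoc_eq:
  assumes "take (length u) w \<noteq> u" "take (length u) (w @ [i]) = u"
  shows "w @ [i] = u"
  using assms by (cases "length u \<le> length w") auto

lemma take_butlast_neq:
  assumes "take (length u) w \<noteq> u"
  shows "take (length u) (butlast w) \<noteq> u"
proof
  assume *: "take (length u) (butlast w) = u"
  have "length u \<le> length w - 1" using arg_cong[OF *, of length] by simp
  with * assms show False
    by (cases "length u < length w"; cases "w = []") (auto simp: take_butlast)
qed

text \<open>All children are bounded crudely except one, which is known to be special: a backbone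
  child in the drift estimates, the root of a deep trap in \<open>trap_exit_le\<close>.\<close>

lemma sum_le_drop:
  fixes f g :: "nat \<Rightarrow> real"
  assumes "i0 < k" "\<And>i. i < k \<Longrightarrow> f i \<le> g i" "f i0 \<le> g i0 - d"
  shows "(\<Sum>i<k. f i) \<le> (\<Sum>i<k. g i) - d"
proof -
  have "(\<Sum>i\<in>{..<k} - {i0}. f i) \<le> (\<Sum>i\<in>{..<k} - {i0}. g i)"
    using assms(2) by (intro sum_mono) auto
  with assms(1,3) show ?thesis by (simp add: sum.remove[of "{..<k}" i0])
qed

section \<open>Falling back along the backbone\<close>

definition height_decay :: "real \<Rightarrow> (nat list \<Rightarrow> nat) \<Rightarrow> nat \<Rightarrow> nat list \<Rightarrow> real" where
  "height_decay \<beta> T L w = (1 / \<beta>) ^ (backbone_height T w - L)"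

lemma height_decay_nonneg: "\<beta> > 1 \<Longrightarrow> height_decay \<beta> T L w \<ge> 0"
  by (simp add: height_decay_def)

lemma height_decay_le_1: "\<beta> > 1 \<Longrightarrow> height_decay \<beta> T L w \<le> 1"
  by (simp add: height_decay_def power_le_one)

lemma height_decay_eq_1: "backbone_height T w \<le> L \<Longrightarrow> height_decay \<beta> T L w = 1"
  by (simp add: height_decay_def)

text \<open>At a backbone vertex above height \<open>L\<close> with value \<open>x\<close> the
  parent has value \<open>\<beta> * x\<close> and weight 1, while some backbone child has value
  \<open>x / \<beta>\<close> and weight \<open>\<beta>\<close>; these two contribute
  \<open>\<beta> * x + x\<close>, exactly what two neighbours of value \<open>x\<close> would. Other
  children do not exceed \<open>x\<close>, and inside a trap the function is constant. Hence it
  dominates the chance of ever dropping to backbone height \<open>L\<close>.\<close>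

lemma height_decay_superharmonic:
  assumes b: "\<beta> > 1" and s: "surv T" and w: "w \<in> gw_tree T"
  shows "step_op \<beta> T (height_decay \<beta> T L) w \<le> height_decay \<beta> T L w"
proof -
  let ?p = "height_decay \<beta> T L" and ?k = "real (T w)"
  have "?p (butlast w) + \<beta> * (\<Sum>i<T w. ?p (w @ [i])) \<le> (1 + \<beta> * ?k) * (?p w - 0)"
  proof (cases "backbone_height T w \<le> L \<or> w = []")
    case True
    have "(\<Sum>i<T w. ?p (w @ [i])) \<le> (\<Sum>i<T w. 1)"
      using b by (intro sum_mono height_decay_le_1)
    then have "\<beta> * (\<Sum>i<T w. ?p (w @ [i])) \<le> \<beta> * ?k"
      using b by simp
    moreover have "?p w = 1" "?p (butlast w) \<le> 1"
      using True b height_decay_eq_1[of T w L \<beta>] height_decay_le_1 by (auto simp: height_decay_eq_1)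
    ultimately show ?thesis by simp
  next
    case False
    show ?thesis
    proof (cases "backbone T w")
      case True
      then obtain i0 where i0: "i0 < T w" "backbone T (w @ [i0])" using backbone_iff[of w T] by auto
      have "backbone_height T w - L = Suc (backbone_height T (butlast w) - L)"
        using False True backbone_height_butlast[of w T] by auto
      then have par: "?p (butlast w) = \<beta> * ?p w" using b by (simp add: height_decay_def)
      have "backbone_height T (w @ [i0]) - L = Suc (backbone_height T w - L)"
        using i0 False by (auto simp: backbone_height_snoc)
      then have 1: "?p (w @ [i0]) = ?p w - (?p w - ?p w / \<beta>)" by (simp add: height_decay_def)
      have 2: "?p (w @ [i]) \<le> ?p w" for i
        unfolding height_decay_def using b by (intro power_decreasing) (auto simp: backbone_height_snoc)
      have "(\<Sum>i<T w. ?p (w @ [i])) \<le> (\<Sum>i<T w. ?p w) - (?p w - ?p w / \<beta>)"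
        using i0 1 2 by (intro sum_le_drop[of i0]) auto
      then have "\<beta> * (\<Sum>i<T w. ?p (w @ [i])) \<le> \<beta> * (?k * ?p w - (?p w - ?p w / \<beta>))"
        using b by (intro mult_left_mono) auto
      also have "\<dots> = \<beta> * ?k * ?p w - \<beta> * ?p w + ?p w"
        using b by (simp add: algebra_simps)
      finally show ?thesis unfolding par by (simp add: algebra_simps)
    next
      case nb: False
      have "\<not> backbone T (w @ [i])" if "i < T w" for i
        using nb backbone_iff[of w T] that by auto
      then have "(\<Sum>i<T w. ?p (w @ [i])) = (\<Sum>i<T w. ?p w)"
        by (intro sum.cong) (auto simp: height_decay_def backbone_height_snoc)
      moreover have "?p (butlast w) = ?p w"
        using False nb backbone_height_butlast[of w T] by (simp add: height_decay_def)
      ultimately show ?thesis by (simp add: algebra_simps)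
    qed
  qed
  from step_op_le_drift[where f = ?p and c = 0 and w = w and T = T, OF _ _ _ this] b s show ?thesis
    by (simp add: surv_root_pos)
qed

lemma hit_prob_return_le:
  assumes b: "\<beta> > 1" and s: "surv T" and m: "m \<ge> 1" and w: "w \<in> gw_tree T"
  shows "hit_prob \<beta> 1 T {w. backbone_height T w < m} {} n w \<le> height_decay \<beta> T (m - 1) w"
  using w
proof (induction n arbitrary: w)
  case 0
  then show ?case using b height_decay_nonneg[OF b] height_decay_eq_1[of T w "m - 1" \<beta>] m by auto
next
  case (Suc n)
  show ?case
  proof (cases "backbone_height T w < m")
    case True
    then show ?thesis using height_decay_eq_1[of T w "m - 1" \<beta>] by simp
  next
    case False
    have "step_op \<beta> T (hit_prob \<beta> 1 T {w. backbone_height T w < m} {} n) w \<le> step_op \<beta> T (height_decay \<beta> T (m - 1)) w"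
      using b s Suc by (intro step_op_mono_tree) auto
    also have "\<dots> \<le> height_decay \<beta> T (m - 1) w" by (rule height_decay_superharmonic[OF b s Suc.prems])
    finally show ?thesis using False by simp
  qed
qed

text \<open>The probability that within \<open>n\<close> steps the backbone height reaches \<open>2 * m\<close> and later drops below \<open>m\<close>.\<close>
primrec return_prob :: "real \<Rightarrow> (nat list \<Rightarrow> nat) \<Rightarrow> nat \<Rightarrow> nat \<Rightarrow> nat list \<Rightarrow> real" where
  "return_prob \<beta> T m 0 = (\<lambda>w. 0)"
| "return_prob \<beta> T m (Suc n) = (\<lambda>w. if 2 * m \<le> backbone_height T w then hit_prob \<beta> 1 T {w. backbone_height T w < m} {} (Suc n) w
     else step_op \<beta> T (return_prob \<beta> T m n) w)"

text \<open>On reaching backbone height \<open>2 * m\<close> the decay function with threshold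
  \<open>m - 1\<close> is already below the bound; before that time the bound is a constant, which
  the transition operator preserves.\<close>

lemma return_prob_le:
  assumes b: "\<beta> > 1" and s: "surv T" and m: "m \<ge> 1" and w: "w \<in> gw_tree T"
  shows "return_prob \<beta> T m n w \<le> (1 / \<beta>) ^ m"
  using w
proof (induction n arbitrary: w)
  case (Suc n)
  show ?case
  proof (cases "2 * m \<le> backbone_height T w")
    case True
    have "hit_prob \<beta> 1 T {w. backbone_height T w < m} {} (Suc n) w \<le> height_decay \<beta> T (m - 1) w"
      by (rule hit_prob_return_le[OF b s m Suc.prems])
    also have "\<dots> \<le> (1 / \<beta>) ^ m"
      unfolding height_decay_def using b True by (intro power_decreasing) auto
    finally show ?thesis using True by simp
  next
    case False
    have "step_op \<beta> T (return_prob \<beta> T m n) w \<le> step_op \<beta> T (\<lambda>_. (1 / \<beta>) ^ m) w"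
      using b s Suc by (intro step_op_mono_tree) auto
    with False b show ?thesis by simp
  qed
qed (use b in simp)

lemma take_in_backbone_level_iff:
  assumes "surv T" "w \<in> gw_tree T"
  shows "take l w \<in> backbone_level T l \<longleftrightarrow> l \<le> backbone_height T w"
  using le_backbone_height_iff[OF assms, of l] gw_tree_take[OF assms(2), of l]
  by (auto simp: backbone_level_def level_def)

text \<open>The sum is the expected number of distinct backbone vertices of level \<open>l\<close>
  still to be hit, leaving out the one from which \<open>w\<close> descends. To hit another one the
  walk has to fall back below level \<open>l\<close>, which from that level has chance at most
  \<open>1 / \<beta>\<close>. So a first entrance counts one and restarts the count with weight
  \<open>1 / \<beta>\<close>, and the constant is the solution of
  \<open>C = 1 + C / \<beta>\<close>.\<close>

lemma crossing_aux:
  assumes b: "\<beta> > 1" and s: "surv T" and l: "l \<ge> 1" and w: "w \<in> gw_tree T"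
  shows "(\<Sum>u\<in>backbone_level T l. hit_prob \<beta> 1 T {u} {} N w * (if take l w = u then 0 else 1))
     \<le> \<beta> / (\<beta> - 1) * height_decay \<beta> T (l - 1) w"
  using w
proof (induction N arbitrary: w)
  case 0
  have "(\<Sum>u\<in>backbone_level T l. hit_prob \<beta> 1 T {u} {} 0 w * (if take l w = u then 0 else 1)) = 0"
    by (intro sum.neutral) (auto dest: bblD)
  then show ?case using b height_decay_nonneg[OF b, of T "l - 1" w] by simp
next
  case (Suc N)
  let ?C = "\<beta> / (\<beta> - 1)" and ?p = "height_decay \<beta> T (l - 1)"
  let ?h = "\<lambda>u. hit_prob \<beta> 1 T {u} {} N" and ?h' = "\<lambda>u. hit_prob \<beta> 1 T {u} {} (Suc N)"
  let ?o = "\<lambda>u w. ?h u w * (if take l w = u then 0 else 1)"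
  have b0: "\<beta> > 0" using b by simp
  have h01: "0 \<le> hit_prob \<beta> 1 T {u} {} n v" "hit_prob \<beta> 1 T {u} {} n v \<le> 1" for u v n
    using hit_prob_nonneg[OF b0] hit_prob_le_1[OF b0] by auto
  show ?case
  proof (cases "l \<le> backbone_height T w")
    case True
    then have lw: "l \<le> length w" using backbone_height_le_length[of T w] by linarith
    have "?h' u w * (if take l w = u then 0 else 1) \<le> step_op \<beta> T (?o u) w" if u: "u \<in> backbone_level T l" for u
    proof (cases "take l w = u")
      case True
      then show ?thesis using h01 b0 by (auto intro!: step_op_nonneg)
    next
      case False
      have wu: "w \<noteq> u" using False bblD[OF u] by auto
      have par: "take l (butlast w) \<noteq> u" if "w \<noteq> []"
      proof (cases "l < length w")
        case True
        then show ?thesis using False by (simp add: take_butlast)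
      next
        case False
        with lw have "length (take l (butlast w)) = l - 1" by simp
        then show ?thesis using l bblD[OF u] by auto
      qed
      \<comment> \<open>No neighbour of \<open>w\<close> lies in the subtree of \<open>u\<close>, so
        the exclusion factor is one at all of them and the sums with and without exclusion agree
        after one step.\<close>
      have "step_op \<beta> T (?h u) w = step_op \<beta> T (?o u) w"
        using par lw False surv_root_pos[OF s] by (intro step_op_cong) auto
      then show ?thesis using False wu by simp
    qed
    then have "(\<Sum>u\<in>backbone_level T l. ?h' u w * (if take l w = u then 0 else 1))
        \<le> (\<Sum>u\<in>backbone_level T l. step_op \<beta> T (?o u) w)"
      by (rule sum_mono)
    also have "\<dots> = step_op \<beta> T (\<lambda>w. \<Sum>u\<in>backbone_level T l. ?o u w) w"
      by (rule step_op_sum[symmetric])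
    also have "\<dots> \<le> step_op \<beta> T (\<lambda>w. ?C * ?p w) w"
      using b0 s Suc by (intro step_op_mono_tree) auto
    also have "\<dots> = ?C * step_op \<beta> T ?p w" by (rule step_op_cmult)
    also have "\<dots> \<le> ?C * ?p w"
      using b height_decay_superharmonic[OF b s Suc.prems] by (intro mult_left_mono) auto
    finally show ?thesis .
  next
    case False
    then have p1: "?p w = 1" by (intro height_decay_eq_1) auto
    have nb: "take l w \<noteq> u" "w \<noteq> u" if "u \<in> backbone_level T l" for u
      using False take_in_backbone_level_iff[OF s Suc.prems, of l] that bblD[OF that] by auto
    \<comment> \<open>The full sum at a neighbour: if the step enters level \<open>l\<close>, the
      vertex entered adds one, but then the remaining sum carries the factor
      \<open>1 / \<beta>\<close>.\<close>
    have *: "(\<Sum>u\<in>backbone_level T l. ?h u v) \<le> ?C" if v: "v \<in> gw_tree T" for v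
    proof -
      have "(\<Sum>u\<in>backbone_level T l. ?h u v) = (\<Sum>u\<in>backbone_level T l. ?o u v) + (\<Sum>u\<in>backbone_level T l. if take l v = u then ?h u v else 0)"
        by (subst sum.distrib[symmetric], intro sum.cong) auto
      moreover have "(\<Sum>u\<in>backbone_level T l. if take l v = u then ?h u v else 0) \<le> (if l \<le> backbone_height T v then 1 else 0)"
        using h01 take_in_backbone_level_iff[OF s v, of l] by (simp add: sum.delta)
      moreover have "(\<Sum>u\<in>backbone_level T l. ?o u v) \<le> ?C * (if l \<le> backbone_height T v then 1 / \<beta> else 1)"
      proof -
        have "?p v \<le> (if l \<le> backbone_height T v then 1 / \<beta> else 1)"
        proof (cases "l \<le> backbone_height T v")
          case True
          then have "?p v \<le> (1 / \<beta>) ^ 1"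
            unfolding height_decay_def using b l by (intro power_decreasing) auto
          with True show ?thesis by simp
        qed (simp add: height_decay_le_1 b)
        then have "?C * ?p v \<le> ?C * (if l \<le> backbone_height T v then 1 / \<beta> else 1)"
          using b by (intro mult_left_mono) auto
        with Suc.IH[OF v] show ?thesis by linarith
      qed
      moreover have "?C * (1 / \<beta>) + 1 = ?C" using b by (simp add: field_simps)
      ultimately show ?thesis by (auto split: if_splits)
    qed
    have "(\<Sum>u\<in>backbone_level T l. ?h' u w * (if take l w = u then 0 else 1)) = (\<Sum>u\<in>backbone_level T l. step_op \<beta> T (?h u) w)"
      using nb by (intro sum.cong) auto
    also have "\<dots> = step_op \<beta> T (\<lambda>w. \<Sum>u\<in>backbone_level T l. ?h u w) w"
      by (rule step_op_sum[symmetric])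
    also have "\<dots> \<le> step_op \<beta> T (\<lambda>_. ?C) w"
      using b0 s Suc.prems * by (intro step_op_mono_tree) auto
    finally show ?thesis using p1 b0 by simp
  qed
qed

lemma sum_hit_prob_backbone_level_le:
  assumes b: "\<beta> > 1" and s: "surv T"
  shows "(\<Sum>u\<in>backbone_level T l. hit_prob \<beta> 1 T {u} {} N []) \<le> \<beta> / (\<beta> - 1)"
proof (cases "l = 0")
  case True
  then have "backbone_level T l = {[]}" using s by (auto simp: backbone_level_def level_def)
  then show ?thesis using b by (simp add: field_simps)
next
  case False
  have "(\<Sum>u\<in>backbone_level T l. hit_prob \<beta> 1 T {u} {} N []) =
    (\<Sum>u\<in>backbone_level T l. hit_prob \<beta> 1 T {u} {} N [] * (if take l [] = u then 0 else 1))"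
    using False by (intro sum.cong) (auto dest: bblD)
  with crossing_aux[OF b s, of l "[]" N] False height_decay_eq_1[of T "[]" "l - 1" \<beta>] show ?thesis by simp
qed

section \<open>Occupation time of a backbone vertex together with its traps\<close>

text \<open>The expected time from the root of a trap of height less than \<open>h\<close> to the vertex it is attached to.\<close>
primrec trap_time :: "real \<Rightarrow> nat \<Rightarrow> (nat list \<Rightarrow> nat) \<Rightarrow> real" where
  "trap_time \<beta> 0 T = 0"
| "trap_time \<beta> (Suc h) T = 1 + \<beta> * real (T []) + \<beta> * (\<Sum>i<T []. trap_time \<beta> h (subtree [i] T))"

text \<open>The expectation of the sum of \<open>c\<close> over the first \<open>n + 1\<close> positions of the walk.\<close>
primrec occupation :: "real \<Rightarrow> (nat list \<Rightarrow> nat) \<Rightarrow> (nat list \<Rightarrow> real) \<Rightarrow> nat \<Rightarrow> nat list \<Rightarrow> real" where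
  "occupation \<beta> T c 0 = c"
| "occupation \<beta> T c (Suc n) = (\<lambda>w. c w + step_op \<beta> T (occupation \<beta> T c n) w)"

text \<open>Bounds the expected time that a walk started at a backbone vertex ever spends in that vertex and in
  the traps attached to it, if these have height less than \<open>h\<close>.\<close>
definition green :: "real \<Rightarrow> nat \<Rightarrow> (nat list \<Rightarrow> nat) \<Rightarrow> real" where
  "green \<beta> h T = (1 + \<beta> * real (T []) +
     \<beta> * (\<Sum>i<T []. if surv (subtree [i] T) then 0 else trap_time \<beta> h (subtree [i] T))) / (\<beta> - 1)"

lemma trap_time_nonneg: "\<beta> > 0 \<Longrightarrow> trap_time \<beta> h T \<ge> 0"
  by (induction h arbitrary: T) (auto intro!: add_nonneg_nonneg mult_nonneg_nonneg sum_nonneg)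

text \<open>The expected time to climb from \<open>w\<close> to its ancestor of level
  \<open>l\<close>, as a sum of passage times over the edges of the path. The trap root at level
  \<open>l + 1\<close> gets the truncation height \<open>h\<close>, and each further level one less,
  as the height left in the trap.\<close>

definition trap_time_sum :: "real \<Rightarrow> nat \<Rightarrow> nat \<Rightarrow> (nat list \<Rightarrow> nat) \<Rightarrow> nat list \<Rightarrow> real" where
  "trap_time_sum \<beta> h l T w = (\<Sum>j\<in>{l<..length w}. trap_time \<beta> (h + l + 1 - j) (subtree (take j w) T))"

lemma trap_time_sum_snoc:
  assumes "l \<le> length v"
  shows "trap_time_sum \<beta> h l T (v @ [i]) = trap_time_sum \<beta> h l T v + trap_time \<beta> (h + l - length v) (subtree (v @ [i]) T)"
proof -
  have "{l<..length (v @ [i])} = insert (Suc (length v)) {l<..length v}" using assms by auto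
  then show ?thesis by (simp add: trap_time_sum_def)
qed

text \<open>Read forwards it finds a deep trap whenever the walk is far from the backbone; read
  backwards it bounds how deep the walk can be when all traps are shallow.\<close>

lemma trap_depth:
  assumes s: "surv T" and w: "w \<in> gw_tree T" and l: "backbone_height T w = l" "length w > l"
  shows "w ! l < T (take l w)" "\<not> backbone T (take l w @ [w ! l])"
    "alive (length w - Suc l) (subtree (take l w @ [w ! l]) T)"
proof -
  have eq: "take (Suc l) w = take l w @ [w ! l]"
    using l by (simp add: take_Suc_conv_app_nth)
  show "w ! l < T (take l w)"
    using w l by (simp add: gw_tree_def)
  show "\<not> backbone T (take l w @ [w ! l])"
    using le_backbone_height_iff[OF s w, of "Suc l"] l by (simp add: eq)
  have "take (Suc l) w @ drop (Suc l) w \<in> gw_tree T" using w by simp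
  then have "drop (Suc l) w \<in> gw_tree (subtree (take (Suc l) w) T)"
    by (subst (asm) gw_tree_append) simp
  then show "alive (length w - Suc l) (subtree (take l w @ [w ! l]) T)"
    by (auto simp: alive_iff eq intro!: bexI[of _ "drop (Suc l) w"])
qed

lemma cluster_iff:
  "length u = l \<Longrightarrow> take (backbone_height T w) w = u \<longleftrightarrow> take l w = u \<and> backbone_height T w = l"
  using backbone_height_le_length[of T w] by auto

text \<open>Dominates the expected time still to be spent in the cluster of \<open>u\<close>, the
  positions whose last backbone ancestor is \<open>u\<close>. Inside a trap of \<open>u\<close> it
  is the climb to \<open>u\<close> plus a fresh start there; higher up the backbone it is a fresh
  start weighted by the chance of falling back; outside the subtree it is the fresh start
  alone.\<close>

definition cluster_potential :: "real \<Rightarrow> nat \<Rightarrow> (nat list \<Rightarrow> nat) \<Rightarrow> nat list \<Rightarrow> nat list \<Rightarrow> real" where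
  "cluster_potential \<beta> h T u w = (if take (length u) w = u
     then green \<beta> h (subtree u T) * height_decay \<beta> T (length u) w
       + (if backbone_height T w = length u then trap_time_sum \<beta> h (length u) T w else 0)
     else green \<beta> h (subtree u T))"

text \<open>In a trap the climbing time drops by one per step on average; above the cluster the
  potential is a multiple of \<open>height_decay\<close>. At \<open>u\<close> itself the step to the
  parent gains nothing, and the whole drift comes from one backbone child, where the potential falls
  by the factor \<open>\<beta>\<close>.\<close>

lemma cluster_potential_drift:
  assumes b: "\<beta> > 1" and s: "surv T" and uT: "u \<in> gw_tree T" and ub: "backbone T u"
    and trap: "\<And>i. i < T u \<Longrightarrow> \<not> backbone T (u @ [i]) \<Longrightarrow> \<not> alive h (subtree (u @ [i]) T)"
    and w: "w \<in> gw_tree T" and uw: "take (length u) w = u"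
  shows "step_op \<beta> T (cluster_potential \<beta> h T u) w \<le> cluster_potential \<beta> h T u w - (if take (backbone_height T w) w = u then 1 else 0)"
proof -
  define l where "l = length u"
  define G where "G = green \<beta> h (subtree u T)"
  let ?g = "cluster_potential \<beta> h T u" and ?k = "real (T w)"
  have b0: "\<beta> > 0" using b by simp
  have uw': "take l w = u" using uw by (simp add: l_def)
  then have lw: "l \<le> length w" unfolding l_def by (metis length_take min.cobounded1 uw)
  have g: "?g v = (if take l v = u then G * height_decay \<beta> T l v + (if backbone_height T v = l then trap_time_sum \<beta> h l T v else 0) else G)" for v
    by (simp add: cluster_potential_def l_def G_def)
  have child: "take l (w @ [i]) = u" for i using uw' lw by simp
  have par: "take l (butlast w) = u" if "w \<noteq> u"
  proof -
    have "length w > l" using that uw' lw by (cases "length w = l") auto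
    then show ?thesis using uw' by (simp add: take_butlast)
  qed
  have r: "w \<noteq> [] \<or> T [] > 0" using surv_root_pos[OF s] by simp
  have "u \<in> backbone_level T l" using uT ub by (simp add: backbone_level_def level_def l_def)
  then have "l \<le> backbone_height T w" using take_in_backbone_level_iff[OF s w, of l] uw' by simp
  then consider (a) "w = u" | (b) "w \<noteq> u" "backbone_height T w = l" | (c) "backbone_height T w > l"
    by linarith
  then show ?thesis
  proof cases
    case a
    have bhu: "backbone_height T u = l" using backbone_height_backbone[OF s uT ub] by (simp add: l_def)
    have gu: "?g w = G" using a uw' bhu by (simp add: g height_decay_eq_1 trap_time_sum_def l_def)
    have gp: "?g (butlast w) = G"
    proof (cases "w = []")
      case False
      have "length (take l (butlast w)) < length u" using a False by (cases u rule: rev_cases) (auto simp: l_def)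
      then have "take l (butlast w) \<noteq> u" by auto
      then show ?thesis by (simp add: g)
    qed (use gu in simp)
    let ?e = "\<lambda>i. G + (if backbone T (u @ [i]) then 0 else trap_time \<beta> h (subtree (u @ [i]) T))"
    obtain i0 where i0: "i0 < T u" "backbone T (u @ [i0])" using ub backbone_iff[of u T] by auto
    \<comment> \<open>\<open>green\<close> is chosen to satisfy this balance: the gain at one
      backbone child pays for the time at \<open>u\<close> and for the climbs out of all its
      traps.\<close>
    have G0: "(\<beta> - 1) * G = 1 + \<beta> * ?k + \<beta> * (\<Sum>i<T u. if backbone T (u @ [i]) then 0 else trap_time \<beta> h (subtree (u @ [i]) T))"
      using b a by (simp add: G_def green_def cong: if_cong)
    have Gpos: "G \<ge> 0" unfolding G_def green_def
      using b by (auto intro!: divide_nonneg_nonneg add_nonneg_nonneg mult_nonneg_nonneg sum_nonneg trap_time_nonneg)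
    have gc: "?g (w @ [i]) = (if backbone T (u @ [i]) then G / \<beta> else G + trap_time \<beta> h (subtree (u @ [i]) T))" for i
      using child[of i] a bhu by (simp add: g height_decay_def backbone_height_snoc trap_time_sum_snoc l_def) (simp add: trap_time_sum_def)
    have "G / \<beta> \<le> G" using b Gpos mult_right_mono[of 1 \<beta> G] by (simp add: pos_divide_le_eq mult.commute)
    then have "(\<Sum>i<T u. ?g (w @ [i])) \<le> (\<Sum>i<T u. ?e i) - (G - G / \<beta>)"
      using i0 by (intro sum_le_drop[of i0]) (auto simp: gc)
    also have "(\<Sum>i<T u. ?e i) = ?k * G + (\<Sum>i<T u. if backbone T (u @ [i]) then 0 else trap_time \<beta> h (subtree (u @ [i]) T))"
      using a by (simp add: sum.distrib)
    finally have "\<beta> * (\<Sum>i<T u. ?g (w @ [i])) \<le> \<beta> * (?k * G +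
      (\<Sum>i<T u. if backbone T (u @ [i]) then 0 else trap_time \<beta> h (subtree (u @ [i]) T)) - (G - G / \<beta>))"
      using b0 by (intro mult_left_mono) auto
    also have "\<dots> = \<beta> * ?k * G + ((\<beta> - 1) * G - 1 - \<beta> * ?k) - \<beta> * G + G"
      unfolding G0 using b0 by (simp add: algebra_simps)
    finally have "?g (butlast w) + \<beta> * (\<Sum>i<T w. ?g (w @ [i])) \<le> (1 + \<beta> * ?k) * (?g w - 1)"
      unfolding gu gp using a by (simp add: algebra_simps)
    from step_op_le_drift[where f = ?g and c = 1 and w = w and T = T, OF b0 r _ this] show ?thesis using a bhu uw' by simp
  next
    case b
    have wl: "length w > l" using b uw' lw by (cases "length w = l") auto
    have nb: "\<not> backbone T w" using backbone_iff_backbone_height[OF s w] b wl by auto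
    have nbc: "\<not> backbone T (w @ [i])" if "i < T w" for i
      using nb backbone_iff[of w T] that by auto
    have "\<not> alive h (subtree (u @ [w ! l]) T)"
      using trap_depth[OF s w b(2) wl] trap uw' by auto
    then have "length w - Suc l < h"
      using trap_depth(3)[OF s w b(2) wl] alive_antimono uw' by (metis linorder_not_less)
    \<comment> \<open>Since all traps at \<open>u\<close> have height less than \<open>h\<close>,
      the truncation height at \<open>w\<close> is still positive, so \<open>trap_time\<close>
      unfolds by its recursion and not to its value zero.\<close>
    then have idx: "h + l - length (butlast w) = Suc (h + l - length w)" using wl by auto
    have bhp: "backbone_height T (butlast w) = l" using backbone_height_butlast[of w T] wl nb b by (cases "w = []") auto
    have tw: "trap_time_sum \<beta> h l T w = trap_time_sum \<beta> h l T (butlast w) + trap_time \<beta> (Suc (h + l - length w)) (subtree w T)"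
      using trap_time_sum_snoc[of l "butlast w" \<beta> h T "last w"] wl idx
      by (subgoal_tac "w \<noteq> []") auto
    have gw: "?g w = G + trap_time_sum \<beta> h l T w" using uw' b by (simp add: g height_decay_eq_1)
    have gp: "?g (butlast w) = G + trap_time_sum \<beta> h l T (butlast w)"
      using par b bhp by (simp add: g height_decay_eq_1)
    have gc: "?g (w @ [i]) = ?g w + trap_time \<beta> (h + l - length w) (subtree (w @ [i]) T)" if "i < T w" for i
      using child[of i] b lw nbc[OF that] gw by (simp add: g height_decay_def backbone_height_snoc trap_time_sum_snoc)
    have "(\<Sum>i<T w. ?g (w @ [i])) = ?k * ?g w + (\<Sum>i<T w. trap_time \<beta> (h + l - length w) (subtree (w @ [i]) T))"
      using gc by (simp add: sum.distrib)
    then have "?g (butlast w) + \<beta> * (\<Sum>i<T w. ?g (w @ [i])) \<le> (1 + \<beta> * ?k) * (?g w - 1)"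
      using gp gw tw by (simp add: algebra_simps)
    from step_op_le_drift[where f = ?g and c = 1 and w = w and T = T, OF b0 r _ this] show ?thesis using b uw' by simp
  next
    case c
    \<comment> \<open>From backbone height above \<open>l\<close> a neighbour has backbone height
      \<open>l\<close> only if it is \<open>u\<close>, where the climbing time is an empty
      sum.\<close>
    have gv: "?g v = G * height_decay \<beta> T l v" if "take l v = u" "backbone_height T v = l \<Longrightarrow> length v = l" for v
      using that by (auto simp: g trap_time_sum_def)
    have "step_op \<beta> T ?g w = step_op \<beta> T (\<lambda>v. G * height_decay \<beta> T l v) w"
    proof (intro step_op_cong)
      show "w = [] \<Longrightarrow> T [] = 0 \<Longrightarrow> ?g [] = G * height_decay \<beta> T l []" using c by simp
      show "w \<noteq> [] \<Longrightarrow> ?g (butlast w) = G * height_decay \<beta> T l (butlast w)"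
      proof (rule gv)
        assume ne: "w \<noteq> []"
        have "w \<noteq> u" using c backbone_height_le_length[of T w] by (auto simp: l_def)
        then show "take l (butlast w) = u" by (rule par)
        assume "backbone_height T (butlast w) = l"
        then have "backbone T w" using c backbone_height_butlast[OF ne, of T] by (auto split: if_splits)
        then show "length (butlast w) = l"
          using backbone_height_backbone[OF s w] backbone_height_butlast[OF ne, of T] \<open>backbone_height T (butlast w) = l\<close> by simp
      qed
      show "?g (w @ [i]) = G * height_decay \<beta> T l (w @ [i])" for i
        using child[of i] c by (intro gv) (auto simp: backbone_height_snoc split: if_splits)
    qed
    also have "\<dots> = G * step_op \<beta> T (height_decay \<beta> T l) w" by (rule step_op_cmult)
    also have "\<dots> \<le> G * height_decay \<beta> T l w"
    proof (rule mult_left_mono[OF height_decay_superharmonic[OF assms(1) s w]])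
      show "G \<ge> 0" unfolding G_def green_def
        using assms(1) by (auto intro!: divide_nonneg_nonneg add_nonneg_nonneg mult_nonneg_nonneg sum_nonneg trap_time_nonneg)
    qed
    also have "\<dots> = ?g w" using uw' c gv[of w] by simp
    finally show ?thesis using c cluster_iff[of u l T w] by (simp add: l_def)
  qed
qed

text \<open>Outside the subtree of \<open>u\<close> nothing is counted until \<open>u\<close> is
  hit, and the potential at \<open>u\<close> equals \<open>green\<close>. This yields the product of
  a hitting probability and a function of the subtree of \<open>u\<close>.\<close>

lemma occupation_cluster_le:
  assumes b: "\<beta> > 1" and s: "surv T" and uT: "u \<in> gw_tree T" and ub: "backbone T u"
    and trap: "\<And>i. i < T u \<Longrightarrow> \<not> backbone T (u @ [i]) \<Longrightarrow> \<not> alive h (subtree (u @ [i]) T)"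
    and w: "w \<in> gw_tree T"
  shows "occupation \<beta> T (\<lambda>w. if take (backbone_height T w) w = u then 1 else 0) n w
    \<le> (if take (length u) w = u then cluster_potential \<beta> h T u w
       else green \<beta> h (subtree u T) * hit_prob \<beta> 1 T {u} {} n w)"
  using w
proof (induction n arbitrary: w)
  let ?G = "green \<beta> h (subtree u T)"
  let ?c = "\<lambda>w. if take (backbone_height T w) w = u then 1 else 0 :: real"
  have b0: "\<beta> > 0" using b by simp
  have bhu: "backbone_height T u = length u" using backbone_height_backbone[OF s uT ub] .
  have "1 \<le> 1 + \<beta> * real (T u)" using b by simp
  moreover have "\<beta> * 1 \<le> \<beta> * real (T u)" using b0 backbone_child_pos[OF ub] by (intro mult_left_mono) auto
  moreover have "0 \<le> \<beta> * (\<Sum>i<T u. if backbone T (u @ [i]) then 0 else trap_time \<beta> h (subtree (u @ [i]) T))"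
    using b0 by (auto intro!: mult_nonneg_nonneg sum_nonneg trap_time_nonneg)
  ultimately have "\<beta> - 1 \<le> 1 + \<beta> * real (T u) +
      \<beta> * (\<Sum>i<T u. if backbone T (u @ [i]) then 0 else trap_time \<beta> h (subtree (u @ [i]) T))"
    by linarith
  \<comment> \<open>Covers the horizon zero, where standing at \<open>u\<close> already counts
    one.\<close>
  then have G1: "?G \<ge> 1" unfolding green_def using b by (simp add: pos_le_divide_eq cong: if_cong)
  have nc: "?c w = 0" if "take (length u) w \<noteq> u" for w
    using that cluster_iff[of u "length u" T w] by auto
  {
    case 0
    have "trap_time_sum \<beta> h (length u) T w \<ge> 0" unfolding trap_time_sum_def using b0 by (intro sum_nonneg trap_time_nonneg)
    then show ?case
      using nc[of w] G1 cluster_iff[of u "length u" T w] height_decay_nonneg[OF b, of T "length u" w]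
        hit_prob_nonneg[OF b0, of 1 T "{u}" "{}" 0 w]
      by (auto simp: cluster_potential_def height_decay_eq_1)
  next
    case (Suc n)
    have hn: "hit_prob \<beta> 1 T {u} {} n v \<ge> 0" "hit_prob \<beta> 1 T {u} {} n v \<le> 1" for v
      using hit_prob_nonneg[OF b0] hit_prob_le_1[OF b0] by auto
    show ?case
    proof (cases "take (length u) w = u")
      case True
      have "occupation \<beta> T ?c n v \<le> cluster_potential \<beta> h T u v" if "v \<in> gw_tree T" for v
      proof (cases "take (length u) v = u")
        case False
        have "?G * hit_prob \<beta> 1 T {u} {} n v \<le> ?G * 1" using G1 hn by (intro mult_left_mono) auto
        with Suc.IH[OF that] False show ?thesis by (simp add: cluster_potential_def)
      qed (use Suc.IH[OF that] in simp)
      then have "step_op \<beta> T (occupation \<beta> T ?c n) w \<le> step_op \<beta> T (cluster_potential \<beta> h T u) w"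
        using b0 s Suc.prems by (intro step_op_mono_tree) auto
      also have "\<dots> \<le> cluster_potential \<beta> h T u w - ?c w"
        by (rule cluster_potential_drift[OF b s uT ub trap Suc.prems True])
      finally show ?thesis using True by simp
    next
      case False
      have nu: "w \<noteq> u" using False by auto
      have main: "occupation \<beta> T ?c n v \<le> ?G * hit_prob \<beta> 1 T {u} {} n v"
        if "v \<in> gw_tree T" "take (length u) v = u \<Longrightarrow> v = u" for v
      proof (cases "take (length u) v = u")
        case True
        with that have "v = u" by simp
        with Suc.IH[OF that(1)] True bhu show ?thesis
          by (simp add: cluster_potential_def height_decay_eq_1 trap_time_sum_def)
      qed (use Suc.IH[OF that(1)] in simp)
      have "step_op \<beta> T (occupation \<beta> T ?c n) w \<le> step_op \<beta> T (\<lambda>v. ?G * hit_prob \<beta> 1 T {u} {} n v) w"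
      proof (rule step_op_mono[OF b0 Suc.prems surv_root_pos[OF s]])
        show "occupation \<beta> T ?c n (butlast w) \<le> ?G * hit_prob \<beta> 1 T {u} {} n (butlast w)"
        proof (rule main)
          assume "take (length u) (butlast w) = u"
          then have *: "take (length u) (butlast w) = u" .
          have "length u \<le> length w - 1"
            using arg_cong[OF *, of length] by simp
          with * False have False
            by (cases "length u < length w"; cases "w = []") (auto simp: take_butlast)
          then show "butlast w = u" ..
        qed (use Suc.prems gw_tree_butlast in blast)
        show "occupation \<beta> T ?c n (w @ [i]) \<le> ?G * hit_prob \<beta> 1 T {u} {} n (w @ [i])" if "i < T w" for i
        proof (rule main)
          assume "take (length u) (w @ [i]) = u"
          with False show "w @ [i] = u"
            by (cases "length u \<le> length w") (auto simp: take_append)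
        qed (use Suc.prems that in simp)
      qed
      also have "\<dots> = ?G * step_op \<beta> T (hit_prob \<beta> 1 T {u} {} n) w" by (rule step_op_cmult)
      finally show ?thesis using False nu nc[OF False] by simp
    qed
  }
qed

lemma occupation_cluster_root_le:
  assumes b: "\<beta> > 1" and s: "surv T" and uT: "u \<in> gw_tree T" and ub: "backbone T u"
    and trap: "\<And>i. i < T u \<Longrightarrow> \<not> backbone T (u @ [i]) \<Longrightarrow> \<not> alive h (subtree (u @ [i]) T)"
  shows "occupation \<beta> T (\<lambda>w. if take (backbone_height T w) w = u then 1 else 0) n []
    \<le> green \<beta> h (subtree u T) * hit_prob \<beta> 1 T {u} {} n []"
  using occupation_cluster_le[OF b s uT ub trap, of "[]" n]
  by (auto simp: cluster_potential_def height_decay_eq_1 trap_time_sum_def split: if_splits)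

section \<open>The killed walk: transforms of exit times and passage between levels\<close>

text \<open>An upper bound for the expectation of \<open>s ^ \<tau>\<close>, where \<open>\<tau>\<close> is the time from the root of a trap to the
  vertex it is attached to; below depth \<open>h\<close> the killing is ignored.\<close>
primrec trap_exit :: "real \<Rightarrow> real \<Rightarrow> nat \<Rightarrow> (nat list \<Rightarrow> nat) \<Rightarrow> real" where
  "trap_exit \<beta> s 0 T = 1"
| "trap_exit \<beta> s (Suc h) T = s / (1 + \<beta> * real (T []) - s * \<beta> * (\<Sum>i<T []. trap_exit \<beta> s h (subtree [i] T)))"

lemma trap_exit_bounds:
  assumes b: "\<beta> > 1" and s: "0 < s" "s \<le> 1"
  shows "0 < trap_exit \<beta> s h T \<and> trap_exit \<beta> s h T \<le> 1"
    and "1 \<le> 1 + \<beta> * real (T []) - s * \<beta> * (\<Sum>i<T []. trap_exit \<beta> s h (subtree [i] T))"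
proof -
  have den: "1 \<le> 1 + \<beta> * real (T []) - s * \<beta> * (\<Sum>i<T []. trap_exit \<beta> s h (subtree [i] T))"
    if "\<And>T. trap_exit \<beta> s h T \<le> 1" "\<And>T. 0 < trap_exit \<beta> s h T" for h T
  proof -
    have "(\<Sum>i<T []. trap_exit \<beta> s h (subtree [i] T)) \<le> (\<Sum>i<T []. 1)" by (intro sum_mono that)
    moreover have "0 \<le> (\<Sum>i<T []. trap_exit \<beta> s h (subtree [i] T))" by (intro sum_nonneg less_imp_le that)
    ultimately have "(s * \<beta>) * (\<Sum>i<T []. trap_exit \<beta> s h (subtree [i] T)) \<le> (1 * \<beta>) * real (T [])"
      using s b by (intro mult_mono) auto
    then show ?thesis by simp
  qed
  show 1: "0 < trap_exit \<beta> s h T \<and> trap_exit \<beta> s h T \<le> 1" for h T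
  proof (induction h arbitrary: T)
    case (Suc h)
    then have "1 \<le> 1 + \<beta> * real (T []) - s * \<beta> * (\<Sum>i<T []. trap_exit \<beta> s h (subtree [i] T))"
      by (intro den) auto
    with s show ?case by (auto simp: divide_le_eq)
  qed simp
  show "1 \<le> 1 + \<beta> * real (T []) - s * \<beta> * (\<Sum>i<T []. trap_exit \<beta> s h (subtree [i] T))"
    using 1 by (intro den) auto
qed

text \<open>The factor by which the killed walk loses mass between its first visits to two successive backbone
  levels, as seen from the first vertex; only the killing in the traps of that vertex is counted.\<close>
definition level_factor :: "real \<Rightarrow> real \<Rightarrow> nat \<Rightarrow> (nat list \<Rightarrow> nat) \<Rightarrow> real" where
  "level_factor \<beta> s h T = 1 - \<beta> / (1 + \<beta> * real (T [])) *
     (\<Sum>i<T []. if surv (subtree [i] T) then 0 else 1 - trap_exit \<beta> s h (subtree [i] T))"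

lemma level_factor_bounds:
  assumes b: "\<beta> > 1" and s: "0 < s" "s \<le> 1"
  shows "0 \<le> level_factor \<beta> s h T" "level_factor \<beta> s h T \<le> 1"
proof -
  let ?S = "\<Sum>i<T []. if surv (subtree [i] T) then 0 else 1 - trap_exit \<beta> s h (subtree [i] T)"
  have r: "0 < trap_exit \<beta> s h T'" "trap_exit \<beta> s h T' \<le> 1" for T' using trap_exit_bounds(1)[OF assms] by auto
  have "?S \<le> (\<Sum>i<T []. 1)" using r by (intro sum_mono) (auto intro: less_imp_le)
  then have "\<beta> * ?S \<le> \<beta> * real (T [])" using b by (intro mult_left_mono) auto
  then have "\<beta> * ?S \<le> 1 + \<beta> * real (T [])" by linarith
  then have "\<beta> / (1 + \<beta> * real (T [])) * ?S \<le> 1"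
    using b by (simp add: pos_divide_le_eq add_pos_nonneg)
  then show "0 \<le> level_factor \<beta> s h T" by (simp add: level_factor_def)
  have "0 \<le> ?S" using r by (intro sum_nonneg) auto
  then have "0 \<le> \<beta> / (1 + \<beta> * real (T [])) * ?S"
    using b by (intro mult_nonneg_nonneg divide_nonneg_nonneg) auto
  then show "level_factor \<beta> s h T \<le> 1" by (simp add: level_factor_def)
qed

text \<open>The multiplicative counterpart of \<open>trap_time_sum\<close>: the transform of the
  climb from \<open>w\<close> to level \<open>m\<close> is bounded by the product over the edges of
  the path. Below relative depth \<open>h\<close> the factors are one.\<close>

definition trap_exit_prod :: "real \<Rightarrow> real \<Rightarrow> nat \<Rightarrow> nat \<Rightarrow> (nat list \<Rightarrow> nat) \<Rightarrow> nat list \<Rightarrow> real" where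
  "trap_exit_prod \<beta> s h m T w = (\<Prod>j\<in>{m<..length w}. trap_exit \<beta> s (h + m + 1 - j) (subtree (take j w) T))"

lemma trap_exit_prod_snoc:
  assumes "m \<le> length v"
  shows "trap_exit_prod \<beta> s h m T (v @ [i]) = trap_exit_prod \<beta> s h m T v * trap_exit \<beta> s (h + m - length v) (subtree (v @ [i]) T)"
proof -
  have "{m<..length (v @ [i])} = insert (Suc (length v)) {m<..length v}" using assms by auto
  then show ?thesis by (simp add: trap_exit_prod_def)
qed

text \<open>The bound depends on where the walk stands. Below level \<open>m\<close> it is
  decomposed at the first vertex of level \<open>m\<close> that is entered. In a trap attached at
  level \<open>m\<close> the walk must climb out first, and the vertex above is given the value one.
  At a backbone vertex of level \<open>m\<close> a single step is examined, in which entering a trap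
  costs its exit transform.\<close>

lemma killed_hit_next_level:
  assumes b: "\<beta> > 1" and s: "0 < s" "s \<le> 1" and sv: "surv T" and w: "w \<in> gw_tree T"
  shows "hit_prob \<beta> s T {w. Suc m \<le> backbone_height T w} {} N w \<le>
    (if backbone_height T w < m then \<Sum>u\<in>backbone_level T m. level_factor \<beta> s h (subtree u T) * hit_prob \<beta> s T {u} (backbone_level T m - {u}) N w
     else if backbone_height T w = m then (if length w = m then level_factor \<beta> s h (subtree w T) else trap_exit_prod \<beta> s h m T w)
     else 1)"
  using w
proof (induction N arbitrary: w)
  case 0
  have "0 \<le> trap_exit_prod \<beta> s h m T w"
    unfolding trap_exit_prod_def using trap_exit_bounds(1)[OF b s] by (intro prod_nonneg) (auto intro: less_imp_le)
  moreover have "0 \<le> (\<Sum>u\<in>backbone_level T m. level_factor \<beta> s h (subtree u T) * hit_prob \<beta> s T {u} (backbone_level T m - {u}) 0 w)"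
    using level_factor_bounds[OF b s] by (intro sum_nonneg) auto
  ultimately show ?case using level_factor_bounds[OF b s] by auto
next
  case (Suc N)
  let ?v = "hit_prob \<beta> s T {w. Suc m \<le> backbone_height T w} {} N"
  let ?H = "\<lambda>u. hit_prob \<beta> s T {u} (backbone_level T m - {u})"
  let ?K = "\<lambda>u. level_factor \<beta> s h (subtree u T)"
  let ?R = "trap_exit_prod \<beta> s h m T"
  have b0: "\<beta> > 0" using b by simp
  have s0: "0 \<le> s" using s by simp
  have v01: "0 \<le> ?v x" "?v x \<le> 1" for x
    using hit_prob_nonneg[OF b0 s0] hit_prob_le_1[OF b0 s0 s(2)] by auto
  have root: "T [] > 0" by (rule surv_root_pos[OF sv])
  consider (a) "backbone_height T w < m" | (b) "backbone_height T w = m" "length w = m" | (c) "backbone_height T w = m" "length w > m"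
    | (d) "backbone_height T w > m"
    using backbone_height_le_length[of T w] by linarith
  then show ?case
  proof cases
    case a
    have nw: "w \<notin> backbone_level T m" using a backbone_height_backbone_level[OF sv, of w m] by auto
    have *: "?v x \<le> (\<Sum>u\<in>backbone_level T m. ?K u * ?H u N x)"
      if x: "x \<in> gw_tree T" and xb: "backbone_height T x < m \<or> x \<in> backbone_level T m" for x
    proof (cases "x \<in> backbone_level T m")
      case True
      then have "?v x \<le> ?K x"
        using Suc.IH[OF x] backbone_height_backbone_level[OF sv True] bblD[OF True] by simp
      also have "\<dots> = ?K x * ?H x N x" by simp
      also have "\<dots> \<le> (\<Sum>u\<in>backbone_level T m. ?K u * ?H u N x)"
        using True level_factor_bounds[OF b s] hit_prob_nonneg[OF b0 s0]
        by (intro member_le_sum) auto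
      finally show ?thesis .
    next
      case False
      with xb Suc.IH[OF x] show ?thesis by simp
    qed
    have bp: "backbone_height T (butlast w) < m" if "w \<noteq> []"
      using a backbone_height_butlast[OF that, of T] by simp
    have bc: "backbone_height T (w @ [i]) < m \<or> w @ [i] \<in> backbone_level T m" if "i < T w" for i
    proof (cases "backbone T (w @ [i])")
      case True
      have T: "w @ [i] \<in> gw_tree T" using that Suc.prems by simp
      show ?thesis using backbone_height_backbone[OF sv T True] a T True
        by (auto simp: backbone_height_snoc backbone_level_def level_def)
    qed (use a in \<open>simp add: backbone_height_snoc\<close>)
    have "step_op \<beta> T ?v w \<le> step_op \<beta> T (\<lambda>x. \<Sum>u\<in>backbone_level T m. ?K u * ?H u N x) w"
      using bp bc Suc.prems by (intro step_op_mono[OF b0 Suc.prems root] *) (auto simp: gw_tree_butlast)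
    also have "\<dots> = (\<Sum>u\<in>backbone_level T m. ?K u * step_op \<beta> T (?H u N) w)"
      by (simp add: step_op_sum step_op_cmult)
    finally have "s * step_op \<beta> T ?v w \<le> s * (\<Sum>u\<in>backbone_level T m. ?K u * step_op \<beta> T (?H u N) w)"
      using s0 by (rule mult_left_mono)
    also have "\<dots> = (\<Sum>u\<in>backbone_level T m. ?K u * ?H u (Suc N) w)"
      unfolding sum_distrib_left using nw by (intro sum.cong) auto
    finally show ?thesis using a by simp
  next
    case b
    let ?k = "real (T w)"
    have wb: "backbone T w" using backbone_iff_backbone_height[OF sv Suc.prems] b by simp
    \<comment> \<open>The parent and the backbone children are given the trivial value one, so only
      the killing in the traps of \<open>w\<close> is retained; the drop of \<open>f\<close> at
      \<open>w\<close> is then \<open>1 - level_factor\<close>.\<close>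
    define f where "f x = (if length x \<le> m \<or> backbone T x then 1 else trap_exit \<beta> s h (subtree x T))" for x
    have "step_op \<beta> T ?v w \<le> step_op \<beta> T f w"
    proof (rule step_op_mono[OF b0 Suc.prems root])
      show "?v (butlast w) \<le> f (butlast w)" using v01 b by (simp add: f_def)
      fix i assume i: "i < T w"
      show "?v (w @ [i]) \<le> f (w @ [i])"
      proof (cases "backbone T (w @ [i])")
        case False
        have "?v (w @ [i]) \<le> ?R (w @ [i])"
          using Suc.IH[of "w @ [i]"] Suc.prems i b False by (simp add: backbone_height_snoc)
        also have "\<dots> = trap_exit \<beta> s h (subtree (w @ [i]) T)"
          using b by (simp add: trap_exit_prod_snoc) (simp add: trap_exit_prod_def)
        finally show ?thesis using False b by (simp add: f_def)
      qed (use v01 in \<open>simp add: f_def\<close>)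
    qed
    also have "step_op \<beta> T f w \<le> f w - (1 - ?K w)"
    proof (rule step_op_le_drift[OF b0])
      show "w \<noteq> [] \<or> T [] > 0" using root by simp
      show "0 \<le> 1 - ?K w" using level_factor_bounds[OF assms(1) s] by simp
      have f1: "f w = 1" "f (butlast w) = 1" using b by (auto simp: f_def)
      have "(\<Sum>i<T w. f (w @ [i])) = (\<Sum>i<T w. 1 - (if backbone T (w @ [i]) then 0 else 1 - trap_exit \<beta> s h (subtree (w @ [i]) T)))"
        using b by (intro sum.cong) (auto simp: f_def)
      also have "\<dots> = ?k - (\<Sum>i<T w. if backbone T (w @ [i]) then 0 else 1 - trap_exit \<beta> s h (subtree (w @ [i]) T))"
        by (simp add: sum_subtractf)
      finally have S: "(\<Sum>i<T w. f (w @ [i])) = ?k - (\<Sum>i<T w. if backbone T (w @ [i]) then 0 else 1 - trap_exit \<beta> s h (subtree (w @ [i]) T))" .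
      have pos: "1 + \<beta> * ?k > 0" using b0 by (simp add: add_pos_nonneg)
      have K: "?K w = 1 - \<beta> / (1 + \<beta> * ?k) * (\<Sum>i<T w. if backbone T (w @ [i]) then 0 else 1 - trap_exit \<beta> s h (subtree (w @ [i]) T))"
        by (simp add: level_factor_def cong: if_cong)
      have "(1 + \<beta> * ?k) * ?K w = (1 + \<beta> * ?k) - \<beta> * (\<Sum>i<T w. if backbone T (w @ [i]) then 0 else 1 - trap_exit \<beta> s h (subtree (w @ [i]) T))"
        unfolding K using pos by (simp add: right_diff_distrib)
      then show "f (butlast w) + \<beta> * (\<Sum>i<T w. f (w @ [i])) \<le> (1 + \<beta> * ?k) * (f w - (1 - ?K w))"
        unfolding f1 S by (simp add: algebra_simps)
    qed
    also have "\<dots> = ?K w" using b by (simp add: f_def)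
    finally have *: "step_op \<beta> T ?v w \<le> ?K w" .
    have "s * step_op \<beta> T ?v w \<le> 1 * step_op \<beta> T ?v w"
      using s step_op_nonneg[OF b0, of ?v T w] v01 by (intro mult_right_mono) auto
    with * b show ?thesis by simp
  next
    case c
    let ?k = "real (T w)"
    have nb: "\<not> backbone T w" using backbone_iff_backbone_height[OF sv Suc.prems] c by auto
    have nbc: "\<not> backbone T (w @ [i])" if "i < T w" for i
      using nb backbone_iff[of w T] that by auto
    have wne: "w \<noteq> []" using c by auto
    have bhp: "backbone_height T (butlast w) = m" using backbone_height_butlast[OF wne, of T] nb c by simp
    define r where "r = trap_exit \<beta> s (h + m + 1 - length w) (subtree w T)"
    define r' where "r' i = trap_exit \<beta> s (h + m - length w) (subtree (w @ [i]) T)" for i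
    have Rw: "?R w = ?R (butlast w) * r"
    proof -
      have "h + m - length (butlast w) = h + m + 1 - length w" using wne by (cases w rule: rev_cases) auto
      then show ?thesis
        using trap_exit_prod_snoc[of m "butlast w" \<beta> s h T "last w"] wne c by (simp add: r_def)
    qed
    have R0: "0 \<le> ?R x" for x
      unfolding trap_exit_prod_def using trap_exit_bounds(1)[OF b s] by (intro prod_nonneg) (auto intro: less_imp_le)
    have "step_op \<beta> T ?v w \<le> step_op \<beta> T ?R w"
    proof (rule step_op_mono[OF b0 Suc.prems root])
      have "?R (butlast w) = 1" if "length (butlast w) = m" using that by (simp add: trap_exit_prod_def)
      then show "?v (butlast w) \<le> ?R (butlast w)"
        using Suc.IH[OF gw_tree_butlast[OF Suc.prems]] bhp v01 by (auto split: if_splits)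
      show "?v (w @ [i]) \<le> ?R (w @ [i])" if "i < T w" for i
        using Suc.IH[of "w @ [i]"] Suc.prems that c nbc[OF that] by (simp add: backbone_height_snoc)
    qed
    also have "\<dots> = ?R (butlast w) * (1 + \<beta> * (\<Sum>i<T w. r * r' i)) / (1 + \<beta> * ?k)"
    proof -
      have "(\<Sum>i<T w. ?R (w @ [i])) = (\<Sum>i<T w. ?R (butlast w) * (r * r' i))"
        using c by (intro sum.cong) (auto simp: trap_exit_prod_snoc Rw r'_def)
      also have "\<dots> = ?R (butlast w) * (\<Sum>i<T w. r * r' i)" by (rule sum_distrib_left[symmetric])
      finally have "step_op \<beta> T ?R w = (?R (butlast w) + \<beta> * (?R (butlast w) * (\<Sum>i<T w. r * r' i))) / (1 + \<beta> * ?k)"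
        using wne by (simp add: step_op_def)
      also have "?R (butlast w) + \<beta> * (?R (butlast w) * S) = ?R (butlast w) * (1 + \<beta> * S)" for S
        by (simp add: algebra_simps)
      finally show ?thesis .
    qed
    finally have 1: "s * step_op \<beta> T ?v w \<le> s * (?R (butlast w) * (1 + \<beta> * (\<Sum>i<T w. r * r' i)) / (1 + \<beta> * ?k))"
      using s0 by (rule mult_left_mono)
    have pos: "1 + \<beta> * ?k > 0" using b0 by (simp add: add_pos_nonneg)
    \<comment> \<open>The recursion of \<open>trap_exit\<close> with its denominator cleared. Beyond
      relative depth \<open>h\<close> all factors are one and the claim reduces to
      \<open>s \<le> 1\<close>.\<close>
    have "s * (1 + \<beta> * (\<Sum>i<T w. r * r' i)) \<le> (1 + \<beta> * ?k) * r"
    proof (cases "h + m - length w")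
      case 0
      show ?thesis
      proof (cases "h + m + 1 - length w = 0")
        case True
        have "s * (1 + \<beta> * ?k) \<le> 1 * (1 + \<beta> * ?k)" using s pos by (intro mult_right_mono) auto
        with True 0 show ?thesis by (simp add: r_def r'_def)
      next
        case False
        with 0 have e: "h + m + 1 - length w = Suc 0" by simp
        have "1 \<le> 1 + \<beta> * ?k - s * \<beta> * ?k"
          using trap_exit_bounds(2)[OF b s, of "subtree w T" 0] by simp
        then have "r * (1 + \<beta> * ?k - s * \<beta> * ?k) = s" unfolding r_def e by simp
        then have "s * (1 + \<beta> * (?k * r)) = (1 + \<beta> * ?k) * r" by (simp add: algebra_simps)
        with 0 show ?thesis by (simp add: r'_def)
      qed
    next
      case (Suc a)
      then have e: "h + m + 1 - length w = Suc (Suc a)" by simp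
      have "1 \<le> 1 + \<beta> * ?k - s * \<beta> * (\<Sum>i<T w. r' i)"
        using trap_exit_bounds(2)[OF b s, of "subtree w T" "Suc a"] by (simp add: r'_def Suc del: trap_exit.simps)
      moreover have "r = s / (1 + \<beta> * ?k - s * \<beta> * (\<Sum>i<T w. r' i))"
        unfolding r_def e by (subst trap_exit.simps(2)) (simp add: r'_def Suc del: trap_exit.simps)
      ultimately have "r * (1 + \<beta> * ?k - s * \<beta> * (\<Sum>i<T w. r' i)) = s" by simp
      then have "s * (1 + \<beta> * (r * (\<Sum>i<T w. r' i))) = (1 + \<beta> * ?k) * r" by (simp add: algebra_simps)
      then show ?thesis by (simp add: sum_distrib_left)
    qed
    then have "?R (butlast w) * (s * (1 + \<beta> * (\<Sum>i<T w. r * r' i))) \<le> ?R (butlast w) * ((1 + \<beta> * ?k) * r)"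
      using R0 by (rule mult_left_mono)
    then have "s * (?R (butlast w) * (1 + \<beta> * (\<Sum>i<T w. r * r' i)) / (1 + \<beta> * ?k)) \<le> ?R w"
      unfolding Rw using pos by (simp add: pos_divide_le_eq algebra_simps)
    with 1 c show ?thesis by simp
  next
    case d
    then show ?thesis by simp
  qed
qed

lemma killed_hit_next_level_root:
  assumes b: "\<beta> > 1" and s: "0 < s" "s \<le> 1" and sv: "surv T"
  shows "hit_prob \<beta> s T {w. Suc m \<le> backbone_height T w} {} N [] \<le>
    (\<Sum>u\<in>backbone_level T m. level_factor \<beta> s h (subtree u T) * hit_prob \<beta> s T {u} (backbone_level T m - {u}) N [])"
proof (cases "m = 0")
  case True
  then have "backbone_level T m = {[]}" using sv by (auto simp: backbone_level_def level_def)
  with killed_hit_next_level[OF assms Nil_in_gw_tree, of m N h] True show ?thesis by simp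
next
  case False
  with killed_hit_next_level[OF assms Nil_in_gw_tree, of m N h] show ?thesis by simp
qed

text \<open>Each summand forbids the other vertices of the level, so the events are disjoint, and
  each of them brings the walk to backbone height \<open>m\<close> at the same time. This closes the
  induction over levels.\<close>

lemma killed_first_hit_sum_le:
  assumes b: "\<beta> > 1" and s: "0 < s" "s \<le> 1" and sv: "surv T" and w: "w \<in> gw_tree T"
    and wm: "backbone_height T w < m \<or> w \<in> backbone_level T m"
  shows "(\<Sum>u\<in>backbone_level T m. hit_prob \<beta> s T {u} (backbone_level T m - {u}) N w) \<le> hit_prob \<beta> s T {w. m \<le> backbone_height T w} {} N w"
  using w wm
proof (induction N arbitrary: w)
  case 0
  show ?case
  proof (cases "w \<in> backbone_level T m")
    case True
    then have "(\<Sum>u\<in>backbone_level T m. hit_prob \<beta> s T {u} (backbone_level T m - {u}) 0 w) = 1"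
      by (simp add: sum.delta cong: if_cong)
    then show ?thesis using backbone_height_backbone_level[OF sv True] by simp
  next
    case False
    then have "(\<Sum>u\<in>backbone_level T m. hit_prob \<beta> s T {u} (backbone_level T m - {u}) 0 w) = 0"
      by (intro sum.neutral) auto
    then show ?thesis by simp
  qed
next
  case (Suc N)
  let ?H = "\<lambda>u. hit_prob \<beta> s T {u} (backbone_level T m - {u})"
  show ?case
  proof (cases "w \<in> backbone_level T m")
    case True
    have "(\<Sum>u\<in>backbone_level T m. ?H u (Suc N) w) = (\<Sum>u\<in>backbone_level T m. if u = w then 1 else 0)"
      using True by (intro sum.cong) auto
    also have "\<dots> = 1" using True by simp
    finally show ?thesis using backbone_height_backbone_level[OF sv True] by simp
  next
    case False
    then have a: "backbone_height T w < m" using Suc.prems by simp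
    have b0: "\<beta> > 0" using b by simp
    have bp: "backbone_height T (butlast w) < m" if "w \<noteq> []"
      using a backbone_height_butlast[OF that, of T] by simp
    have bc: "backbone_height T (w @ [i]) < m \<or> w @ [i] \<in> backbone_level T m" if "i < T w" for i
    proof (cases "backbone T (w @ [i])")
      case True
      have T: "w @ [i] \<in> gw_tree T" using that Suc.prems by simp
      show ?thesis using backbone_height_backbone[OF sv T True] a T True
        by (auto simp: backbone_height_snoc backbone_level_def level_def)
    qed (use a in \<open>simp add: backbone_height_snoc\<close>)
    have "(\<Sum>u\<in>backbone_level T m. ?H u (Suc N) w) = (\<Sum>u\<in>backbone_level T m. s * step_op \<beta> T (?H u N) w)"
      using False by (intro sum.cong) auto
    also have "\<dots> = s * step_op \<beta> T (\<lambda>x. \<Sum>u\<in>backbone_level T m. ?H u N x) w"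
      by (simp add: step_op_sum sum_distrib_left)
    also have "\<dots> \<le> s * step_op \<beta> T (hit_prob \<beta> s T {w. m \<le> backbone_height T w} {} N) w"
      using bp bc Suc.prems s
      by (intro mult_left_mono step_op_mono[OF b0 Suc.prems(1) surv_root_pos[OF sv]] Suc.IH)
        (auto simp: gw_tree_butlast)
    finally show ?thesis using a by simp
  qed
qed

text \<open>With \<open>y = r / (1 - r)\<close> for the value \<open>r\<close> of \<open>trap_exit\<close>, the recursion bounds \<open>y\<close> at a vertex by
  \<open>(1 + y) / \<beta>\<close> at any child; the bound below solves this with equality, starting from \<open>y = n\<close>.\<close>
lemma trap_exit_le:
  fixes n :: nat
  assumes b: "\<beta> > 1" and n: "n \<ge> 1" and s: "s = real n / (real n + 1)"
  shows "alive j T \<Longrightarrow> trap_exit \<beta> s (Suc j) T \<le>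
    (real n / \<beta> ^ j + 1 / (\<beta> - 1)) / (1 + (real n / \<beta> ^ j + 1 / (\<beta> - 1)))"
proof (induction j arbitrary: T)
  case 0
  have s01: "0 < s" "s \<le> 1" using n s by (auto simp: divide_le_eq)
  have "1 \<le> 1 + \<beta> * real (T []) - s * \<beta> * real (T [])"
    using trap_exit_bounds(2)[OF b s01, of T 0] by simp
  then have "trap_exit \<beta> s (Suc 0) T \<le> s" using s01 by (simp add: divide_le_eq)
  also have "s \<le> (real n / \<beta> ^ 0 + 1 / (\<beta> - 1)) / (1 + (real n / \<beta> ^ 0 + 1 / (\<beta> - 1)))"
  proof -
    define y where "y = 1 / (\<beta> - 1)"
    have "y > 0" using b by (simp add: y_def)
    then show ?thesis unfolding s y_def[symmetric] using n by (simp add: field_simps)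
  qed
  finally show ?case .
next
  case (Suc j)
  have s01: "0 < s" "s \<le> 1" using n s by (auto simp: divide_le_eq)
  define Y where "Y = real n / \<beta> ^ j + 1 / (\<beta> - 1)"
  have Y0: "Y > 0" unfolding Y_def using b n by (intro add_pos_pos) auto
  have Y': "real n / \<beta> ^ Suc j + 1 / (\<beta> - 1) = (1 + Y) / \<beta>"
    using b by (simp add: Y_def field_simps)
  from Suc.prems obtain i0 where i0: "i0 < T []" "alive j (subtree [i0] T)" by auto
  let ?r = "\<lambda>i. trap_exit \<beta> s (Suc j) (subtree [i] T)" and ?k = "real (T [])"
  have "?r i0 \<le> Y / (1 + Y)" using Suc.IH[OF i0(2)] by (simp add: Y_def)
  also have "\<dots> = 1 - 1 / (1 + Y)" using Y0 by (simp add: field_simps)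
  finally have "?r i0 \<le> 1 - 1 / (1 + Y)" .
  then have "(\<Sum>i<T []. ?r i) \<le> (\<Sum>i<T []. 1) - 1 / (1 + Y)"
    using i0(1) trap_exit_bounds(1)[OF b s01] by (intro sum_le_drop[of i0]) (auto simp del: trap_exit.simps)
  then have "s * \<beta> * (\<Sum>i<T []. ?r i) \<le> s * \<beta> * (?k - 1 / (1 + Y))"
    using s01 b by (intro mult_left_mono) auto
  also have "\<dots> \<le> \<beta> * ?k - s * \<beta> / (1 + Y)"
    using s01 b mult_right_mono[of s 1 "\<beta> * ?k"] by (simp add: algebra_simps)
  finally have den: "s * (1 + \<beta> / (1 + Y)) \<le> 1 + \<beta> * ?k - s * \<beta> * (\<Sum>i<T []. ?r i)"
    using s01 by (simp add: algebra_simps)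
  have "1 + \<beta> / (1 + Y) > 0" using b Y0 by (intro add_pos_pos divide_pos_pos) auto
  then have p: "s * (1 + \<beta> / (1 + Y)) > 0" using s01 by simp
  have "trap_exit \<beta> s (Suc (Suc j)) T = s / (1 + \<beta> * ?k - s * \<beta> * (\<Sum>i<T []. ?r i))"
    by (subst trap_exit.simps(2)) simp
  also have "\<dots> \<le> s / (s * (1 + \<beta> / (1 + Y)))"
    using s01 by (intro divide_left_mono[OF den] mult_pos_pos less_le_trans[OF p den] p) simp
  also have "\<dots> = 1 / (1 + \<beta> / (1 + Y))" using s01 by simp
  also have "\<dots> = (1 + Y) / \<beta> / (1 + (1 + Y) / \<beta>)"
    using b Y0 by (simp add: divide_simps)
  finally show ?case unfolding Y' .
qed

text \<open>When \<open>\<beta> ^ h\<close> is at least \<open>n\<close>, the quantity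
  \<open>Y\<close> from \<open>trap_exit_le\<close> is at most \<open>1 + 1 / (\<beta> - 1)\<close>,
  uniformly in \<open>n\<close>. A trap that deep thus removes at least the fraction
  \<open>1 / (1 + Y)\<close> of the mass, which gives the constant.\<close>

lemma one_minus_trap_exit_ge:
  fixes n :: nat
  assumes b: "\<beta> > 1" and n: "n \<ge> 1" and s: "s = real n / (real n + 1)"
    and h: "real n \<le> \<beta> ^ h" and a: "alive h T"
  shows "1 - trap_exit \<beta> s (Suc h) T \<ge> (\<beta> - 1) / (2 * \<beta> - 1)"
proof -
  define Y where "Y = real n / \<beta> ^ h + 1 / (\<beta> - 1)"
  have Y0: "Y > 0" unfolding Y_def using b n by (intro add_pos_pos) auto
  have "real n / \<beta> ^ h \<le> 1" using h b by (simp add: divide_le_eq)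
  then have "Y \<le> 1 + 1 / (\<beta> - 1)" unfolding Y_def by simp
  also have "\<dots> = \<beta> / (\<beta> - 1)" using b by (simp add: field_simps)
  finally have "Y \<le> \<beta> / (\<beta> - 1)" .
  then have "1 + Y \<le> (2 * \<beta> - 1) / (\<beta> - 1)" using b by (simp add: field_simps)
  then have "1 / ((2 * \<beta> - 1) / (\<beta> - 1)) \<le> 1 / (1 + Y)"
    using Y0 b by (intro divide_left_mono) auto
  moreover have "trap_exit \<beta> s (Suc h) T \<le> Y / (1 + Y)" unfolding Y_def by (rule trap_exit_le[OF b n s a])
  moreover have "Y / (1 + Y) = 1 - 1 / (1 + Y)" using Y0 by (simp add: field_simps)
  ultimately show ?thesis by simp
qed

section \<open>The walk driven by uniform noise\<close>

primrec walk_from :: "real \<Rightarrow> (nat list \<Rightarrow> nat) \<Rightarrow> nat list \<Rightarrow> (nat \<Rightarrow> real) \<Rightarrow> nat \<Rightarrow> nat list" where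
  "walk_from \<beta> T w U 0 = w"
| "walk_from \<beta> T w U (Suc n) = walk_step \<beta> T (walk_from \<beta> T w U n) (U n)"

lemma walk_eq_walk_from: "walk \<beta> T U n = walk_from \<beta> T [] U n"
  by (induction n) auto

text \<open>The Markov property at time one in pathwise form: the walk iterates a random map, so
  dropping the first noise variable restarts it at the new position.\<close>

lemma walk_from_case_nat: "walk_from \<beta> T w (case_nat r U) (Suc n) = walk_from \<beta> T (walk_step \<beta> T w r) U n"
proof (induction n)
  case (Suc n)
  have "walk_from \<beta> T w (case_nat r U) (Suc (Suc n)) =
      walk_step \<beta> T (walk_from \<beta> T w (case_nat r U) (Suc n)) (case_nat r U (Suc n))"
    by (rule walk_from.simps(2))
  then show ?case unfolding Suc by simp
qed simp

lemma walk_step_cases: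
  assumes "T [] > 0"
  shows "(w \<noteq> [] \<and> walk_step \<beta> T w r = butlast w) \<or> (\<exists>i<T w. walk_step \<beta> T w r = w @ [i])"
proof (cases "w = []")
  case True
  with assms show ?thesis by (simp add: walk_step_def Let_def)
next
  case False
  then show ?thesis by (auto simp: walk_step_def Let_def)
qed

lemma walk_from_in_tree: "T [] > 0 \<Longrightarrow> w \<in> gw_tree T \<Longrightarrow> walk_from \<beta> T w U n \<in> gw_tree T"
proof (induction n)
  case (Suc n)
  then show ?case
    using walk_step_cases[of T "walk_from \<beta> T w U n" \<beta> "U n"] by (auto simp: gw_tree_butlast)
qed simp

text \<open>The walk starts at the root and moves between neighbours, so it enters the subtree of
  \<open>u\<close> through \<open>u\<close>.\<close>

lemma visits_prefix:
  assumes "T [] > 0" "take (length u) (walk_from \<beta> T [] U k) = u"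
  shows "\<exists>j\<le>k. walk_from \<beta> T [] U j = u"
  using assms(2)
proof (induction k)
  case (Suc k)
  let ?w = "walk_from \<beta> T [] U k"
  show ?case
  proof (cases "take (length u) ?w = u")
    case True
    with Suc.IH show ?thesis by (auto intro: le_SucI)
  next
    case False
    consider "?w \<noteq> []" "walk_step \<beta> T ?w (U k) = butlast ?w"
      | i where "i < T ?w" "walk_step \<beta> T ?w (U k) = ?w @ [i]"
      using walk_step_cases[of T ?w \<beta> "U k", OF assms(1)] by blast
    then show ?thesis
    proof cases
      case 1
      with Suc.prems have *: "take (length u) (butlast ?w) = u" by simp
      from arg_cong[OF *, of length] have "length u \<le> length ?w - 1" by simp
      then have "length u < length ?w" using 1 by (cases ?w) auto
      then show ?thesis using * False by (simp add: take_butlast)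
    next
      case 2
      then have "walk_from \<beta> T [] U (Suc k) = u" using Suc.prems False
        by (cases "length u \<le> length ?w") auto
      then show ?thesis by blast
    qed
  qed
qed auto

section \<open>Product noise and first-step identities\<close>

abbreviation U01 :: "real measure" where
  "U01 \<equiv> uniform_measure lborel {0..1::real}"

lemma prob_space_U01: "prob_space U01"
  by (rule prob_space_uniform_measure) auto

lemma sets_noise: "sets noise_law = sets (PiM UNIV (\<lambda>_. borel :: real measure))"
  unfolding noise_law_def by (intro sets_PiM_cong) auto

lemma space_noise [simp]: "space noise_law = UNIV"
  by (simp add: noise_law_def space_PiM)

lemma prob_space_noise: "prob_space noise_law"
  unfolding noise_law_def by (intro prob_space_PiM prob_space_U01)

lemma measurable_noise_component [measurable]: "(\<lambda>U. U n) \<in> borel_measurable noise_law"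
proof -
  have "(\<lambda>U. U n) \<in> borel_measurable (PiM UNIV (\<lambda>_. borel :: real measure))" by measurable
  then show ?thesis by (simp cong: measurable_cong_sets add: measurable_cong_sets[OF sets_noise refl])
qed

text \<open>An i.i.d. sequence is its first entry followed by an independent copy of the sequence.
  This turns path probabilities into one-step recursions.\<close>

lemma nn_integral_noise_step:
  assumes F: "F \<in> borel_measurable noise_law"
  shows "(\<integral>\<^sup>+U. F U \<partial>noise_law) = (\<integral>\<^sup>+r. \<integral>\<^sup>+U. F (case_nat r U) \<partial>noise_law \<partial>U01)"
proof -
  interpret Q: prob_space U01 by (rule prob_space_U01)
  interpret sequence_space U01 by unfold_locales
  interpret N: prob_space noise_law by (rule prob_space_noise)
  have eq: "distr (U01 \<Otimes>\<^sub>M noise_law) noise_law (\<lambda>(s, \<omega>). case_nat s \<omega>) = noise_law"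
    unfolding noise_law_def by (rule PiM_iter)
  have m: "(\<lambda>(s, \<omega>). case_nat s \<omega>) \<in> U01 \<Otimes>\<^sub>M noise_law \<rightarrow>\<^sub>M noise_law"
    unfolding noise_law_def by measurable
  have "(\<integral>\<^sup>+U. F U \<partial>noise_law) = (\<integral>\<^sup>+x. F ((\<lambda>(s, \<omega>). case_nat s \<omega>) x) \<partial>(U01 \<Otimes>\<^sub>M noise_law))"
    by (subst eq[symmetric], subst nn_integral_distr[OF m]) (use F in auto)
  also have "\<dots> = (\<integral>\<^sup>+r. \<integral>\<^sup>+U. F (case_nat r U) \<partial>noise_law \<partial>U01)"
    using N.nn_integral_fst[of "\<lambda>x. F ((\<lambda>(s, \<omega>). case_nat s \<omega>) x)" U01] measurable_compose[OF m F]
    by simp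
  finally show ?thesis .
qed

text \<open>The unit interval splits into one piece of length \<open>a\<close> and \<open>k\<close>
  pieces of length \<open>d\<close>, and the floor identifies the piece. The cap at
  \<open>k - 1\<close> acts only at \<open>r = 1\<close>, a null set.\<close>

lemma nn_integral_uniform_pieces:
  fixes a d :: real and k :: nat and c :: ennreal and G :: "nat \<Rightarrow> ennreal"
  assumes a: "0 \<le> a" and d: "0 < d" and k: "0 < k" and tot: "a + real k * d = 1"
  shows "(\<integral>\<^sup>+r. (if r < a then c else G (min (k - 1) (nat \<lfloor>(r - a) / d\<rfloor>))) * indicator {0..1} r \<partial>lborel)
    = ennreal a * c + (\<Sum>i<k. ennreal d * G i)"
proof -
  let ?I = "\<lambda>i. {a + real i * d ..< a + (real i + 1) * d}"
  have "(\<integral>\<^sup>+r. (if r < a then c else G (min (k - 1) (nat \<lfloor>(r - a) / d\<rfloor>))) * indicator {0..1} r \<partial>lborel)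
     = (\<integral>\<^sup>+r. c * indicator {0..<a} r + (\<Sum>i<k. G i * indicator (?I i) r) \<partial>lborel)"
  proof (rule nn_integral_cong_AE)
    have "AE r in lborel. r \<noteq> (1::real)" by (rule AE_lborel_singleton)
    then show "AE r in lborel. (if r < a then c else G (min (k - 1) (nat \<lfloor>(r - a) / d\<rfloor>))) * indicator {0..1} r
       = c * indicator {0..<a} r + (\<Sum>i<k. G i * indicator (?I i) r)"
    proof (eventually_elim)
      fix r :: real assume r1: "r \<noteq> 1"
      have Ile: "a + (real i + 1) * d \<le> 1" if "i < k" for i
      proof -
        have "(real i + 1) * d \<le> real k * d" using that d by (intro mult_right_mono) auto
        then show ?thesis using tot by simp
      qed
      have Ige: "a \<le> a + real i * d" for i using d by simp
      have a1: "a < 1" using tot d k by (metis less_add_same_cancel1 mult_pos_pos of_nat_0_less_iff)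
      consider "r < 0" | "0 \<le> r" "r < a" | "a \<le> r" "r < 1" | "r > 1" using r1 by linarith
      then show "(if r < a then c else G (min (k - 1) (nat \<lfloor>(r - a) / d\<rfloor>))) * indicator {0..1} r
       = c * indicator {0..<a} r + (\<Sum>i<k. G i * indicator (?I i) r)"
      proof cases
        case 1
        then have "indicator (?I i) r = (0::ennreal)" for i
          using Ige[of i] a by (auto simp: indicator_def)
        with 1 show ?thesis by simp
      next
        case 2
        then have "indicator (?I i) r = (0::ennreal)" for i
          using Ige[of i] a by (auto simp: indicator_def)
        with 2 a1 show ?thesis by simp
      next
        case 3
        define x where "x = (r - a) / d"
        have x0: "0 \<le> x" using 3 d by (simp add: x_def)
        have r: "r = a + x * d" using d by (simp add: x_def)
        have "x * d < real k * d" using 3 tot r by simp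
        then have xk: "x < real k" using d by simp
        define j where "j = nat \<lfloor>x\<rfloor>"
        have jk: "j < k" using xk x0 unfolding j_def by linarith
        have ind: "indicator (?I i) r = (if i = j then 1 else 0 :: ennreal)" for i
        proof -
          have "r \<in> ?I i \<longleftrightarrow> real i \<le> x \<and> x < real i + 1"
            unfolding r using d by simp
          also have "\<dots> \<longleftrightarrow> i = j" unfolding j_def using x0 by linarith
          finally show ?thesis by (simp add: indicator_def)
        qed
        have "(\<Sum>i<k. G i * indicator (?I i) r) = (\<Sum>i<k. if i = j then G i else 0)"
          unfolding ind by (intro sum.cong) auto
        also have "\<dots> = G j" using jk by simp
        finally have "(\<Sum>i<k. G i * indicator (?I i) r) = G j" .
        moreover have "min (k - 1) (nat \<lfloor>(r - a) / d\<rfloor>) = j"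
          using jk by (simp add: j_def x_def)
        ultimately show ?thesis using 3 a by simp
      next
        case 4
        then have "indicator (?I i) r = (0::ennreal)" if "i < k" for i
          using Ile[OF that] by (auto simp: indicator_def)
        with 4 a1 show ?thesis by simp
      qed
    qed
  qed
  also have "\<dots> = c * emeasure lborel {0..<a} + (\<Sum>i<k. G i * emeasure lborel (?I i))"
  proof -
    have "(\<integral>\<^sup>+r. (\<Sum>i<k. G i * indicator (?I i) r) \<partial>lborel) = (\<Sum>i<k. \<integral>\<^sup>+r. G i * indicator (?I i) r \<partial>lborel)"
      by (rule nn_integral_sum) measurable
    also have "\<dots> = (\<Sum>i<k. G i * emeasure lborel (?I i))"
      by (intro sum.cong refl nn_integral_cmult_indicator) simp
    finally have 1: "(\<integral>\<^sup>+r. (\<Sum>i<k. G i * indicator (?I i) r) \<partial>lborel) = (\<Sum>i<k. G i * emeasure lborel (?I i))" .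
    have 2: "(\<integral>\<^sup>+r. c * indicator {0..<a} r \<partial>lborel) = c * emeasure lborel {0..<a}"
      by (rule nn_integral_cmult_indicator) simp
    show ?thesis unfolding 1[symmetric] 2[symmetric] by (rule nn_integral_add) measurable
  qed
  also have "\<dots> = ennreal a * c + (\<Sum>i<k. ennreal d * G i)"
    using a d by (simp add: mult.commute algebra_simps)
  finally show ?thesis .
qed

text \<open>The step with the offspring number as a separate argument: for fixed \<open>k\<close> it
  is measurable in the noise, and the random offspring number is then substituted through its
  countably many values.\<close>

definition step_fun :: "real \<Rightarrow> nat \<Rightarrow> nat list \<Rightarrow> real \<Rightarrow> nat list" where
  "step_fun \<beta> k u r =
     (if u = [] then (if k = 0 then u else u @ [min (k - 1) (nat \<lfloor>r * real k\<rfloor>)])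
      else (let a = 1 / (1 + \<beta> * real k) in
         if k = 0 \<or> r < a then butlast u else u @ [min (k - 1) (nat \<lfloor>(r - a) / (\<beta> * a)\<rfloor>)]))"

lemma walk_step_eq: "walk_step \<beta> T u r = step_fun \<beta> (T u) u r"
  by (simp add: walk_step_def step_fun_def Let_def)

lemma measurable_step_fun [measurable]: "step_fun \<beta> k u \<in> borel \<rightarrow>\<^sub>M count_space UNIV"
proof -
  have [measurable]: "(\<lambda>r::real. u @ [min (k - 1) (nat \<lfloor>f r\<rfloor>)]) \<in> borel \<rightarrow>\<^sub>M count_space UNIV"
    if [measurable]: "f \<in> borel_measurable borel" for f :: "real \<Rightarrow> real"
    by (rule measurable_compose[where f="\<lambda>r. \<lfloor>f r\<rfloor>" and N="count_space UNIV"]) measurable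
  show ?thesis unfolding step_fun_def Let_def by measurable
qed

text \<open>Both cases with children are the same partition of the unit interval, with
  \<open>a = 0\<close> and pieces \<open>1 / k\<close> at the root, and with
  \<open>a = 1 / (1 + \<beta> * k)\<close> and pieces \<open>\<beta> * a\<close> elsewhere.\<close>

lemma nn_integral_walk_step:
  assumes b: "\<beta> > 0" and f: "\<And>v. f v \<ge> 0"
  shows "(\<integral>\<^sup>+r. ennreal (f (walk_step \<beta> T w r)) \<partial>U01) = ennreal (step_op \<beta> T f w)"
proof -
  let ?k = "T w"
  have m: "(\<lambda>r. ennreal (f (walk_step \<beta> T w r))) \<in> borel_measurable lborel"
    unfolding walk_step_eq
    using measurable_compose[OF measurable_step_fun, of "\<lambda>v. ennreal (f v)" borel] by simp
  have "(\<integral>\<^sup>+r. ennreal (f (walk_step \<beta> T w r)) \<partial>U01) =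
      (\<integral>\<^sup>+r. ennreal (f (walk_step \<beta> T w r)) * indicator {0..1} r \<partial>lborel)"
    by (subst nn_integral_uniform_measure[OF m]) (auto simp: divide_ennreal_def)
  also have "\<dots> = ennreal (step_op \<beta> T f w)"
  proof (cases "?k = 0")
    case True
    then have "walk_step \<beta> T w r = butlast w" for r by (simp add: walk_step_def)
    then show ?thesis using True by (cases "w = []") (auto simp: step_op_def nn_integral_cmult_indicator)
  next
    case k: False
    show ?thesis
    proof (cases "w = []")
      case True
      define d where "d = 1 / real ?k"
      have d: "d > 0" "0 + real ?k * d = 1" using k by (auto simp: d_def)
      have "(\<integral>\<^sup>+r. ennreal (f (walk_step \<beta> T w r)) * indicator {0..1} r \<partial>lborel) =
        (\<integral>\<^sup>+r. (if r < 0 then 0 else ennreal (f [min (?k - 1) (nat \<lfloor>(r - 0) / d\<rfloor>)])) * indicator {0..1} r \<partial>lborel)"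
        using True k by (intro nn_integral_cong) (auto simp: walk_step_def Let_def d_def indicator_def)
      also have "\<dots> = ennreal 0 * 0 + (\<Sum>i<?k. ennreal d * ennreal (f [i]))"
        using k d by (intro nn_integral_uniform_pieces[where G = "\<lambda>i. ennreal (f [i])"]) auto
      also have "\<dots> = ennreal (\<Sum>i<?k. d * f [i])"
        using d f by (simp add: ennreal_mult[symmetric] sum_ennreal)
      also have "(\<Sum>i<?k. d * f [i]) = step_op \<beta> T f w"
        using True k by (simp add: step_op_def d_def sum_divide_distrib)
      finally show ?thesis .
    next
      case False
      define a where "a = 1 / (1 + \<beta> * real ?k)"
      define d where "d = \<beta> * a"
      have p: "1 + \<beta> * real ?k > 0" using b by (simp add: add_pos_nonneg)
      have ad: "a > 0" "d > 0" using b p by (auto simp: a_def d_def)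
      have "a + real ?k * d = a * (1 + \<beta> * real ?k)" by (simp add: d_def algebra_simps)
      also have "\<dots> = 1" using p by (simp add: a_def)
      finally have tot: "a + real ?k * d = 1" .
      have "(\<integral>\<^sup>+r. ennreal (f (walk_step \<beta> T w r)) * indicator {0..1} r \<partial>lborel) =
        (\<integral>\<^sup>+r. (if r < a then ennreal (f (butlast w)) else ennreal (f (w @ [min (?k - 1) (nat \<lfloor>(r - a) / d\<rfloor>)])))
           * indicator {0..1} r \<partial>lborel)"
        using False k by (intro nn_integral_cong) (auto simp: walk_step_def Let_def d_def a_def)
      also have "\<dots> = ennreal a * ennreal (f (butlast w)) + (\<Sum>i<?k. ennreal d * ennreal (f (w @ [i])))"
        using k ad tot by (intro nn_integral_uniform_pieces[where G = "\<lambda>i. ennreal (f (w @ [i]))"]) auto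
      also have "\<dots> = ennreal (a * f (butlast w) + (\<Sum>i<?k. d * f (w @ [i])))"
        using ad f by (simp add: ennreal_mult[symmetric] sum_ennreal ennreal_plus[symmetric] sum_nonneg del: ennreal_plus)
      also have "a * f (butlast w) + (\<Sum>i<?k. d * f (w @ [i])) = step_op \<beta> T f w"
        using False by (simp add: step_op_def d_def a_def sum_divide_distrib add_divide_distrib sum_distrib_left)
      finally show ?thesis .
    qed
  qed
  finally show ?thesis .
qed

lemma measurable_walk_from:
  assumes T[measurable]: "\<And>v. (\<lambda>x. T x v) \<in> M \<rightarrow>\<^sub>M count_space UNIV"
    and U[measurable]: "\<And>n. (\<lambda>x. U x n) \<in> borel_measurable M"
  shows "(\<lambda>x. walk_from \<beta> (T x) w (U x) n) \<in> M \<rightarrow>\<^sub>M count_space UNIV"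
proof (induction n)
  case (Suc n)
  have "(\<lambda>x. walk_step \<beta> (T x) v (U x n)) \<in> M \<rightarrow>\<^sub>M count_space UNIV" for v
    unfolding walk_step_eq
    by (rule measurable_compose_countable[where f = "\<lambda>k x. step_fun \<beta> k v (U x n)"])
      (use measurable_compose[OF U measurable_step_fun] in auto)
  from measurable_compose_countable[OF this Suc] show ?case by simp
qed simp

lemma measurable_walk_from_noise [measurable]: "(\<lambda>U. walk_from \<beta> T w U n) \<in> noise_law \<rightarrow>\<^sub>M count_space UNIV"
  by (rule measurable_walk_from) auto

text \<open>First-step analysis identifies the recursion without killing with a probability of the
  actual walk. The same scheme gives \<open>nn_integral_occupation\<close> and
  \<open>nn_integral_return\<close>.\<close>

lemma nn_integral_hit:
  assumes b: "\<beta> > 0"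
  shows "(\<integral>\<^sup>+U. (if \<exists>k\<le>n. walk_from \<beta> T w U k \<in> A then 1 else 0) \<partial>noise_law) = ennreal (hit_prob \<beta> 1 T A {} n w)"
proof (induction n arbitrary: w)
  case 0
  interpret prob_space noise_law by (rule prob_space_noise)
  show ?case using emeasure_space_1 by auto
next
  case (Suc n)
  interpret prob_space noise_law by (rule prob_space_noise)
  have ex: "(\<exists>k\<le>Suc n. P k) \<longleftrightarrow> P 0 \<or> (\<exists>k\<le>n. P (Suc k))" for P
    by (metis Suc_le_mono le0 not0_implies_Suc)
  show ?case
  proof (cases "w \<in> A")
    case True
    then have "\<exists>k\<le>Suc n. walk_from \<beta> T w U k \<in> A" for U by (intro exI[of _ 0]) simp
    with True show ?thesis using emeasure_space_1 by simp
  next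
    case False
    have "(\<integral>\<^sup>+U. (if \<exists>k\<le>Suc n. walk_from \<beta> T w U k \<in> A then 1 else 0) \<partial>noise_law) =
      (\<integral>\<^sup>+r. \<integral>\<^sup>+U. (if \<exists>k\<le>Suc n. walk_from \<beta> T w (case_nat r U) k \<in> A then 1 else 0) \<partial>noise_law \<partial>U01)"
      by (rule nn_integral_noise_step) measurable
    also have "\<dots> = (\<integral>\<^sup>+r. \<integral>\<^sup>+U. (if \<exists>k\<le>n. walk_from \<beta> T (walk_step \<beta> T w r) U k \<in> A then 1 else 0) \<partial>noise_law \<partial>U01)"
      unfolding ex walk_from_case_nat using False by simp
    also have "\<dots> = (\<integral>\<^sup>+r. ennreal (hit_prob \<beta> 1 T A {} n (walk_step \<beta> T w r)) \<partial>U01)"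
      unfolding Suc.IH ..
    also have "\<dots> = ennreal (step_op \<beta> T (hit_prob \<beta> 1 T A {} n) w)"
      using b by (intro nn_integral_walk_step) (auto intro: hit_prob_nonneg)
    finally show ?thesis using False by simp
  qed
qed

lemma occupation_nonneg: "\<beta> > 0 \<Longrightarrow> (\<And>v. c v \<ge> 0) \<Longrightarrow> occupation \<beta> T c n w \<ge> 0"
  by (induction n arbitrary: w) (auto intro!: add_nonneg_nonneg step_op_nonneg)

lemma nn_integral_occupation:
  assumes b: "\<beta> > 0" and c: "\<And>v. c v \<ge> 0"
  shows "(\<integral>\<^sup>+U. (\<Sum>k\<le>n. ennreal (c (walk_from \<beta> T w U k))) \<partial>noise_law) = ennreal (occupation \<beta> T c n w)"
proof (induction n arbitrary: w)
  case 0
  interpret prob_space noise_law by (rule prob_space_noise)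
  show ?case using emeasure_space_1 by simp
next
  case (Suc n)
  interpret prob_space noise_law by (rule prob_space_noise)
  have [measurable]: "(\<lambda>U. ennreal (c (walk_from \<beta> T w U k))) \<in> borel_measurable noise_law" for w k
    by (rule measurable_compose[OF measurable_walk_from_noise]) simp
  have "(\<integral>\<^sup>+U. (\<Sum>k\<le>Suc n. ennreal (c (walk_from \<beta> T w U k))) \<partial>noise_law) =
    (\<integral>\<^sup>+r. \<integral>\<^sup>+U. (\<Sum>k\<le>Suc n. ennreal (c (walk_from \<beta> T w (case_nat r U) k))) \<partial>noise_law \<partial>U01)"
    by (rule nn_integral_noise_step) measurable
  also have "\<dots> = (\<integral>\<^sup>+r. \<integral>\<^sup>+U. ennreal (c w) + (\<Sum>k\<le>n. ennreal (c (walk_from \<beta> T (walk_step \<beta> T w r) U k))) \<partial>noise_law \<partial>U01)"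
    by (simp only: sum.atMost_Suc_shift walk_from_case_nat walk_from.simps(1))
  also have "\<dots> = (\<integral>\<^sup>+r. ennreal (c w) + ennreal (occupation \<beta> T c n (walk_step \<beta> T w r)) \<partial>U01)"
    using emeasure_space_1 by (subst nn_integral_add) (auto simp: Suc.IH)
  also have "\<dots> = (\<integral>\<^sup>+r. ennreal (c w + occupation \<beta> T c n (walk_step \<beta> T w r)) \<partial>U01)"
    using c occupation_nonneg[OF b c] by simp
  also have "\<dots> = ennreal (step_op \<beta> T (\<lambda>v. c w + occupation \<beta> T c n v) w)"
    using c occupation_nonneg[OF b c] b by (intro nn_integral_walk_step) auto
  \<comment> \<open>Additivity for two functions is finite additivity over a two-element index
    set.\<close>
  also have "step_op \<beta> T (\<lambda>v. c w + occupation \<beta> T c n v) w = c w + step_op \<beta> T (occupation \<beta> T c n) w"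
    using step_op_sum[of \<beta> T "\<lambda>b v. if b then c w else occupation \<beta> T c n v" "{True, False}" w] b by simp
  finally show ?case by simp
qed

lemma nn_integral_return:
  assumes b: "\<beta> > 0"
  shows "(\<integral>\<^sup>+U. (if \<exists>k\<le>n. \<exists>j\<le>k. 2 * m \<le> backbone_height T (walk_from \<beta> T w U j) \<and> backbone_height T (walk_from \<beta> T w U k) < m then 1 else 0) \<partial>noise_law)
    = ennreal (return_prob \<beta> T m n w)"
proof (induction n arbitrary: w)
  case 0
  have "\<not> (2 * m \<le> backbone_height T w \<and> backbone_height T w < m)" by linarith
  then show ?case by auto
next
  case (Suc n)
  let ?E = "\<lambda>n w U. \<exists>k\<le>n. \<exists>j\<le>k. 2 * m \<le> backbone_height T (walk_from \<beta> T w U j) \<and> backbone_height T (walk_from \<beta> T w U k) < m"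
  have rt0: "return_prob \<beta> T m n v \<ge> 0" for v n
    using b by (induction n arbitrary: v) (auto intro!: step_op_nonneg hit_prob_nonneg simp del: hit_prob.simps)
  show ?case
  proof (cases "2 * m \<le> backbone_height T w")
    case True
    have "?E (Suc n) w U \<longleftrightarrow> (\<exists>k\<le>Suc n. walk_from \<beta> T w U k \<in> {w. backbone_height T w < m})" for U
      using True by (metis le0 mem_Collect_eq walk_from.simps(1))
    then show ?thesis using nn_integral_hit[OF b, of "Suc n" T w "{w. backbone_height T w < m}"] True by simp
  next
    case False
    \<comment> \<open>The start has backbone height below \<open>2 * m\<close>, so the time
      \<open>j\<close>, and with it \<open>k\<close>, is positive and both can be shifted.\<close>
    have ex: "?E (Suc n) w (case_nat r U) \<longleftrightarrow> ?E n (walk_step \<beta> T w r) U" for r U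
    proof
      assume "?E (Suc n) w (case_nat r U)"
      then obtain k j where kj: "k \<le> Suc n" "j \<le> k" "2 * m \<le> backbone_height T (walk_from \<beta> T w (case_nat r U) j)"
        "backbone_height T (walk_from \<beta> T w (case_nat r U) k) < m" by blast
      from kj(3) False obtain j' where j': "j = Suc j'" by (cases j) auto
      with kj(2) obtain k' where k': "k = Suc k'" by (cases k) auto
      show "?E n (walk_step \<beta> T w r) U"
        using kj unfolding j' k' walk_from_case_nat by (intro exI[of _ k'] exI[of _ j'] conjI) auto
    next
      assume "?E n (walk_step \<beta> T w r) U"
      then obtain k j where kj: "k \<le> n" "j \<le> k" "2 * m \<le> backbone_height T (walk_from \<beta> T (walk_step \<beta> T w r) U j)"
        "backbone_height T (walk_from \<beta> T (walk_step \<beta> T w r) U k) < m" by blast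
      then show "?E (Suc n) w (case_nat r U)"
        unfolding walk_from_case_nat[symmetric] by (intro exI[of _ "Suc k"] exI[of _ "Suc j"] conjI) auto
    qed
    have "(\<integral>\<^sup>+U. (if ?E (Suc n) w U then 1 else 0) \<partial>noise_law) =
      (\<integral>\<^sup>+r. \<integral>\<^sup>+U. (if ?E (Suc n) w (case_nat r U) then 1 else 0) \<partial>noise_law \<partial>U01)"
      by (rule nn_integral_noise_step) measurable
    also have "\<dots> = (\<integral>\<^sup>+r. ennreal (return_prob \<beta> T m n (walk_step \<beta> T w r)) \<partial>U01)"
      unfolding ex Suc.IH ..
    also have "\<dots> = ennreal (step_op \<beta> T (return_prob \<beta> T m n) w)"
      using b rt0 by (intro nn_integral_walk_step) auto
    finally show ?thesis using False by simp
  qed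
qed

section \<open>Quenched bounds for events of the walk\<close>

definition deep_trap :: "nat \<Rightarrow> (nat list \<Rightarrow> nat) \<Rightarrow> bool" where
  "deep_trap h T \<longleftrightarrow> (\<exists>i<T []. \<not> surv (subtree [i] T) \<and> alive h (subtree [i] T))"

text \<open>A deep trap is counted with cost \<open>1\<close>, otherwise Markov's inequality for the time spent is used.\<close>
definition cluster_cost :: "real \<Rightarrow> nat \<Rightarrow> nat \<Rightarrow> (nat list \<Rightarrow> nat) \<Rightarrow> real" where
  "cluster_cost \<beta> h t T = (if deep_trap h T then 1 else green \<beta> h T / real (Suc t))"

text \<open>A hitting time bounded by \<open>n\<close> is discounted by no less than
  \<open>s ^ n\<close>.\<close>

lemma hit_prob_discount:
  assumes b: "\<beta> > 0" and s: "0 \<le> s" "s \<le> 1"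
  shows "s ^ n * hit_prob \<beta> 1 T A {} n w \<le> hit_prob \<beta> s T A {} n w"
proof (induction n arbitrary: w)
  case (Suc n)
  have mono: "step_op \<beta> T f w \<le> step_op \<beta> T g w" if "\<And>v. f v \<le> g v" for f g
  proof (cases "w = [] \<and> T [] = 0")
    case False
    have "(\<Sum>i<T w. f (w @ [i])) \<le> (\<Sum>i<T w. g (w @ [i]))" using that by (intro sum_mono) auto
    then show ?thesis using False that b unfolding step_op_def
      by (auto intro!: divide_right_mono add_mono mult_left_mono)
  qed (simp add: step_op_def that)
  show ?case
  proof (cases "w \<in> A")
    case True
    then show ?thesis using s by (auto intro: mult_le_one power_le_one)
  next
    case False
    have "s ^ Suc n * hit_prob \<beta> 1 T A {} (Suc n) w = s * step_op \<beta> T (\<lambda>v. s ^ n * hit_prob \<beta> 1 T A {} n v) w"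
      using False by (simp add: step_op_cmult)
    also have "\<dots> \<le> s * step_op \<beta> T (hit_prob \<beta> s T A {} n) w"
      using s Suc by (intro mult_left_mono mono) auto
    finally show ?thesis using False by simp
  qed
qed simp

text \<open>Killing at rate \<open>1 / (n + 1)\<close> leaves a path of at most \<open>n\<close>
  steps a fixed share of its mass: the inverse of \<open>s ^ n\<close> is
  \<open>(1 + 1 / n) ^ n\<close>, which is at most \<open>exp 1\<close> and so at most 3.\<close>

lemma quenched_reach:
  assumes b: "\<beta> > 1" and n: "n \<ge> 1"
  shows "(\<integral>\<^sup>+U. (if \<exists>k\<le>n. m \<le> backbone_height T (walk_from \<beta> T [] U k) then 1 else 0) \<partial>noise_law)
    \<le> 3 * ennreal (hit_prob \<beta> (real n / (real n + 1)) T {w. m \<le> backbone_height T w} {} n [])"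
proof -
  let ?A = "{w. m \<le> backbone_height T w}" and ?s = "real n / (real n + 1)"
  have s: "0 < ?s" "?s \<le> 1" using n by auto
  have b0: "\<beta> > 0" using b by simp
  have "inverse ?s = 1 + 1 / real n" using n by (simp add: field_simps)
  also have "\<dots> \<le> exp (1 / real n)" by (rule exp_ge_add_one_self)
  finally have "inverse ?s ^ n \<le> exp (1 / real n) ^ n"
    using s by (intro power_mono) auto
  also have "\<dots> = exp 1" using n by (simp add: exp_of_nat_mult[symmetric])
  also have "\<dots> \<le> 3" by (rule exp_le)
  finally have "1 \<le> 3 * ?s ^ n" using s n by (simp add: power_inverse field_simps)
  then have "1 * hit_prob \<beta> 1 T ?A {} n [] \<le> (3 * ?s ^ n) * hit_prob \<beta> 1 T ?A {} n []"
    using hit_prob_nonneg[OF b0, of 1 T ?A "{}" n "[]"] by (intro mult_right_mono) auto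
  also have "\<dots> \<le> 3 * hit_prob \<beta> ?s T ?A {} n []"
    using hit_prob_discount[OF b0, of ?s n T ?A "[]"] s by simp
  finally have "ennreal (hit_prob \<beta> 1 T ?A {} n []) \<le> ennreal (3 * hit_prob \<beta> ?s T ?A {} n [])"
    by (intro ennreal_leI) simp
  then show ?thesis
    using nn_integral_hit[OF b0, of n T "[]" ?A] hit_prob_nonneg[OF b0, of ?s T ?A "{}" n "[]"] s
    by (simp add: ennreal_mult)
qed

lemma quenched_return:
  assumes b: "\<beta> > 1" and s: "surv T" and m: "m \<ge> 1"
  shows "(\<integral>\<^sup>+U. (if \<exists>k\<le>n. \<exists>j\<le>k. 2 * m \<le> backbone_height T (walk_from \<beta> T [] U j) \<and> backbone_height T (walk_from \<beta> T [] U k) < m then 1 else 0) \<partial>noise_law)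
    \<le> ennreal ((1 / \<beta>) ^ m)"
  using nn_integral_return[of \<beta> n m T "[]"] return_prob_le[OF b s m Nil_in_gw_tree] b
  by (auto intro!: ennreal_leI)

lemma sum_backbone_level_ge:
  fixes g :: "nat list \<Rightarrow> ennreal"
  assumes "u \<in> backbone_level T l" "l < m"
  shows "g u \<le> (\<Sum>l<m. \<Sum>u\<in>backbone_level T l. g u)"
proof -
  have "g u \<le> (\<Sum>u\<in>backbone_level T l. g u)" using assms(1) by (intro member_le_sum) auto
  also have "\<dots> \<le> (\<Sum>l<m. \<Sum>u\<in>backbone_level T l. g u)"
    using assms(2) by (intro member_le_sum[where f = "\<lambda>l. \<Sum>u\<in>backbone_level T l. g u"]) auto
  finally show ?thesis .
qed

lemma cluster_root:
  assumes s: "surv T" and w: "w \<in> gw_tree T"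
  shows "take (backbone_height T w) w \<in> backbone_level T (backbone_height T w)"
  using backbone_take_backbone_height[OF assms] gw_tree_take[OF w] backbone_height_le_length[of T w] by (simp add: backbone_level_def level_def)

text \<open>A walk at distance \<open>2 * m\<close> whose last backbone ancestor has level below
  \<open>m\<close> sits in a trap of height at least \<open>m\<close>. The vertex carrying this trap
  was visited earlier, so a union bound over the backbone vertices of the first \<open>m\<close>
  levels applies.\<close>

lemma quenched_deep_trap:
  assumes b: "\<beta> > 1" and s: "surv T"
  shows "(\<integral>\<^sup>+U. (if \<exists>k\<le>n. 2 * m \<le> length (walk_from \<beta> T [] U k) \<and> backbone_height T (walk_from \<beta> T [] U k) < m then 1 else 0) \<partial>noise_law)
    \<le> (\<Sum>l<m. \<Sum>u\<in>backbone_level T l. ennreal (hit_prob \<beta> 1 T {u} {} n []) * indicator {T. deep_trap m T} (subtree u T))"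
proof -
  let ?X = "\<lambda>U k. walk_from \<beta> T [] U k"
  let ?g = "\<lambda>U u. (if \<exists>k\<le>n. ?X U k \<in> {u} then 1 else 0) * indicator {T. deep_trap m T} (subtree u T) :: ennreal"
  have root: "T [] > 0" by (rule surv_root_pos[OF s])
  have "(if \<exists>k\<le>n. 2 * m \<le> length (?X U k) \<and> backbone_height T (?X U k) < m then 1 else 0) \<le> (\<Sum>l<m. \<Sum>u\<in>backbone_level T l. ?g U u)" for U
  proof (cases "\<exists>k\<le>n. 2 * m \<le> length (?X U k) \<and> backbone_height T (?X U k) < m")
    case True
    then obtain k where k: "k \<le> n" "2 * m \<le> length (?X U k)" "backbone_height T (?X U k) < m" by blast
    define w where "w = ?X U k"
    have w: "w \<in> gw_tree T" unfolding w_def using root by (simp add: walk_from_in_tree)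
    define l where "l = backbone_height T w"
    have l: "l < m" "length w > l" using k backbone_height_le_length[of T w] unfolding l_def w_def by auto
    have u: "take l w \<in> backbone_level T l" using cluster_root[OF s w] by (simp add: l_def)
    have "alive m (subtree (take l w @ [w ! l]) T)"
      using trap_depth(3)[OF s w l_def[symmetric] l(2)] k l by (intro alive_antimono[of m "length w - Suc l"]) (auto simp: w_def)
    then have "deep_trap m (subtree (take l w) T)"
      unfolding deep_trap_def using trap_depth(1,2)[OF s w l_def[symmetric] l(2)] by (auto intro!: exI[of _ "w ! l"])
    moreover have "\<exists>j\<le>n. ?X U j = take l w"
      using visits_prefix[of T "take l w" \<beta> U k] root k l by (auto simp: w_def min_def) (meson le_trans)
    ultimately have "?g U (take l w) = 1" by simp
    then show ?thesis using sum_backbone_level_ge[OF u l(1), of "?g U"] True by simp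
  next
    case False
    then show ?thesis by (simp only: if_False zero_le)
  qed
  then have "(\<integral>\<^sup>+U. (if \<exists>k\<le>n. 2 * m \<le> length (?X U k) \<and> backbone_height T (?X U k) < m then 1 else 0) \<partial>noise_law) \<le>
    (\<integral>\<^sup>+U. (\<Sum>l<m. \<Sum>u\<in>backbone_level T l. ?g U u) \<partial>noise_law)"
    by (intro nn_integral_mono) auto
  also have "\<dots> = (\<Sum>l<m. \<Sum>u\<in>backbone_level T l. \<integral>\<^sup>+U. ?g U u \<partial>noise_law)"
    by (subst nn_integral_sum; (subst nn_integral_sum)?) measurable
  also have "\<dots> = (\<Sum>l<m. \<Sum>u\<in>backbone_level T l. ennreal (hit_prob \<beta> 1 T {u} {} n []) * indicator {T. deep_trap m T} (subtree u T))"
  proof (intro sum.cong refl)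
    fix u
    have "(\<integral>\<^sup>+U. ?g U u \<partial>noise_law) = (\<integral>\<^sup>+U. (if \<exists>k\<le>n. ?X U k \<in> {u} then 1 else 0) \<partial>noise_law) * indicator {T. deep_trap m T} (subtree u T)"
      by (rule nn_integral_multc) measurable
    then show "(\<integral>\<^sup>+U. ?g U u \<partial>noise_law) = ennreal (hit_prob \<beta> 1 T {u} {} n []) * indicator {T. deep_trap m T} (subtree u T)"
      using nn_integral_hit[of \<beta> n T "[]" "{u}"] b by simp
  qed
  finally show ?thesis .
qed

lemma green_nonneg: "\<beta> > 1 \<Longrightarrow> green \<beta> h T \<ge> 0"
  unfolding green_def
  by (auto intro!: divide_nonneg_nonneg add_nonneg_nonneg mult_nonneg_nonneg sum_nonneg trap_time_nonneg)

text \<open>Either some vertex visited on the first \<open>m\<close> backbone levels carries a deep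
  trap, or all \<open>t + 1\<close> instants are spent in clusters without one. In the second case
  the occupation times of these clusters, divided by \<open>t + 1\<close>, sum to at least one, and
  their means are bounded by \<open>green\<close>.\<close>

lemma quenched_slow:
  assumes b: "\<beta> > 1" and s: "surv T"
  shows "(\<integral>\<^sup>+U. (if \<forall>k\<le>t. backbone_height T (walk_from \<beta> T [] U k) < m then 1 else 0) \<partial>noise_law)
    \<le> (\<Sum>l<m. \<Sum>u\<in>backbone_level T l. ennreal (hit_prob \<beta> 1 T {u} {} t []) * ennreal (cluster_cost \<beta> h t (subtree u T)))"
proof -
  let ?X = "\<lambda>U k. walk_from \<beta> T [] U k"
  let ?e = "ennreal (1 / real (Suc t))"
  let ?c = "\<lambda>u w. if take (backbone_height T w) w = u then 1 else 0 :: real"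
  let ?g = "\<lambda>U u. (if deep_trap h (subtree u T) then (if \<exists>k\<le>t. ?X U k \<in> {u} then 1 else 0)
     else ?e * (\<Sum>k\<le>t. ennreal (?c u (?X U k))))"
  have root: "T [] > 0" by (rule surv_root_pos[OF s])
  have b0: "\<beta> > 0" using b by simp
  have "(if \<forall>k\<le>t. backbone_height T (?X U k) < m then 1 else 0) \<le> (\<Sum>l<m. \<Sum>u\<in>backbone_level T l. ?g U u)" for U
  proof (cases "\<forall>k\<le>t. backbone_height T (?X U k) < m")
    case True
    have T: "?X U k \<in> gw_tree T" for k using root by (simp add: walk_from_in_tree)
    define r where "r k = take (backbone_height T (?X U k)) (?X U k)" for k
    have r: "r k \<in> backbone_level T (backbone_height T (?X U k))" for k
      unfolding r_def by (rule cluster_root[OF s T])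
    show ?thesis
    proof (cases "\<exists>k\<le>t. deep_trap h (subtree (r k) T)")
      case True': True
      then obtain k where k: "k \<le> t" "deep_trap h (subtree (r k) T)" by blast
      have "take (length (r k)) (?X U k) = r k"
        using backbone_height_le_length[of T "?X U k"] by (simp add: r_def min_absorb2)
      then have "\<exists>j\<le>t. ?X U j = r k"
        using visits_prefix[of T "r k" \<beta> U k] root k by (meson le_trans)
      then have "?g U (r k) = 1" using k by simp
      then show ?thesis using sum_backbone_level_ge[OF r, of k m "?g U"] True k by simp
    next
      case False
      have "(\<Sum>k\<le>t. 1 :: ennreal) = ennreal (real (Suc t))"
        by (simp add: ennreal_of_nat_eq_real_of_nat[symmetric] del: of_nat_Suc)
      \<comment> \<open>Each instant belongs to the cluster of its last backbone ancestor, whose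
        level is below \<open>m\<close>, so every term of the time average is at least one.\<close>
      then have "(1::ennreal) = ?e * (\<Sum>k\<le>t. 1)"
        by (simp add: ennreal_mult[symmetric] del: of_nat_Suc sum_constant)
      also have "\<dots> \<le> ?e * (\<Sum>k\<le>t. \<Sum>l<m. \<Sum>u\<in>backbone_level T l. ennreal (?c u (?X U k)))"
      proof (intro mult_left_mono sum_mono)
        fix k assume "k \<in> {..t}"
        then show "1 \<le> (\<Sum>l<m. \<Sum>u\<in>backbone_level T l. ennreal (?c u (?X U k)))"
          using sum_backbone_level_ge[OF r, of k m "\<lambda>u. ennreal (?c u (?X U k))"] True by (simp add: r_def)
      qed simp
      also have "\<dots> = (\<Sum>l<m. \<Sum>u\<in>backbone_level T l. ?e * (\<Sum>k\<le>t. ennreal (?c u (?X U k))))"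
      proof -
        have "(\<Sum>k\<le>t. \<Sum>l<m. \<Sum>u\<in>backbone_level T l. f k u) = (\<Sum>l<m. \<Sum>u\<in>backbone_level T l. \<Sum>k\<le>t. f k u)"
          for f :: "nat \<Rightarrow> nat list \<Rightarrow> ennreal"
          by (subst sum.swap) (intro sum.cong refl sum.swap)
        then show ?thesis by (simp only: sum_distrib_left)
      qed
      also have "\<dots> \<le> (\<Sum>l<m. \<Sum>u\<in>backbone_level T l. ?g U u)"
      proof (intro sum_mono)
        fix l u
        show "?e * (\<Sum>k\<le>t. ennreal (?c u (?X U k))) \<le> ?g U u"
        proof (cases "deep_trap h (subtree u T)")
          case True
          have "?c u (?X U k) = 0" if "k \<le> t" for k
            using False True that by (auto simp: r_def)
          then have "(\<Sum>k\<le>t. ennreal (?c u (?X U k))) = 0"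
            by (intro sum.neutral) (simp del: ennreal_eq_0_iff)
          then show ?thesis by (simp only:) simp
        qed simp
      qed
      finally show ?thesis by auto
    qed
  next
    case False
    then show ?thesis by (simp only: if_False zero_le)
  qed
  then have "(\<integral>\<^sup>+U. (if \<forall>k\<le>t. backbone_height T (?X U k) < m then 1 else 0) \<partial>noise_law) \<le>
    (\<integral>\<^sup>+U. (\<Sum>l<m. \<Sum>u\<in>backbone_level T l. ?g U u) \<partial>noise_law)"
    by (intro nn_integral_mono) auto
  also have "\<dots> = (\<Sum>l<m. \<Sum>u\<in>backbone_level T l. \<integral>\<^sup>+U. ?g U u \<partial>noise_law)"
    by (subst nn_integral_sum; (subst nn_integral_sum)?) measurable
  also have "\<dots> \<le> (\<Sum>l<m. \<Sum>u\<in>backbone_level T l. ennreal (hit_prob \<beta> 1 T {u} {} t []) * ennreal (cluster_cost \<beta> h t (subtree u T)))"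
  proof (intro sum_mono)
    fix l u assume u: "u \<in> backbone_level T l"
    have h0: "0 \<le> hit_prob \<beta> 1 T {u} {} t []" using hit_prob_nonneg[OF b0] by simp
    show "(\<integral>\<^sup>+U. ?g U u \<partial>noise_law) \<le> ennreal (hit_prob \<beta> 1 T {u} {} t []) * ennreal (cluster_cost \<beta> h t (subtree u T))"
    proof (cases "deep_trap h (subtree u T)")
      case True
      then show ?thesis using nn_integral_hit[OF b0, of t T "[]" "{u}"] by (simp add: cluster_cost_def)
    next
      case False
      have [measurable]: "(\<lambda>U. ennreal (?c u (?X U k))) \<in> borel_measurable noise_law" for k
        by (rule measurable_compose[OF measurable_walk_from_noise]) simp
      have "(\<integral>\<^sup>+U. ?g U u \<partial>noise_law) = ?e * (\<integral>\<^sup>+U. (\<Sum>k\<le>t. ennreal (?c u (?X U k))) \<partial>noise_law)"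
        using False by (simp only: if_False) (rule nn_integral_cmult, measurable)
      also have "\<dots> = ?e * ennreal (occupation \<beta> T (?c u) t [])"
        by (subst nn_integral_occupation[OF b0]) auto
      also have "\<dots> \<le> ?e * ennreal (green \<beta> h (subtree u T) * hit_prob \<beta> 1 T {u} {} t [])"
        using False bblD[OF u]
        by (intro mult_left_mono ennreal_leI occupation_cluster_root_le[OF b s]) (auto simp: deep_trap_def)
      also have "\<dots> = ennreal (hit_prob \<beta> 1 T {u} {} t []) * ennreal (cluster_cost \<beta> h t (subtree u T))"
        using False h0 green_nonneg[OF b, of h "subtree u T"]
        by (simp add: cluster_cost_def ennreal_mult[symmetric] mult.commute)
      finally show ?thesis .
    qed
  qed
  finally show ?thesis .
qed

section \<open>The Galton-Watson environment\<close>

lemma space_gw [simp]: "space (gw_law p) = UNIV"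
  by (simp add: gw_law_def space_PiM)

lemma prob_space_gw: "prob_space (gw_law p)"
  unfolding gw_law_def by (intro prob_space_PiM measure_pmf.prob_space_axioms)

lemma measurable_gw_component [measurable]: "(\<lambda>T. T v) \<in> gw_law p \<rightarrow>\<^sub>M count_space UNIV"
proof -
  have "(\<lambda>T. T v) \<in> gw_law p \<rightarrow>\<^sub>M measure_pmf p"
    unfolding gw_law_def by (rule measurable_component_singleton) simp
  then show ?thesis by simp
qed

lemma measurable_subtree [measurable]: "subtree u \<in> gw_law p \<rightarrow>\<^sub>M gw_law p"
proof -
  have "(\<lambda>T w. subtree u T w) \<in> gw_law p \<rightarrow>\<^sub>M PiM UNIV (\<lambda>_. measure_pmf p)"
    unfolding subtree_def by (rule measurable_PiM_single') auto
  then show ?thesis by (simp add: gw_law_def)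
qed

lemma measurable_alive [measurable]: "Measurable.pred (gw_law p) (alive h)"
proof (induction h)
  case (Suc h)
  have [measurable]: "Measurable.pred (gw_law p) (\<lambda>T. alive h (subtree [i] T))" for i
    by (rule measurable_compose[OF measurable_subtree Suc])
  have "Measurable.pred (gw_law p) (\<lambda>T. \<exists>i. i < T [] \<and> alive h (subtree [i] T))" by measurable
  then show ?case by simp
qed simp

lemma measurable_surv [measurable]: "Measurable.pred (gw_law p) surv"
  unfolding surv_def[abs_def] by measurable

lemma measurable_backbone_height [measurable]: "(\<lambda>T. backbone_height T w) \<in> gw_law p \<rightarrow>\<^sub>M count_space UNIV"
proof -
  have [measurable]: "Measurable.pred (gw_law p) (\<lambda>T. backbone T v)" for v
    by (rule measurable_compose[OF measurable_subtree measurable_surv])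
  show ?thesis unfolding backbone_height_def by measurable
qed

lemma measurable_gw_tree [measurable]: "Measurable.pred (gw_law p) (\<lambda>T. u \<in> gw_tree T)"
  unfolding gw_tree_def mem_Collect_eq by measurable

text \<open>The number of summands is random; fixing its countably many values reduces the claim to
  finite sums.\<close>

lemma borel_measurable_sum_offspring:
  fixes f :: "nat \<Rightarrow> (nat list \<Rightarrow> nat) \<Rightarrow> real"
  assumes [measurable]: "\<And>i. f i \<in> borel_measurable (gw_law p)"
  shows "(\<lambda>T. \<Sum>i<T w. f i T) \<in> borel_measurable (gw_law p)"
  by (rule measurable_compose_countable[where f = "\<lambda>k T. \<Sum>i<k. f i T"]) measurable

lemma measurable_trap_time [measurable]: "trap_time \<beta> h \<in> borel_measurable (gw_law p)"
proof (induction h)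
  case 0
  then show ?case by (simp add: trap_time.simps(1)[abs_def])
next
  case (Suc h)
  have [measurable]: "(\<lambda>T. \<Sum>i<T []. trap_time \<beta> h (subtree [i] T)) \<in> borel_measurable (gw_law p)"
    by (rule borel_measurable_sum_offspring) (rule measurable_compose[OF measurable_subtree Suc])
  show ?case unfolding trap_time.simps(2)[abs_def] by measurable
qed

lemma measurable_trap_exit [measurable]: "trap_exit \<beta> s h \<in> borel_measurable (gw_law p)"
proof (induction h)
  case 0
  then show ?case by (simp add: trap_exit.simps(1)[abs_def])
next
  case (Suc h)
  have [measurable]: "(\<lambda>T. \<Sum>i<T []. trap_exit \<beta> s h (subtree [i] T)) \<in> borel_measurable (gw_law p)"
    by (rule borel_measurable_sum_offspring) (rule measurable_compose[OF measurable_subtree Suc])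
  show ?case unfolding trap_exit.simps(2)[abs_def] by measurable
qed

lemma measurable_level_factor [measurable]: "level_factor \<beta> s h \<in> borel_measurable (gw_law p)"
proof -
  have [measurable]: "(\<lambda>T. \<Sum>i<T []. if surv (subtree [i] T) then 0 else 1 - trap_exit \<beta> s h (subtree [i] T)) \<in> borel_measurable (gw_law p)"
    by (rule borel_measurable_sum_offspring) measurable
  show ?thesis unfolding level_factor_def[abs_def] by measurable
qed

lemma measurable_green [measurable]: "green \<beta> h \<in> borel_measurable (gw_law p)"
proof -
  have [measurable]: "(\<lambda>T. \<Sum>i<T []. if surv (subtree [i] T) then 0 else trap_time \<beta> h (subtree [i] T)) \<in> borel_measurable (gw_law p)"
    by (rule borel_measurable_sum_offspring) measurable
  show ?thesis unfolding green_def[abs_def] by measurable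
qed

lemma measurable_deep_trap [measurable]: "Measurable.pred (gw_law p) (deep_trap h)"
proof -
  have "Measurable.pred (gw_law p) (\<lambda>T. \<exists>i. i < T [] \<and> \<not> surv (subtree [i] T) \<and> alive h (subtree [i] T))"
    by measurable
  then show ?thesis by (simp add: deep_trap_def[abs_def])
qed

lemma measurable_cluster_cost [measurable]: "cluster_cost \<beta> h t \<in> borel_measurable (gw_law p)"
  unfolding cluster_cost_def[abs_def] by measurable

lemma measurable_hit_prob:
  assumes [measurable]: "\<And>w. Measurable.pred (gw_law p) (\<lambda>T. w \<in> A T)" "\<And>w. Measurable.pred (gw_law p) (\<lambda>T. w \<in> D T)"
  shows "(\<lambda>T. hit_prob \<beta> s T (A T) (D T) n w) \<in> borel_measurable (gw_law p)"
proof (induction n arbitrary: w)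
  case (Suc n)
  note [measurable] = Suc borel_measurable_sum_offspring[where p = p]
  have [measurable]: "(\<lambda>T. \<Sum>i<T v. hit_prob \<beta> s T (A T) (D T) n (v @ [i])) \<in> borel_measurable (gw_law p)" for v
    by (rule borel_measurable_sum_offspring) (rule Suc)
  have [measurable]: "(\<lambda>T. \<Sum>i<T []. hit_prob \<beta> s T (A T) (D T) n [i]) \<in> borel_measurable (gw_law p)"
    by (rule borel_measurable_sum_offspring) (rule Suc)
  have [measurable]: "(\<lambda>T. step_op \<beta> T (hit_prob \<beta> s T (A T) (D T) n) w) \<in> borel_measurable (gw_law p)"
    unfolding step_op_def by measurable
  show ?case by simp
qed simp

lemma measurable_hit_prob_backbone_level [measurable]:
  "(\<lambda>T. hit_prob \<beta> s T {u} (backbone_level T m - {u}) n w) \<in> borel_measurable (gw_law p)"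
  by (rule measurable_hit_prob) (auto simp: backbone_level_def level_def)

lemma measurable_hit_prob_single [measurable]:
  "(\<lambda>T. hit_prob \<beta> s T {u} {} n w) \<in> borel_measurable (gw_law p)"
  by (rule measurable_hit_prob) auto

lemma measurable_hit_prob_backbone_height [measurable]:
  "(\<lambda>T. hit_prob \<beta> s T {w. m \<le> backbone_height T w} {} n w) \<in> borel_measurable (gw_law p)"
  by (rule measurable_hit_prob) auto

section \<open>Independence of subtrees\<close>

definition agree_off :: "nat list \<Rightarrow> (nat list \<Rightarrow> nat) \<Rightarrow> (nat list \<Rightarrow> nat) \<Rightarrow> bool" where
  "agree_off u T T' \<longleftrightarrow> (\<forall>v. take (length u) v \<noteq> u \<longrightarrow> T v = T' v)"

text \<open>The recursion stops at \<open>u\<close>, and before that the walk only reads offspring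
  numbers outside the subtree of \<open>u\<close>.\<close>

lemma hit_prob_agree_off:
  assumes a: "agree_off u T T'" and w: "take (length u) w = u \<Longrightarrow> w = u"
  shows "hit_prob \<beta> s T {u} D n w = hit_prob \<beta> s T' {u} D n w"
  using w
proof (induction n arbitrary: w)
  case (Suc n)
  show ?case
  proof (cases "w = u")
    case False
    with Suc.prems have t: "take (length u) w \<noteq> u" by auto
    then have T: "T w = T' w" using a by (simp add: agree_off_def)
    have 1: "hit_prob \<beta> s T {u} D n (butlast w) = hit_prob \<beta> s T' {u} D n (butlast w)"
      using take_butlast_neq[OF t] by (intro Suc.IH) auto
    have 2: "hit_prob \<beta> s T {u} D n (w @ [i]) = hit_prob \<beta> s T' {u} D n (w @ [i])" for i
      using take_snoc_eq[OF t] by (intro Suc.IH) auto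
    have 3: "hit_prob \<beta> s T {u} D n w = hit_prob \<beta> s T' {u} D n w"
      using Suc.prems by (rule Suc.IH)
    have "step_op \<beta> T (hit_prob \<beta> s T {u} D n) w = step_op \<beta> T' (hit_prob \<beta> s T' {u} D n) w"
      using T 1 2 3 2[of _] by (cases "w = []") (auto simp: step_op_def)
    with False show ?thesis by simp
  qed simp
qed simp

lemma gw_tree_agree_off:
  assumes "agree_off u T T'" "length v \<le> length u"
  shows "v \<in> gw_tree T \<longleftrightarrow> v \<in> gw_tree T'"
proof -
  have "T (take j v) = T' (take j v)" if "j < length v" for j
  proof -
    have "length (take (length u) (take j v)) < length u" using that assms(2) by auto
    then have "take (length u) (take j v) \<noteq> u" by (metis less_irrefl)
    then show ?thesis using assms(1) by (simp add: agree_off_def)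
  qed
  then show ?thesis by (auto simp: gw_tree_def)
qed

text \<open>Distinct vertices of one level have disjoint subtrees. The vertex \<open>u\<close> has
  to be removed, because its own membership depends on the survival of its subtree.\<close>

lemma backbone_level_agree_off:
  assumes a: "agree_off u T T'"
  shows "backbone_level T (length u) - {u} = backbone_level T' (length u) - {u}"
proof -
  have "subtree v T = subtree v T'" if "length v = length u" "v \<noteq> u" for v
    using a that by (auto simp: agree_off_def subtree_def fun_eq_iff)
  then show ?thesis using gw_tree_agree_off[OF a] by (auto simp: backbone_level_def level_def)
qed

lemma indep_vars_offspring:
  "prob_space.indep_vars (gw_law p) (\<lambda>_. measure_pmf p) (\<lambda>i T. T i) UNIV"
proof -
  interpret prob_space "gw_law p" by (rule prob_space_gw)
  have rv: "random_variable (measure_pmf p) (\<lambda>T. T i)" for i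
    unfolding gw_law_def by (rule measurable_component_singleton) simp
  have "distr (gw_law p) (PiM UNIV (\<lambda>_. measure_pmf p)) (\<lambda>x. \<lambda>i\<in>UNIV. x i) = gw_law p"
    unfolding gw_law_def by (simp add: restrict_UNIV)
  moreover have "distr (gw_law p) (measure_pmf p) (\<lambda>x. x i) = measure_pmf p" for i
    unfolding gw_law_def by (rule distr_PiM_component) (auto intro: measure_pmf.prob_space_axioms)
  ultimately show ?thesis
    by (subst indep_vars_iff_distr_eq_PiM[OF _ rv]) (auto simp: gw_law_def)
qed

lemma distr_subtree: "distr (gw_law p) (gw_law p) (subtree u) = gw_law p"
proof -
  have "distr (PiM UNIV (\<lambda>_. measure_pmf p)) (\<Pi>\<^sub>M i\<in>UNIV. measure_pmf p) (\<lambda>\<omega>. \<lambda>n\<in>UNIV. \<omega> (u @ n)) = (\<Pi>\<^sub>M i\<in>UNIV. measure_pmf p)"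
    using distr_PiM_reindex[of UNIV "\<lambda>_. measure_pmf p" "\<lambda>w. u @ w" UNIV]
    by (auto simp: inj_on_def measure_pmf.prob_space_axioms)
  then show ?thesis by (simp add: gw_law_def restrict_UNIV subtree_def[abs_def])
qed

lemma nn_integral_subtree:
  assumes "F \<in> borel_measurable (gw_law p)"
  shows "(\<integral>\<^sup>+T. F (subtree u T) \<partial>gw_law p) = (\<integral>\<^sup>+T. F T \<partial>gw_law p)"
  using nn_integral_distr[OF measurable_subtree[where u = u and p = p], where f = F] assms by (simp add: distr_subtree)

text \<open>The coordinates inside and outside the subtree of \<open>u\<close> are independent
  families. \<open>F\<close> reads only the former, and by the invariance assumption the other
  factor is a function of the latter.\<close>

lemma nn_integral_indep_subtree:
  fixes \<Phi> F :: "(nat list \<Rightarrow> nat) \<Rightarrow> ennreal"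
  assumes \<Phi>: "\<Phi> \<in> borel_measurable (gw_law p)" and F: "F \<in> borel_measurable (gw_law p)"
    and inv: "\<And>T T'. agree_off u T T' \<Longrightarrow> \<Phi> T = \<Phi> T'"
  shows "(\<integral>\<^sup>+T. \<Phi> T * F (subtree u T) \<partial>gw_law p) = (\<integral>\<^sup>+T. \<Phi> T \<partial>gw_law p) * (\<integral>\<^sup>+T. F T \<partial>gw_law p)"
proof -
  interpret prob_space "gw_law p" by (rule prob_space_gw)
  define A where "A = {v. take (length u) v \<noteq> u}"
  let ?P = "\<lambda>A. PiM A (\<lambda>_::nat list. measure_pmf p)"
  have uB: "u @ w \<in> - A" for w by (simp add: A_def)
  have ind: "indep_var (?P A) (\<lambda>T. restrict (\<lambda>i. T i) A) (?P (- A)) (\<lambda>T. restrict (\<lambda>i. T i) (- A))"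
    by (rule indep_var_restrict[OF indep_vars_offspring]) auto
  \<comment> \<open>Extends an environment known off the subtree by zeros; the invariance assumption
    makes the filling invisible to the first factor.\<close>
  define e1 where "e1 y i = (if i \<in> A then y i else 0)" for y :: "nat list \<Rightarrow> nat" and i
  define e2 where "e2 y w = y (u @ w)" for y :: "nat list \<Rightarrow> nat" and w
  have m1: "e1 \<in> ?P A \<rightarrow>\<^sub>M gw_law p"
  proof -
    have "(\<lambda>y i. e1 y i) \<in> ?P A \<rightarrow>\<^sub>M ?P UNIV"
    proof (rule measurable_PiM_single')
      fix i show "(\<lambda>y. e1 y i) \<in> ?P A \<rightarrow>\<^sub>M measure_pmf p"
      proof (cases "i \<in> A")
        case True
        then have "(\<lambda>y. y i) \<in> ?P A \<rightarrow>\<^sub>M measure_pmf p" by (rule measurable_component_singleton)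
        with True show ?thesis by (simp add: e1_def)
      qed (simp add: e1_def)
    qed auto
    then show ?thesis by (simp add: gw_law_def)
  qed
  have m2: "e2 \<in> ?P (- A) \<rightarrow>\<^sub>M gw_law p"
  proof -
    have "(\<lambda>y i. e2 y i) \<in> ?P (- A) \<rightarrow>\<^sub>M ?P UNIV"
      unfolding e2_def
    proof (rule measurable_PiM_single')
      show "(\<lambda>y. y (u @ i)) \<in> ?P (- A) \<rightarrow>\<^sub>M measure_pmf p" for i
        by (rule measurable_component_singleton[OF uB])
    qed auto
    then show ?thesis by (simp add: gw_law_def)
  qed
  have "indep_var borel ((\<Phi> \<circ> e1) \<circ> (\<lambda>T. restrict (\<lambda>i. T i) A)) borel ((F \<circ> e2) \<circ> (\<lambda>T. restrict (\<lambda>i. T i) (- A)))"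
    by (rule indep_var_compose[OF ind measurable_comp[OF m1 \<Phi>] measurable_comp[OF m2 F]])
  moreover have "((\<Phi> \<circ> e1) \<circ> (\<lambda>T. restrict (\<lambda>i. T i) A)) = \<Phi>"
  proof
    fix T show "((\<Phi> \<circ> e1) \<circ> (\<lambda>T. restrict (\<lambda>i. T i) A)) T = \<Phi> T"
      unfolding o_def by (rule inv) (simp add: agree_off_def e1_def A_def)
  qed
  moreover have "((F \<circ> e2) \<circ> (\<lambda>T. restrict (\<lambda>i. T i) (- A))) = (\<lambda>T. F (subtree u T))"
  proof
    fix T show "((F \<circ> e2) \<circ> (\<lambda>T. restrict (\<lambda>i. T i) (- A))) T = F (subtree u T)"
      unfolding o_def by (rule arg_cong[where f = F]) (use uB in \<open>auto simp: e2_def subtree_def fun_eq_iff\<close>)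
  qed
  ultimately have "indep_var borel \<Phi> borel (\<lambda>T. F (subtree u T))" by simp
  then have iv: "indep_vars (\<lambda>_. borel) (case_bool \<Phi> (\<lambda>T. F (subtree u T))) UNIV"
    unfolding indep_var_def by (rule back_subst[of "\<lambda>M. indep_vars M _ UNIV"]) (auto split: bool.split)
  have "(\<integral>\<^sup>+T. (\<Prod>b\<in>UNIV. case_bool \<Phi> (\<lambda>T. F (subtree u T)) b T) \<partial>gw_law p) =
      (\<Prod>b\<in>UNIV. \<integral>\<^sup>+T. case_bool \<Phi> (\<lambda>T. F (subtree u T)) b T \<partial>gw_law p)"
    by (rule indep_vars_nn_integral[OF _ iv]) auto
  then show ?thesis by (simp add: UNIV_bool nn_integral_subtree[OF F] mult.commute)
qed

section \<open>Branching at the root\<close>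

lemma emeasure_offspring: "(\<integral>\<^sup>+T. indicator {T. T [] = k} T \<partial>gw_law p) = ennreal (pmf p k)"
proof -
  have "distr (gw_law p) (measure_pmf p) (\<lambda>x. x []) = measure_pmf p"
    unfolding gw_law_def by (rule distr_PiM_component) (auto intro: measure_pmf.prob_space_axioms)
  then have "emeasure (measure_pmf p) {k} = emeasure (distr (gw_law p) (measure_pmf p) (\<lambda>x. x [])) {k}" by simp
  also have "\<dots> = emeasure (gw_law p) {T. T [] = k}"
    by (subst emeasure_distr) (auto simp: vimage_def measurable_pmf_measure2)
  finally have "ennreal (pmf p k) = emeasure (gw_law p) {T. T [] = k}" by (simp add: emeasure_pmf_single)
  moreover have "{T \<in> space (gw_law p). T [] = k} \<in> sets (gw_law p)" by measurable
  ultimately show ?thesis by simp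
qed

text \<open>The subtrees are split off one at a time, each independent of the root and of the
  earlier ones. In this encoding a subtree exists at every index, child or not, so the number
  \<open>j\<close> of factors may differ from the offspring number \<open>k\<close>.\<close>

lemma nn_integral_branch_aux:
  fixes \<phi> :: "nat \<Rightarrow> (nat list \<Rightarrow> nat) \<Rightarrow> ennreal"
  assumes [measurable]: "\<And>i. \<phi> i \<in> borel_measurable (gw_law p)"
  shows "(\<integral>\<^sup>+T. indicator {T. T [] = k} T * (\<Prod>i<j. \<phi> i (subtree [i] T)) \<partial>gw_law p)
    = ennreal (pmf p k) * (\<Prod>i<j. \<integral>\<^sup>+T. \<phi> i T \<partial>gw_law p)"
proof (induction j)
  case 0
  then show ?case by (simp add: emeasure_offspring del: nn_integral_indicator)
next
  case (Suc j)
  have [measurable]: "(\<lambda>T. \<phi> i (subtree [i] T)) \<in> borel_measurable (gw_law p)" for i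
    by (rule measurable_compose[OF measurable_subtree assms])
  let ?\<Phi> = "\<lambda>T. indicator {T. T [] = k} T * (\<Prod>i<j. \<phi> i (subtree [i] T))"
  have "(\<integral>\<^sup>+T. ?\<Phi> T * \<phi> j (subtree [j] T) \<partial>gw_law p) = (\<integral>\<^sup>+T. ?\<Phi> T \<partial>gw_law p) * (\<integral>\<^sup>+T. \<phi> j T \<partial>gw_law p)"
  proof (rule nn_integral_indep_subtree)
    show "?\<Phi> \<in> borel_measurable (gw_law p)" by measurable
    fix T T' assume a: "agree_off [j] T T'"
    have "T [] = T' []" using a by (simp add: agree_off_def)
    moreover have "subtree [i] T = subtree [i] T'" if "i < j" for i
      using a that by (simp add: agree_off_def subtree_def fun_eq_iff)
    then have "(\<Prod>i<j. \<phi> i (subtree [i] T)) = (\<Prod>i<j. \<phi> i (subtree [i] T'))"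
      by (intro prod.cong) auto
    ultimately show "?\<Phi> T = ?\<Phi> T'" by (simp add: indicator_def)
  qed simp
  with Suc show ?case by (simp add: mult.assoc)
qed

lemma nn_integral_by_offspring:
  fixes f :: "(nat list \<Rightarrow> nat) \<Rightarrow> ennreal"
  assumes [measurable]: "f \<in> borel_measurable (gw_law p)"
  shows "(\<integral>\<^sup>+T. f T \<partial>gw_law p) = (\<Sum>k. \<integral>\<^sup>+T. indicator {T. T [] = k} T * f T \<partial>gw_law p)"
proof -
  have "(\<Sum>k. indicator {T. T [] = k} T * f T) = f T" for T :: "nat list \<Rightarrow> nat"
    by (subst suminf_finite[of "{T []}"]) (auto simp: indicator_def)
  then have "(\<integral>\<^sup>+T. f T \<partial>gw_law p) = (\<integral>\<^sup>+T. (\<Sum>k. indicator {T. T [] = k} T * f T) \<partial>gw_law p)"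
    by simp
  also have "\<dots> = (\<Sum>k. \<integral>\<^sup>+T. indicator {T. T [] = k} T * f T \<partial>gw_law p)"
    by (rule nn_integral_suminf) measurable
  finally show ?thesis .
qed

lemma nn_integral_branch_prod:
  fixes \<phi> :: "(nat list \<Rightarrow> nat) \<Rightarrow> ennreal"
  assumes [measurable]: "\<phi> \<in> borel_measurable (gw_law p)"
  shows "(\<integral>\<^sup>+T. (\<Prod>i<T []. \<phi> (subtree [i] T)) \<partial>gw_law p) = (\<Sum>k. ennreal (pmf p k) * (\<integral>\<^sup>+T. \<phi> T \<partial>gw_law p) ^ k)"
proof -
  have [measurable]: "(\<lambda>T. \<phi> (subtree [i] T)) \<in> borel_measurable (gw_law p)" for i
    by (rule measurable_compose[OF measurable_subtree assms])
  have [measurable]: "(\<lambda>T. \<Prod>i<T []. \<phi> (subtree [i] T)) \<in> borel_measurable (gw_law p)"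
    by (rule measurable_compose_countable[where f = "\<lambda>k T. \<Prod>i<k. \<phi> (subtree [i] T)"]) measurable
  have "(\<integral>\<^sup>+T. indicator {T. T [] = k} T * (\<Prod>i<T []. \<phi> (subtree [i] T)) \<partial>gw_law p) =
     (\<integral>\<^sup>+T. indicator {T. T [] = k} T * (\<Prod>i<k. \<phi> (subtree [i] T)) \<partial>gw_law p)" for k
    by (intro nn_integral_cong) (auto simp: indicator_def)
  then show ?thesis
    using nn_integral_branch_aux[of "\<lambda>_. \<phi>" p] by (subst nn_integral_by_offspring) auto
qed

text \<open>The origin of the derivative of the generating function: with extinction for the
  unmarked children, summing over the marked one gives the terms
  \<open>pmf p k * k * q ^ (k - 1)\<close>.\<close>

lemma nn_integral_branch_marked:
  fixes \<phi> \<psi> :: "(nat list \<Rightarrow> nat) \<Rightarrow> ennreal"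
  assumes [measurable]: "\<phi> \<in> borel_measurable (gw_law p)" "\<psi> \<in> borel_measurable (gw_law p)"
    and i: "i < k"
  shows "(\<integral>\<^sup>+T. indicator {T. T [] = k} T * (\<psi> (subtree [i] T) * (\<Prod>j\<in>{..<k} - {i}. \<phi> (subtree [j] T))) \<partial>gw_law p)
    = ennreal (pmf p k) * ((\<integral>\<^sup>+T. \<psi> T \<partial>gw_law p) * (\<integral>\<^sup>+T. \<phi> T \<partial>gw_law p) ^ (k - 1))"
proof -
  have 1: "(\<Prod>j<k. (if j = i then \<psi> else \<phi>) (subtree [j] T)) = \<psi> (subtree [i] T) * (\<Prod>j\<in>{..<k} - {i}. \<phi> (subtree [j] T))" for T
    using i by (subst prod.remove[of _ i]) auto
  have 2: "(\<Prod>j<k. \<integral>\<^sup>+T. (if j = i then \<psi> else \<phi>) T \<partial>gw_law p) = (\<integral>\<^sup>+T. \<psi> T \<partial>gw_law p) * (\<integral>\<^sup>+T. \<phi> T \<partial>gw_law p) ^ (k - 1)"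
    using i by (subst prod.remove[of _ i]) auto
  show ?thesis
    using nn_integral_branch_aux[of "\<lambda>j. if j = i then \<psi> else \<phi>" p k k] unfolding 1 2 by simp
qed

lemma nn_integral_sum_offspring:
  fixes \<psi> :: "(nat list \<Rightarrow> nat) \<Rightarrow> ennreal"
  assumes [measurable]: "\<psi> \<in> borel_measurable (gw_law p)"
  shows "(\<integral>\<^sup>+T. (\<Sum>i<T []. \<psi> (subtree [i] T)) \<partial>gw_law p) =
    (\<Sum>k. ennreal (pmf p k * real k)) * (\<integral>\<^sup>+T. \<psi> T \<partial>gw_law p)"
proof -
  interpret prob_space "gw_law p" by (rule prob_space_gw)
  have [measurable]: "(\<lambda>T. \<psi> (subtree [i] T)) \<in> borel_measurable (gw_law p)" for i
    by (rule measurable_compose[OF measurable_subtree assms])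
  have [measurable]: "(\<lambda>T. \<Sum>i<T []. \<psi> (subtree [i] T)) \<in> borel_measurable (gw_law p)"
    by (rule measurable_compose_countable[where f = "\<lambda>k T. \<Sum>i<k. \<psi> (subtree [i] T)"]) measurable
  have "(\<integral>\<^sup>+T. indicator {T. T [] = k} T * (\<Sum>i<T []. \<psi> (subtree [i] T)) \<partial>gw_law p) =
     ennreal (pmf p k * real k) * (\<integral>\<^sup>+T. \<psi> T \<partial>gw_law p)" for k
  proof -
    have "(\<integral>\<^sup>+T. indicator {T. T [] = k} T * (\<Sum>i<T []. \<psi> (subtree [i] T)) \<partial>gw_law p) =
      (\<integral>\<^sup>+T. (\<Sum>i<k. indicator {T. T [] = k} T * \<psi> (subtree [i] T)) \<partial>gw_law p)"
      by (intro nn_integral_cong) (auto simp: indicator_def sum_distrib_left)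
    also have "\<dots> = (\<Sum>i<k. \<integral>\<^sup>+T. indicator {T. T [] = k} T * \<psi> (subtree [i] T) \<partial>gw_law p)"
      by (rule nn_integral_sum) measurable
    also have "\<dots> = (\<Sum>i<k. ennreal (pmf p k) * (\<integral>\<^sup>+T. \<psi> T \<partial>gw_law p))"
      using nn_integral_branch_marked[of "\<lambda>_. 1" p \<psi> _ k] emeasure_space_1 by (intro sum.cong) auto
    also have "\<dots> = ennreal (pmf p k * real k) * (\<integral>\<^sup>+T. \<psi> T \<partial>gw_law p)"
      by (simp add: ennreal_mult ennreal_of_nat_eq_real_of_nat mult_ac)
    finally show ?thesis .
  qed
  then show ?thesis by (subst nn_integral_by_offspring) (auto simp: ennreal_suminf_multc)
qed

text \<open>Membership of \<open>u\<close> in the backbone level splits into being in the tree,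
  which depends on the proper ancestors of \<open>u\<close> only, and survival of the subtree of
  \<open>u\<close>, which is absorbed into \<open>F\<close>. Each summand is then a product of
  independent factors.\<close>

lemma nn_integral_sum_level:
  fixes \<Phi> :: "nat list \<Rightarrow> (nat list \<Rightarrow> nat) \<Rightarrow> ennreal" and F :: "(nat list \<Rightarrow> nat) \<Rightarrow> ennreal"
  assumes \<Phi>[measurable]: "\<And>u. \<Phi> u \<in> borel_measurable (gw_law p)" and F[measurable]: "F \<in> borel_measurable (gw_law p)"
    and inv: "\<And>u T T'. length u = l \<Longrightarrow> agree_off u T T' \<Longrightarrow> \<Phi> u T = \<Phi> u T'"
  shows "(\<integral>\<^sup>+T. (\<Sum>u\<in>backbone_level T l. \<Phi> u T * F (subtree u T)) \<partial>gw_law p) =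
    (\<integral>\<^sup>+u. (\<integral>\<^sup>+T. \<Phi> u T * indicator {T. u \<in> gw_tree T} T \<partial>gw_law p) \<partial>count_space {u. length u = l})
      * (\<integral>\<^sup>+T. F T * indicator {T. surv T} T \<partial>gw_law p)"
proof -
  let ?\<Phi> = "\<lambda>u T. \<Phi> u T * indicator {T. u \<in> gw_tree T} T"
  let ?F = "\<lambda>T. F T * indicator {T. surv T} T"
  have [measurable]: "(\<lambda>T. ?F (subtree u T)) \<in> borel_measurable (gw_law p)" for u
    by (rule measurable_compose[OF measurable_subtree]) measurable
  have "(\<Sum>u\<in>backbone_level T l. \<Phi> u T * F (subtree u T)) = (\<integral>\<^sup>+u. ?\<Phi> u T * ?F (subtree u T) \<partial>count_space {u. length u = l})" for T
  proof -
    have "(\<integral>\<^sup>+u. ?\<Phi> u T * ?F (subtree u T) \<partial>count_space {u. length u = l}) = (\<Sum>u\<in>backbone_level T l. ?\<Phi> u T * ?F (subtree u T))"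
      by (rule nn_integral_count_space'[OF finite_backbone_level]) (auto simp: backbone_level_def level_def indicator_def)
    also have "\<dots> = (\<Sum>u\<in>backbone_level T l. \<Phi> u T * F (subtree u T))"
      by (intro sum.cong) (auto dest: bblD)
    finally show ?thesis ..
  qed
  then have "(\<integral>\<^sup>+T. (\<Sum>u\<in>backbone_level T l. \<Phi> u T * F (subtree u T)) \<partial>gw_law p) =
    (\<integral>\<^sup>+T. \<integral>\<^sup>+u. ?\<Phi> u T * ?F (subtree u T) \<partial>count_space {u. length u = l} \<partial>gw_law p)"
    by simp
  also have "\<dots> = (\<integral>\<^sup>+u. \<integral>\<^sup>+T. ?\<Phi> u T * ?F (subtree u T) \<partial>gw_law p \<partial>count_space {u. length u = l})"
    by (rule nn_integral_count_space_nn_integral) measurable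
  also have "\<dots> = (\<integral>\<^sup>+u. (\<integral>\<^sup>+T. ?\<Phi> u T \<partial>gw_law p) * (\<integral>\<^sup>+T. ?F T \<partial>gw_law p) \<partial>count_space {u. length u = l})"
  proof (rule nn_integral_cong)
    fix u :: "nat list" assume u: "u \<in> space (count_space {u. length u = l})"
    show "(\<integral>\<^sup>+T. ?\<Phi> u T * ?F (subtree u T) \<partial>gw_law p) = (\<integral>\<^sup>+T. ?\<Phi> u T \<partial>gw_law p) * (\<integral>\<^sup>+T. ?F T \<partial>gw_law p)"
    proof (rule nn_integral_indep_subtree)
      fix T T' assume a: "agree_off u T T'"
      show "?\<Phi> u T = ?\<Phi> u T'"
        using inv[OF _ a] gw_tree_agree_off[OF a, of u] u by (simp add: indicator_def)
    qed measurable
  qed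
  also have "\<dots> = (\<integral>\<^sup>+u. (\<integral>\<^sup>+T. ?\<Phi> u T \<partial>gw_law p) \<partial>count_space {u. length u = l}) * (\<integral>\<^sup>+T. ?F T \<partial>gw_law p)"
    by (rule nn_integral_multc) simp
  finally show ?thesis .
qed

text \<open>Comparing with the case \<open>F = 1\<close> avoids ever evaluating the sum over the vertices of a level.\<close>
lemma nn_integral_sum_level_cross:
  fixes \<Phi> :: "nat list \<Rightarrow> (nat list \<Rightarrow> nat) \<Rightarrow> ennreal" and F :: "(nat list \<Rightarrow> nat) \<Rightarrow> ennreal"
  assumes \<Phi>[measurable]: "\<And>u. \<Phi> u \<in> borel_measurable (gw_law p)" and F[measurable]: "F \<in> borel_measurable (gw_law p)"
    and inv: "\<And>u T T'. length u = l \<Longrightarrow> agree_off u T T' \<Longrightarrow> \<Phi> u T = \<Phi> u T'"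
  shows "(\<integral>\<^sup>+T. (\<Sum>u\<in>backbone_level T l. \<Phi> u T * F (subtree u T)) \<partial>gw_law p) * emeasure (gw_law p) {T. surv T} =
    (\<integral>\<^sup>+T. (\<Sum>u\<in>backbone_level T l. \<Phi> u T) \<partial>gw_law p) * (\<integral>\<^sup>+T. F T * indicator {T. surv T} T \<partial>gw_law p)"
proof -
  have "{T. surv T} \<in> sets (gw_law p)" using measurable_surv[of p] by (simp add: pred_def)
  then have S: "(\<integral>\<^sup>+T. 1 * indicator {T. surv T} T \<partial>gw_law p) = emeasure (gw_law p) {T. surv T}" by simp
  have 1: "(\<lambda>_. 1) \<in> borel_measurable (gw_law p)" by simp
  let ?N = "\<integral>\<^sup>+u. (\<integral>\<^sup>+T. \<Phi> u T * indicator {T. u \<in> gw_tree T} T \<partial>gw_law p) \<partial>count_space {u. length u = l}"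
  have "(\<integral>\<^sup>+T. (\<Sum>u\<in>backbone_level T l. \<Phi> u T * F (subtree u T)) \<partial>gw_law p) =
      ?N * (\<integral>\<^sup>+T. F T * indicator {T. surv T} T \<partial>gw_law p)"
    by (rule nn_integral_sum_level[of \<Phi>, OF \<Phi> F inv])
  moreover have "(\<integral>\<^sup>+T. (\<Sum>u\<in>backbone_level T l. \<Phi> u T * 1) \<partial>gw_law p) =
      ?N * (\<integral>\<^sup>+T. 1 * indicator {T. surv T} T \<partial>gw_law p)"
    by (rule nn_integral_sum_level[of \<Phi>, OF \<Phi> 1 inv])
  ultimately show ?thesis unfolding S mult_1_right by (simp only: mult_ac)
qed

section \<open>Extinction probabilities\<close>

lemma power_Suc_diff_le:
  fixes x q :: real
  assumes "0 \<le> x" "x \<le> q"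
  shows "q ^ Suc k - x ^ Suc k \<le> (real k + 1) * q ^ k * (q - x)"
proof (induction k)
  case (Suc k)
  have "q ^ Suc (Suc k) - x ^ Suc (Suc k) = q * (q ^ Suc k - x ^ Suc k) + x ^ Suc k * (q - x)"
    by (simp add: algebra_simps)
  also have "\<dots> \<le> q * ((real k + 1) * q ^ k * (q - x)) + q ^ Suc k * (q - x)"
    using assms Suc by (intro add_mono mult_left_mono mult_right_mono power_mono) auto
  also have "\<dots> = (real (Suc k) + 1) * q ^ Suc k * (q - x)" by (simp add: algebra_simps)
  finally show ?case .
qed simp

text \<open>A second-order Taylor bound. The remainder coefficient is taken as large as the squared
  exponent; the induction then closes, and summing it against the offspring law produces the second
  moment.\<close>

lemma power_Suc_diff_ge:
  fixes x q :: real
  assumes "0 \<le> x" "x \<le> q" "q \<le> 1"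
  shows "q ^ Suc k - x ^ Suc k \<ge> (real k + 1) * q ^ k * (q - x) - (real k + 1)\<^sup>2 * (q - x)\<^sup>2"
proof (induction k)
  case 0
  then show ?case by simp
next
  case (Suc k)
  let ?d = "q - x"
  have d: "0 \<le> ?d" using assms by simp
  have "(real k + 1) * q ^ k * ?d \<le> (real k + 1) * 1 * ?d"
    using assms by (intro mult_right_mono mult_left_mono power_le_one) auto
  then have 1: "q ^ Suc k - (real k + 1) * ?d \<le> x ^ Suc k"
    using power_Suc_diff_le[OF assms(1,2), of k] by linarith
  have "q * ((real k + 1)\<^sup>2 * ?d\<^sup>2) \<le> 1 * ((real k + 1)\<^sup>2 * ?d\<^sup>2)"
    using assms by (intro mult_right_mono) auto
  then have "(real (Suc k) + 1) * q ^ Suc k * ?d - (real (Suc k) + 1)\<^sup>2 * ?d\<^sup>2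
     \<le> q * ((real k + 1) * q ^ k * ?d - (real k + 1)\<^sup>2 * ?d\<^sup>2) + (q ^ Suc k - (real k + 1) * ?d) * ?d"
  proof -
    have "(real (Suc k) + 1)\<^sup>2 * ?d\<^sup>2 - (real k + 1)\<^sup>2 * ?d\<^sup>2 - (real k + 1) * ?d\<^sup>2 = (real k + 2) * ?d\<^sup>2"
      by (simp add: algebra_simps power2_eq_square)
    moreover have "0 \<le> (real k + 2) * ?d\<^sup>2" by simp
    moreover have "q * ((real k + 1) * q ^ k * ?d) + q ^ Suc k * ?d = (real (Suc k) + 1) * q ^ Suc k * ?d"
      by (simp add: algebra_simps)
    moreover have "(real k + 1) * ?d * ?d = (real k + 1) * ?d\<^sup>2" by (simp add: power2_eq_square)
    ultimately show ?thesis
      using \<open>q * ((real k + 1)\<^sup>2 * ?d\<^sup>2) \<le> 1 * ((real k + 1)\<^sup>2 * ?d\<^sup>2)\<close>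
      unfolding right_diff_distrib[of q] left_diff_distrib[of _ _ ?d] by linarith
  qed
  also have "\<dots> \<le> q * (q ^ Suc k - x ^ Suc k) + x ^ Suc k * ?d"
    using assms d Suc 1 by (intro add_mono mult_left_mono mult_right_mono) auto
  also have "\<dots> = q ^ Suc (Suc k) - x ^ Suc (Suc k)" by (simp add: algebra_simps)
  finally show ?case .
qed

lemma power_Suc_diff_ge_single:
  fixes x q :: real
  assumes "0 \<le> x" "x \<le> q"
  shows "q ^ k * (q - x) \<le> q ^ Suc k - x ^ Suc k"
proof -
  have "x * x ^ k \<le> x * q ^ k" using assms by (intro mult_left_mono power_mono) auto
  then show ?thesis by (simp add: algebra_simps)
qed

lemma prod_indicator:
  fixes k :: nat
  shows "(\<Prod>i<k. indicator A (g i) :: ennreal) = (if \<forall>i<k. g i \<in> A then 1 else 0)"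
  by (induction k) (auto simp: less_Suc_eq)

lemma ennreal_add_le_diff:
  assumes "A + ennreal y \<le> ennreal z" "0 \<le> y"
  shows "A \<le> ennreal (z - y)"
proof (cases A)
  case (real r)
  then have "ennreal (r + y) \<le> ennreal z" using assms by simp
  then have "r + y \<le> z \<or> r + y \<le> 0" by (metis ennreal_le_iff2)
  then have "r \<le> z - y \<or> r = 0" using real assms(2) by linarith
  then show ?thesis
  proof
    assume "r = 0"
    then have "A = 0" using real by simp
    then show ?thesis by simp
  qed (use real in \<open>auto intro!: ennreal_leI\<close>)
next
  case top
  with assms(1) show ?thesis by (simp add: top_unique)
qed

locale biased_gw =
  fixes p :: "nat pmf" and q \<beta> \<gamma> :: real
  assumes p0: "pmf p 0 > 0"
    and mean_int: "integrable (measure_pmf p) real"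
    and mean_gt1: "measure_pmf.expectation p real > 1"
    and second_moment: "integrable (measure_pmf p) (\<lambda>k. real k ^ 2)"
    and q_range: "q \<in> {0..1}" and q_fix: "gen_fun p q = q"
    and q_least: "\<And>s. s \<in> {0..1} \<Longrightarrow> gen_fun p s = s \<Longrightarrow> q \<le> s"
    and beta: "\<beta> > 1 / gen_fun_deriv p q"
    and gamma: "\<gamma> = - ln (gen_fun_deriv p q) / ln \<beta>"
begin

abbreviation "\<mu> \<equiv> gen_fun_deriv p q"
abbreviation "mean_offspring \<equiv> measure_pmf.expectation p real"

lemma pmf_sums:
  assumes f: "\<And>k. f k \<ge> 0" and int: "integrable (measure_pmf p) f"
  shows "(\<lambda>k. pmf p k * f k) sums measure_pmf.expectation p f"
proof -
  have "ennreal (measure_pmf.expectation p f) = (\<integral>\<^sup>+k. ennreal (f k) \<partial>measure_pmf p)"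
    using f int by (intro nn_integral_eq_integral[symmetric]) auto
  also have "\<dots> = (\<Sum>k. ennreal (pmf p k) * ennreal (f k))"
    by (simp add: nn_integral_measure_pmf nn_integral_count_space_nat)
  finally have eq: "ennreal (measure_pmf.expectation p f) = (\<Sum>k. ennreal (pmf p k * f k))"
    using f by (simp add: ennreal_mult)
  have s: "summable (\<lambda>k. pmf p k * f k)"
    using f eq by (intro summable_suminf_not_top) (auto simp: eq[symmetric])
  have "ennreal (measure_pmf.expectation p f) = ennreal (\<Sum>k. pmf p k * f k)"
    unfolding eq using f s by (intro suminf_ennreal2) auto
  then have "measure_pmf.expectation p f = (\<Sum>k. pmf p k * f k)"
    using f s by (subst (asm) ennreal_inj) (auto intro!: suminf_nonneg)
  with s show ?thesis by (simp add: summable_sums)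
qed

lemma summable_pmf:
  assumes "\<And>k. \<bar>f k\<bar> \<le> C * (1 + real k ^ 2)"
  shows "summable (\<lambda>k. pmf p k * f k)"
proof (rule summable_comparison_test')
  have "summable (\<lambda>k. pmf p k * 1)" "summable (\<lambda>k. pmf p k * real k ^ 2)"
    using pmf_sums[of "\<lambda>_. 1"] pmf_sums[OF _ second_moment] by (auto simp: sums_iff)
  then have "summable (\<lambda>k. C * (pmf p k * 1 + pmf p k * real k ^ 2))"
    by (intro summable_mult summable_add)
  then show "summable (\<lambda>k. pmf p k * (C * (1 + real k ^ 2)))" by (simp add: algebra_simps)
  show "norm (pmf p k * f k) \<le> pmf p k * (C * (1 + real k ^ 2))" for k
    using assms[of k] by (simp add: abs_mult mult_left_mono)
qed

lemma k_le: "real k \<le> 1 + real k ^ 2"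
proof (cases k)
  case (Suc j)
  then have "real k * 1 \<le> real k * real k" by (intro mult_left_mono) auto
  then show ?thesis by (simp add: power2_eq_square)
qed simp

lemma summable_gen:
  assumes "0 \<le> z" "z \<le> 1"
  shows "summable (\<lambda>k. pmf p k * z ^ k)"
  using assms by (intro summable_pmf[where C = 1]) (auto simp: power_le_one intro: order_trans[of _ 1])

lemma summable_mean: "summable (\<lambda>k. pmf p k * real k)"
  using k_le by (intro summable_pmf[where C = 1]) auto

lemma summable_deriv:
  assumes "0 \<le> z" "z \<le> 1"
  shows "summable (\<lambda>k. pmf p k * (real k * z ^ (k - 1)))"
proof (rule summable_pmf[where C = 1])
  fix k
  have "real k * z ^ (k - 1) \<le> real k * 1" using assms by (intro mult_left_mono power_le_one) auto
  then show "\<bar>real k * z ^ (k - 1)\<bar> \<le> 1 * (1 + real k ^ 2)"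
    using k_le[of k] assms by simp
qed

lemma sums_mean: "(\<lambda>k. pmf p k * real k) sums mean_offspring"
  by (rule pmf_sums[OF _ mean_int]) simp

lemma sums_one: "(\<lambda>k. pmf p k) sums 1"
  using pmf_sums[of "\<lambda>_. 1"] by simp

lemma gen_fun_mono:
  assumes "0 \<le> x" "x \<le> y" "y \<le> 1"
  shows "gen_fun p x \<le> gen_fun p y"
  unfolding gen_fun_def using assms
  by (intro suminf_le summable_gen mult_left_mono power_mono) auto

lemma ennreal_gen_fun:
  assumes "0 \<le> x" "x \<le> 1"
  shows "(\<Sum>k. ennreal (pmf p k) * ennreal x ^ k) = ennreal (gen_fun p x)"
proof -
  have "(\<Sum>k. ennreal (pmf p k) * ennreal x ^ k) = (\<Sum>k. ennreal (pmf p k * x ^ k))"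
    using assms by (simp add: ennreal_mult ennreal_power)
  also have "\<dots> = ennreal (gen_fun p x)"
    unfolding gen_fun_def using assms summable_gen[OF assms] by (intro suminf_ennreal2) auto
  finally show ?thesis .
qed

sublocale G: prob_space "gw_law p"
  by (rule prob_space_gw)

text \<open>Serves both the recursion for extinction by generation \<open>h\<close> and the fixed
  point equation for eventual extinction.\<close>

lemma extinction_rec:
  assumes [measurable]: "Measurable.pred (gw_law p) P" "Measurable.pred (gw_law p) Q"
    and Q: "\<And>T. Q T \<longleftrightarrow> (\<forall>i<T []. P (subtree [i] T))"
  shows "measure (gw_law p) {T. Q T} = gen_fun p (measure (gw_law p) {T. P T})"
proof -
  have sP: "{T. P T} \<in> sets (gw_law p)" "{T. Q T} \<in> sets (gw_law p)"
    using assms(1,2) by (simp_all add: pred_def)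
  have "emeasure (gw_law p) {T. Q T} = (\<integral>\<^sup>+T. indicator {T. Q T} T \<partial>gw_law p)"
    using sP by simp
  also have "\<dots> = (\<integral>\<^sup>+T. (\<Prod>i<T []. indicator {T. P T} (subtree [i] T)) \<partial>gw_law p)"
    unfolding prod_indicator by (intro nn_integral_cong) (auto simp: Q indicator_def)
  also have "\<dots> = (\<Sum>k. ennreal (pmf p k) * (\<integral>\<^sup>+T. indicator {T. P T} T \<partial>gw_law p) ^ k)"
    using sP by (intro nn_integral_branch_prod) auto
  also have "(\<integral>\<^sup>+T. indicator {T. P T} T \<partial>gw_law p) = ennreal (measure (gw_law p) {T. P T})"
    using sP by (simp add: G.emeasure_eq_measure)
  also have "(\<Sum>k. ennreal (pmf p k) * \<dots> ^ k) = ennreal (gen_fun p (measure (gw_law p) {T. P T}))"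
    by (rule ennreal_gen_fun) auto
  finally have e: "ennreal (measure (gw_law p) {T. Q T}) = ennreal (gen_fun p (measure (gw_law p) {T. P T}))"
    by (simp add: G.emeasure_eq_measure)
  have "0 \<le> gen_fun p (measure (gw_law p) {T. P T})"
    unfolding gen_fun_def by (intro suminf_nonneg summable_gen) auto
  with e show ?thesis by simp
qed

definition extinct_by :: "nat \<Rightarrow> real" where
  "extinct_by h = measure (gw_law p) {T. \<not> alive h T}"

lemma extinct_by_0: "extinct_by 0 = 0"
  by (simp add: extinct_by_def)

lemma extinct_by_Suc: "extinct_by (Suc h) = gen_fun p (extinct_by h)"
  unfolding extinct_by_def by (rule extinction_rec) auto

lemma ext_fix: "measure (gw_law p) {T. \<not> surv T} = gen_fun p (measure (gw_law p) {T. \<not> surv T})"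
proof (rule extinction_rec)
  show "\<not> surv T \<longleftrightarrow> (\<forall>i<T []. \<not> surv (subtree [i] T))" for T
    using surv_iff[of T] by blast
qed measurable

lemma extinct_by_range: "0 \<le> extinct_by h" "extinct_by h \<le> 1"
  by (auto simp: extinct_by_def)

text \<open>The iterates of the monotone generating function started at zero never pass a point that
  it maps below itself.\<close>

lemma extinct_by_le_super:
  assumes "0 \<le> z" "z \<le> 1" "gen_fun p z \<le> z"
  shows "extinct_by h \<le> z"
proof (induction h)
  case (Suc h)
  have "extinct_by (Suc h) \<le> gen_fun p z" unfolding extinct_by_Suc using Suc assms extinct_by_range by (intro gen_fun_mono) auto
  with assms show ?case by simp
qed (simp add: extinct_by_0 assms)

lemma extinct_by_tendsto: "extinct_by \<longlonglongrightarrow> measure (gw_law p) {T. \<not> surv T}"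
proof -
  have "(\<lambda>h. measure (gw_law p) {T. \<not> alive h T}) \<longlonglongrightarrow> measure (gw_law p) (\<Union>h. {T. \<not> alive h T})"
  proof (rule G.finite_Lim_measure_incseq)
    have "{T \<in> space (gw_law p). \<not> alive h T} \<in> sets (gw_law p)" for h by measurable
    then show "range (\<lambda>h. {T. \<not> alive h T}) \<subseteq> sets (gw_law p)" by auto
    show "incseq (\<lambda>h. {T. \<not> alive h T})" using alive_antimono by (auto simp: incseq_def)
  qed
  moreover have "(\<Union>h. {T. \<not> alive h T}) = {T. \<not> surv T}" by (auto simp: surv_def)
  ultimately show ?thesis by (simp add: extinct_by_def[abs_def])
qed

text \<open>The limit of the iterates is at most \<open>q\<close>, since \<open>q\<close> is fixed,
  and it is itself a fixed point, hence at least \<open>q\<close> by minimality.\<close>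

lemma ext_prob: "measure (gw_law p) {T. \<not> surv T} = q"
proof (rule antisym)
  show "measure (gw_law p) {T. \<not> surv T} \<le> q"
    using q_range q_fix by (intro LIMSEQ_le_const2[OF extinct_by_tendsto]) (auto intro!: exI[of _ 0] extinct_by_le_super)
  show "q \<le> measure (gw_law p) {T. \<not> surv T}"
    using ext_fix by (intro q_least) auto
qed

lemma ex_big_offspring: "\<exists>k0\<ge>2. pmf p k0 > 0"
proof (rule ccontr)
  assume "\<not> ?thesis"
  then have z: "pmf p k = 0" if "k \<ge> 2" for k using that by (metis order_le_less pmf_nonneg)
  have "mean_offspring \<le> (\<Sum>k. pmf p k)"
    unfolding sums_unique[OF sums_mean]
  proof (rule suminf_le)
    show "pmf p k * real k \<le> pmf p k" for k
      using z[of k] by (cases "k \<ge> 2") (auto intro!: mult_left_le)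
  qed (use summable_mean sums_one in \<open>auto simp: sums_iff\<close>)
  with sums_unique[OF sums_one] mean_gt1 show False by simp
qed

lemma q_pos: "q > 0"
proof -
  have "extinct_by (Suc 0) = pmf p 0" unfolding extinct_by_Suc extinct_by_0 gen_fun_def by (simp add: powser_zero)
  moreover have "extinct_by (Suc 0) \<le> q" using q_range q_fix by (intro extinct_by_le_super) auto
  ultimately show ?thesis using p0 by simp
qed

text \<open>A truncated mean already exceeds one. The truncated sum of
  \<open>pmf p k * (1 - z ^ k)\<close> is \<open>(1 - z) * h z\<close> with a polynomial
  \<open>h\<close> and \<open>h 1 > 1\<close>, so the generating function lies below the diagonal at
  some \<open>z < 1\<close>, which then bounds \<open>q\<close>. The truncation avoids
  differentiating the power series at the endpoint 1.\<close>

lemma q_less_1: "q < 1"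
proof -
  have "(\<lambda>n. \<Sum>k<n. pmf p k * real k) \<longlonglongrightarrow> mean_offspring" using sums_mean by (simp add: sums_def)
  then have "\<forall>\<^sub>F n in sequentially. 1 < (\<Sum>k<n. pmf p k * real k)"
    using mean_gt1 by (rule order_tendstoD)
  then obtain N where N: "1 < (\<Sum>k<N. pmf p k * real k)"
    by (auto simp: eventually_sequentially)
  define h where "h z = (\<Sum>k<N. pmf p k * (\<Sum>j<k. z ^ j))" for z :: real
  have "continuous_on UNIV h" unfolding h_def by (intro continuous_intros)
  then have "isCont h 1" by (simp add: continuous_on_eq_continuous_at)
  then have "(h \<longlongrightarrow> h 1) (at_left 1)" by (simp add: isCont_def filterlim_at_split)
  moreover have "h 1 > 1" using N by (simp add: h_def)
  ultimately have "\<forall>\<^sub>F z in at_left 1. 1 < h z" by (rule order_tendstoD(1))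
  moreover have "\<forall>\<^sub>F z in at_left (1::real). z \<in> {0<..<1}"
    by (rule eventually_at_leftI[of 0]) auto
  ultimately have "\<forall>\<^sub>F z in at_left 1. 1 < h z \<and> z \<in> {0<..<1}" by (rule eventually_conj)
  then obtain z where z: "1 < h z" "0 < z" "z < 1"
    using eventually_happens[of _ "at_left (1::real)"] by (auto simp: trivial_limit_at_left_real)
  have s: "summable (\<lambda>k. pmf p k * (1 - z ^ k))"
    using summable_diff[OF _ summable_gen[of z]] sums_one z by (auto simp: sums_iff algebra_simps)
  have A: "1 - gen_fun p z = (\<Sum>k. pmf p k * (1 - z ^ k))"
    using suminf_diff[OF _ summable_gen[of z]] sums_one z by (auto simp: sums_iff algebra_simps gen_fun_def)
  have B: "(\<Sum>k<N. pmf p k * (1 - z ^ k)) \<le> (\<Sum>k. pmf p k * (1 - z ^ k))"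
    using z by (intro sum_le_suminf s) (auto intro!: mult_nonneg_nonneg simp: power_le_one)
  have C: "(\<Sum>k<N. pmf p k * (1 - z ^ k)) = (1 - z) * h z"
    unfolding h_def sum_distrib_left[of "1 - z" _ "{..<N}"] by (intro sum.cong refl, subst one_diff_power_eq) (simp only: mult_ac)
  have "(1 - z) * 1 < (1 - z) * h z" using z by (intro mult_strict_left_mono) auto
  then have "1 - z < (\<Sum>k<N. pmf p k * (1 - z ^ k))" unfolding C by simp
  also note B
  also note A[symmetric]
  finally have "gen_fun p z \<le> z" by simp
  then have "extinct_by h \<le> z" for h using z by (intro extinct_by_le_super) auto
  then have "q \<le> z" unfolding ext_prob[symmetric]
    by (intro LIMSEQ_le_const2[OF extinct_by_tendsto]) auto
  with z show ?thesis by simp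
qed

lemma \<mu>_sums: "(\<lambda>k. pmf p k * (real k * q ^ (k - 1))) sums \<mu>"
  using summable_sums[OF summable_deriv[of q]] q_range by (simp add: gen_fun_deriv_def mult.assoc)

lemma \<mu>_pos: "\<mu> > 0"
proof -
  obtain k0 where k0: "k0 \<ge> 2" "pmf p k0 > 0" using ex_big_offspring by blast
  have "0 < (\<Sum>k. pmf p k * (real k * q ^ (k - 1)))"
    using k0 q_pos \<mu>_sums by (intro suminf_pos2[of _ k0]) (auto simp: sums_iff)
  then show ?thesis using \<mu>_sums by (simp add: sums_iff)
qed

text \<open>Each power lies above its tangent at \<open>q\<close>, strictly for an exponent
  \<open>k0 \<ge> 2\<close> of positive weight. Summing up at the point 1 compares
  \<open>\<mu> * (1 - q)\<close> with \<open>1 - q\<close>.\<close>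

lemma \<mu>_less_1: "\<mu> < 1"
proof -
  obtain k0 where k0: "k0 \<ge> 2" "pmf p k0 > 0" using ex_big_offspring by blast
  let ?f = "\<lambda>k. pmf p k * (1 - q ^ k) - pmf p k * (real k * q ^ (k - 1)) * (1 - q)"
  have B: "(real k * q ^ (k - 1)) * (1 - q) \<le> 1 - q ^ k" for k
  proof (cases k)
    case (Suc j)
    have "(\<Sum>i<k. q ^ (k - 1)) \<le> (\<Sum>i<k. q ^ i)"
      using q_pos q_less_1 by (intro sum_mono power_decreasing) auto
    then have "(1 - q) * (real k * q ^ (k - 1)) \<le> (1 - q) * (\<Sum>i<k. q ^ i)"
      using q_less_1 by (intro mult_left_mono) auto
    then show ?thesis using one_diff_power_eq[of q k] by (simp add: mult.commute)
  qed simp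
  have B0: "(real k0 * q ^ (k0 - 1)) * (1 - q) < 1 - q ^ k0"
  proof -
    have "q ^ (k0 - 1) < q ^ 0" using q_pos q_less_1 k0 by (intro power_strict_decreasing) auto
    then have "(\<Sum>i<k0. q ^ (k0 - 1)) < (\<Sum>i<k0. q ^ i)"
      using q_pos q_less_1 k0 by (intro sum_strict_mono_ex1) (auto intro!: power_decreasing bexI[of _ 0])
    then have "(1 - q) * (real k0 * q ^ (k0 - 1)) < (1 - q) * (\<Sum>i<k0. q ^ i)"
      using q_less_1 by (intro mult_strict_left_mono) auto
    then show ?thesis using one_diff_power_eq[of q k0] by (simp add: mult.commute)
  qed
  have s1: "(\<lambda>k. pmf p k * (1 - q ^ k)) sums (1 - q)"
    using sums_diff[OF sums_one summable_sums[OF summable_gen[of q]]] q_range q_fix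
    by (simp add: algebra_simps gen_fun_def)
  have s: "?f sums (1 - q - \<mu> * (1 - q))"
    by (intro sums_diff s1 sums_mult2 \<mu>_sums)
  have "0 < (\<Sum>k. ?f k)"
  proof (rule suminf_pos2[of _ k0])
    show "summable ?f" using s by (simp add: sums_iff)
    show "0 \<le> ?f k" for k using mult_left_mono[OF B[of k], of "pmf p k"] by (simp add: mult.assoc)
    show "0 < ?f k0" using mult_strict_left_mono[OF B0, of "pmf p k0"] k0 by (simp add: mult.assoc)
  qed
  then have "0 < (1 - q) * (1 - \<mu>)" using s by (simp add: sums_iff algebra_simps)
  then show ?thesis using q_less_1 by (simp add: zero_less_mult_iff)
qed

lemma \<beta>\<mu>: "\<beta> * \<mu> > 1"
  using beta \<mu>_pos by (simp add: pos_divide_less_eq)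

lemma \<beta>_gt_1: "\<beta> > 1"
proof -
  have "1 < 1 / \<mu>" using \<mu>_pos \<mu>_less_1 by simp
  with beta show ?thesis by simp
qed

lemma \<gamma>_range: "0 < \<gamma>" "\<gamma> < 1"
proof -
  have l: "ln \<mu> < 0" "0 < ln \<beta>" using \<mu>_pos \<mu>_less_1 \<beta>_gt_1 by auto
  then show "0 < \<gamma>" by (simp add: gamma divide_neg_pos)
  have "0 < ln (\<beta> * \<mu>)" using \<beta>\<mu> by simp
  then have "0 < ln \<beta> + ln \<mu>" using \<mu>_pos \<beta>_gt_1 by (simp add: ln_mult)
  then have "- ln \<mu> < 1 * ln \<beta>" by linarith
  then show "\<gamma> < 1" unfolding gamma using l(2) by (simp only: pos_divide_less_eq)
qed

lemma \<mu>_eq_powr: "\<mu> = \<beta> powr (- \<gamma>)"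
proof -
  have "ln \<beta> > 0" using \<beta>_gt_1 by simp
  then have "- \<gamma> * ln \<beta> = ln \<mu>" by (simp add: gamma)
  then show ?thesis using \<mu>_pos \<beta>_gt_1 by (simp add: powr_def)
qed

section \<open>Tail of the trap height\<close>

lemma extinct_by_le_q: "extinct_by h \<le> q"
  using q_range q_fix by (intro extinct_by_le_super) auto

text \<open>The probability that the tree is finite and still reaches generation \<open>h\<close>,
  as \<open>emeasure_trap\<close> shows.\<close>

definition trap_tail :: "nat \<Rightarrow> real" where "trap_tail h = q - extinct_by h"

lemma trap_tail_nonneg: "trap_tail h \<ge> 0" using extinct_by_le_q by (simp add: trap_tail_def)

lemma trap_tail_Suc_sums: "(\<lambda>k. pmf p k * (q ^ k - extinct_by h ^ k)) sums trap_tail (Suc h)"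
  using sums_diff[OF summable_sums[OF summable_gen[of q]] summable_sums[OF summable_gen[of "extinct_by h"]]]
    q_range extinct_by_range[of h] q_fix
  by (simp add: trap_tail_def extinct_by_Suc gen_fun_def algebra_simps)

lemma trap_tail_Suc_le: "trap_tail (Suc h) \<le> \<mu> * trap_tail h"
proof (rule sums_le[OF _ trap_tail_Suc_sums sums_mult2[OF \<mu>_sums]])
  show "pmf p k * (q ^ k - extinct_by h ^ k) \<le> pmf p k * (real k * q ^ (k - 1)) * trap_tail h" for k
  proof (cases k)
    case (Suc j)
    then show ?thesis using power_Suc_diff_le[OF extinct_by_range(1) extinct_by_le_q, of j h]
      by (auto simp: trap_tail_def mult.assoc add.commute intro!: mult_left_mono)
  qed simp
qed

lemma trap_tail_le: "trap_tail h \<le> \<mu> ^ h"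
proof (induction h)
  case 0
  then show ?case using q_less_1 by (simp add: trap_tail_def extinct_by_0)
next
  case (Suc h)
  have "trap_tail (Suc h) \<le> \<mu> * trap_tail h" by (rule trap_tail_Suc_le)
  also have "\<dots> \<le> \<mu> * \<mu> ^ h" using Suc \<mu>_pos by (intro mult_left_mono) auto
  finally show ?case by simp
qed

text \<open>The reciprocals \<open>y h\<close> of \<open>trap_tail h\<close> satisfy \<open>y (h + 1) \<le> y h / \<mu> + C\<close>; this is where the second moment is used.\<close>
lemma trap_tail_ge: "\<exists>c>0. \<forall>h. c * \<mu> ^ h \<le> trap_tail h"
proof -
  obtain k0 where k0: "k0 \<ge> 2" "pmf p k0 > 0" using ex_big_offspring by blast
  define \<kappa> where "\<kappa> = pmf p k0 * q ^ (k0 - 1)"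
  define K where "K = (\<Sum>k. pmf p k * real k ^ 2)"
  have Ks: "(\<lambda>k. pmf p k * real k ^ 2) sums K"
    unfolding K_def by (intro summable_sums summable_pmf[where C = 1]) auto
  have \<kappa>0: "\<kappa> > 0" using k0 q_pos by (simp add: \<kappa>_def)
  have K0: "K \<ge> 0" unfolding K_def using Ks by (intro suminf_nonneg) (auto simp: sums_iff)
  \<comment> \<open>A crude linear lower bound from one term of the series. It gives positivity, and
    in \<open>rec\<close> it keeps the denominator under control while the quadratic bound handles
    the numerator.\<close>
  have single: "\<kappa> * trap_tail h \<le> trap_tail (Suc h)" for h
  proof -
    obtain j where j: "k0 = Suc j" using k0 by (cases k0) auto
    have "\<kappa> * trap_tail h \<le> pmf p k0 * (q ^ k0 - extinct_by h ^ k0)"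
      using power_Suc_diff_ge_single[OF extinct_by_range(1) extinct_by_le_q, of j h] k0
      by (auto simp: \<kappa>_def trap_tail_def j mult.assoc intro!: mult_left_mono)
    also have "\<dots> \<le> (\<Sum>k. pmf p k * (q ^ k - extinct_by h ^ k))"
    proof -
      have "0 \<le> pmf p k * (q ^ k - extinct_by h ^ k)" for k
        using power_mono[OF extinct_by_le_q extinct_by_range(1), of h k] by simp
      then show ?thesis
        using sum_le_suminf[of "\<lambda>k. pmf p k * (q ^ k - extinct_by h ^ k)" "{k0}"] trap_tail_Suc_sums[of h]
        by (auto simp: sums_iff)
    qed
    also have "\<dots> = trap_tail (Suc h)" using trap_tail_Suc_sums[of h] by (simp add: sums_iff)
    finally show ?thesis .
  qed
  have quad: "\<mu> * trap_tail h - K * (trap_tail h)\<^sup>2 \<le> trap_tail (Suc h)" for h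
  proof (rule sums_le[OF _ sums_diff[OF sums_mult2[OF \<mu>_sums] sums_mult2[OF Ks]] trap_tail_Suc_sums])
    show "pmf p k * (real k * q ^ (k - 1)) * trap_tail h - pmf p k * real k ^ 2 * (trap_tail h)\<^sup>2 \<le> pmf p k * (q ^ k - extinct_by h ^ k)" for k
    proof (cases k)
      case (Suc j)
      have "pmf p k * ((real j + 1) * q ^ j * (q - extinct_by h) - (real j + 1)\<^sup>2 * (q - extinct_by h)\<^sup>2) \<le> pmf p k * (q ^ Suc j - extinct_by h ^ Suc j)"
        using power_Suc_diff_ge[OF extinct_by_range(1) extinct_by_le_q, of j h] q_less_1 by (intro mult_left_mono) auto
      then show ?thesis using Suc by (simp add: trap_tail_def algebra_simps)
    qed simp
  qed
  have apos: "trap_tail h > 0" for h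
  proof (induction h)
    case (Suc h)
    then have "0 < \<kappa> * trap_tail h" using \<kappa>0 by simp
    with single[of h] show ?case by linarith
  qed (simp add: trap_tail_def extinct_by_0 q_pos)
  define C where "C = K / (\<mu> * \<kappa>)"
  have C0: "C \<ge> 0" using K0 \<mu>_pos \<kappa>0 by (simp add: C_def)
  have rec: "1 / trap_tail (Suc h) \<le> 1 / trap_tail h / \<mu> + C" for h
  proof -
    let ?a = "trap_tail h" and ?b = "trap_tail (Suc h)"
    have "1 / ?b - 1 / ?a / \<mu> = (\<mu> * ?a - ?b) / (\<mu> * ?a * ?b)"
      using apos[of h] apos[of "Suc h"] \<mu>_pos by (simp add: field_simps)
    also have "\<dots> \<le> (K * ?a\<^sup>2) / (\<mu> * ?a * ?b)"
      using quad[of h] apos[of h] apos[of "Suc h"] \<mu>_pos by (intro divide_right_mono) auto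
    also have "\<dots> \<le> (K * ?a\<^sup>2) / (\<mu> * ?a * (\<kappa> * ?a))"
      using single[of h] apos[of h] apos[of "Suc h"] \<mu>_pos \<kappa>0 K0
      by (intro divide_left_mono mult_left_mono mult_pos_pos) auto
    also have "\<dots> = C" using apos[of h] by (simp add: C_def power2_eq_square)
    finally show ?thesis by simp
  qed
  \<comment> \<open>\<open>E\<close> solves \<open>E / \<mu> = C + E\<close>, so that the reciprocal
    of the tail plus \<open>E\<close> grows by at most the factor \<open>1 / \<mu>\<close> per
    generation; \<open>D\<close> is its initial value.\<close>
  define E where "E = C * \<mu> / (1 - \<mu>)"
  define D where "D = 1 / q + E"
  have E0: "E \<ge> 0" using C0 \<mu>_pos \<mu>_less_1 by (simp add: E_def)
  have EC: "E / \<mu> = C + E" using \<mu>_pos \<mu>_less_1 by (simp add: E_def field_simps)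
  have D0: "D > 0" using E0 q_pos by (simp add: D_def add_pos_nonneg)
  have main: "1 / trap_tail h + E \<le> D / \<mu> ^ h" for h
  proof (induction h)
    case (Suc h)
    have "1 / trap_tail (Suc h) + E \<le> 1 / trap_tail h / \<mu> + (C + E)" using rec[of h] by simp
    also have "\<dots> = (1 / trap_tail h + E) / \<mu>" unfolding EC[symmetric] by (simp add: add_divide_distrib)
    also have "\<dots> \<le> (D / \<mu> ^ h) / \<mu>" using Suc \<mu>_pos by (intro divide_right_mono) auto
    also have "\<dots> = D / \<mu> ^ Suc h" by (simp add: mult.commute)
    finally show ?case .
  qed (simp add: trap_tail_def extinct_by_0 D_def)
  have "1 / D * \<mu> ^ h \<le> trap_tail h" for h
  proof -
    have "1 / trap_tail h \<le> D / \<mu> ^ h" using main[of h] E0 by linarith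
    then have "\<mu> ^ h \<le> D * trap_tail h" using apos[of h] \<mu>_pos by (simp add: field_simps)
    then show ?thesis using D0 by (simp add: field_simps)
  qed
  then show ?thesis using D0 by (intro exI[of _ "1 / D"]) auto
qed

lemma sets_gw_Collect: "Measurable.pred (gw_law p) P \<Longrightarrow> {T. P T} \<in> sets (gw_law p)"
  by (simp add: pred_def)

lemma emeasure_surv: "emeasure (gw_law p) {T. surv T} = ennreal (1 - q)"
proof -
  have "measure (gw_law p) (space (gw_law p) - {T. \<not> surv T}) = 1 - q"
    using ext_prob by (subst G.prob_compl) (auto intro!: sets_gw_Collect)
  moreover have "space (gw_law p) - {T. \<not> surv T} = {T. surv T}" by auto
  ultimately show ?thesis by (simp add: G.emeasure_eq_measure)
qed

lemma emeasure_trap: "emeasure (gw_law p) {T. \<not> surv T \<and> alive h T} = ennreal (trap_tail h)"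
proof -
  have "{T. \<not> surv T \<and> alive h T} = {T. \<not> surv T} - {T. \<not> alive h T}" by auto
  moreover have "measure (gw_law p) ({T. \<not> surv T} - {T. \<not> alive h T}) = q - extinct_by h"
    unfolding ext_prob[symmetric] extinct_by_def
    by (rule G.finite_measure_Diff) (auto intro!: sets_gw_Collect simp: surv_def)
  ultimately show ?thesis by (simp add: G.emeasure_eq_measure trap_tail_def)
qed

end

lemma ennreal_le_divideI:
  assumes "A * ennreal c \<le> ennreal z" "0 < c"
  shows "A \<le> ennreal (z / c)"
proof (cases A)
  case (real r)
  then have "ennreal (r * c) \<le> ennreal z" using assms by (simp add: ennreal_mult)
  then have "r * c \<le> z \<or> r * c \<le> 0" by (metis ennreal_le_iff2)
  then show ?thesis
  proof
    assume "r * c \<le> 0"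
    then have "A = 0" using real assms(2) by (simp add: mult_le_0_iff)
    then show ?thesis by simp
  qed (use real assms(2) in \<open>auto intro!: ennreal_leI simp: pos_le_divide_eq\<close>)
next
  case top
  with assms show ?thesis by (simp add: top_unique ennreal_top_mult split: if_splits)
qed

lemma ennreal_affine:
  assumes "0 \<le> c" "0 \<le> b" "0 \<le> y" "0 \<le> z"
  shows "ennreal (c * (1 + b * (y + z))) = ennreal c * (1 + ennreal b * (ennreal y + ennreal z))"
  using assms by (simp add: ennreal_mult)

lemma ennreal_add_divide:
  assumes "0 \<le> a" "0 \<le> g" "0 < x"
  shows "ennreal a + ennreal (1 / x) * ennreal g = ennreal (a + g / x)"
  using assms by (simp add: ennreal_mult[symmetric] ennreal_plus[symmetric] del: ennreal_plus)

lemma nn_integral_affine_sum: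
  assumes "A \<in> borel_measurable M" "\<And>i. B i \<in> borel_measurable M"
  shows "(\<integral>\<^sup>+x. c * A x + d * (\<Sum>i<k::nat. B i x) \<partial>M) = c * (\<integral>\<^sup>+x. A x \<partial>M) + d * (\<Sum>i<k. \<integral>\<^sup>+x. B i x \<partial>M)"
  using assms by (simp add: nn_integral_add nn_integral_cmult nn_integral_sum)

lemma measurable_annealed_fst [measurable]: "fst \<in> annealed p \<rightarrow>\<^sub>M gw_law p"
proof -
  have "fst \<in> gw_law_surv p \<Otimes>\<^sub>M noise_law \<rightarrow>\<^sub>M gw_law_surv p" by measurable
  then show ?thesis by (simp add: annealed_def gw_law_surv_def cong: measurable_cong_sets)
qed

lemma measurable_annealed_snd [measurable]: "snd \<in> annealed p \<rightarrow>\<^sub>M noise_law"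
  by (simp add: annealed_def)

lemma measurable_annealed_walk_from [measurable]:
  "(\<lambda>\<omega>. walk_from \<beta> (fst \<omega>) w (snd \<omega>) n) \<in> annealed p \<rightarrow>\<^sub>M count_space UNIV"
  by (rule measurable_walk_from) measurable

lemma measurable_annealed_backbone_height [measurable]:
  "(\<lambda>\<omega>. backbone_height (fst \<omega>) (walk_from \<beta> (fst \<omega>) w (snd \<omega>) n)) \<in> annealed p \<rightarrow>\<^sub>M count_space UNIV"
  by (rule measurable_compose_countable[where f = "\<lambda>w \<omega>. backbone_height (fst \<omega>) w"]) measurable

context biased_gw
begin

section \<open>Environment means of trap times, cluster costs and level factors\<close>

lemma q_nn: "(\<integral>\<^sup>+T. indicator {T. \<not> surv T} T \<partial>gw_law p) = ennreal q"
proof -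
  have "{T. \<not> surv T} \<in> sets (gw_law p)" by (rule sets_gw_Collect) measurable
  then show ?thesis using ext_prob by (simp add: G.emeasure_eq_measure)
qed

text \<open>Chosen so that \<open>C3 * ((\<beta> * \<mu>) ^ h - 1)\<close> solves the recursion
  starting at zero with increment \<open>1 + \<beta> * \<mu>\<close> and ratio
  \<open>\<beta> * \<mu>\<close>.\<close>

definition C3 :: real where "C3 = (1 + \<beta> * \<mu>) / (\<beta> * \<mu> - 1)"

lemma C3_pos: "C3 > 0"
  using \<beta>\<mu> by (simp add: C3_def)

definition mean_trap_time :: "nat \<Rightarrow> ennreal" where
  "mean_trap_time h = (\<integral>\<^sup>+T. ennreal (trap_time \<beta> h T) * indicator {T. \<not> surv T} T \<partial>gw_law p)"

text \<open>Extinction of the tree is extinction of all child subtrees, so the indicator is a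
  product. In each term of the sum one child carries the trap time and the others only extinction,
  which produces \<open>\<mu>\<close> and hence the ratio \<open>\<beta> * \<mu>\<close>.\<close>

lemma mean_trap_time_Suc: "mean_trap_time (Suc h) = ennreal (q * (1 + \<beta> * \<mu>)) + ennreal (\<beta> * \<mu>) * mean_trap_time h"
proof -
  let ?\<phi> = "indicator {T. \<not> surv T} :: (nat list \<Rightarrow> nat) \<Rightarrow> ennreal"
  let ?\<psi> = "\<lambda>T. ennreal (trap_time \<beta> h T) * ?\<phi> T"
  let ?I = "\<lambda>k. indicator {T. T [] = k} :: (nat list \<Rightarrow> nat) \<Rightarrow> ennreal"
  have b0: "\<beta> > 0" using \<beta>_gt_1 by simp
  have [measurable]: "?\<phi> \<in> borel_measurable (gw_law p)" by measurable
  have [measurable]: "?\<psi> \<in> borel_measurable (gw_law p)" by measurable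
  have m1 [measurable]: "(\<lambda>T. ?\<phi> (subtree u T)) \<in> borel_measurable (gw_law p)" for u
    by (rule measurable_compose[OF measurable_subtree]) measurable
  have m2 [measurable]: "(\<lambda>T. ?\<psi> (subtree u T)) \<in> borel_measurable (gw_law p)" for u
    by (rule measurable_compose[OF measurable_subtree]) measurable
  have split: "?\<phi> T = (\<Prod>i<T []. ?\<phi> (subtree [i] T))" for T
    unfolding prod_indicator by (subst surv_iff) (auto simp: indicator_def)
  have pt: "?I k T * (ennreal (trap_time \<beta> (Suc h) T) * ?\<phi> T) =
    ennreal (1 + \<beta> * real k) * (?I k T * (\<Prod>i<k. ?\<phi> (subtree [i] T))) +
    ennreal \<beta> * (\<Sum>i<k. ?I k T * (?\<psi> (subtree [i] T) * (\<Prod>j\<in>{..<k} - {i}. ?\<phi> (subtree [j] T))))" for k T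
  proof (cases "T [] = k")
    case True
    have "ennreal (trap_time \<beta> (Suc h) T) = ennreal (1 + \<beta> * real k) + ennreal \<beta> * (\<Sum>i<k. ennreal (trap_time \<beta> h (subtree [i] T)))"
      using True b0 trap_time_nonneg[OF b0]
      by (simp add: ennreal_mult[symmetric] sum_ennreal sum_nonneg ennreal_plus[symmetric] del: ennreal_plus)
    moreover have "ennreal (trap_time \<beta> h (subtree [i] T)) * (\<Prod>j<k. ?\<phi> (subtree [j] T)) =
       ?\<psi> (subtree [i] T) * (\<Prod>j\<in>{..<k} - {i}. ?\<phi> (subtree [j] T))" if "i < k" for i
      using that by (subst prod.remove[of "{..<k}" i]) (auto simp: mult.assoc)
    then have "(\<Sum>i<k. ennreal (trap_time \<beta> h (subtree [i] T))) * (\<Prod>j<k. ?\<phi> (subtree [j] T)) =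
       (\<Sum>i<k. ?\<psi> (subtree [i] T) * (\<Prod>j\<in>{..<k} - {i}. ?\<phi> (subtree [j] T)))"
      unfolding sum_distrib_right by (intro sum.cong) auto
    ultimately show ?thesis using True split[of T] by (simp add: distrib_right mult.assoc)
  qed simp
  have each: "(\<integral>\<^sup>+T. ?I k T * (ennreal (trap_time \<beta> (Suc h) T) * ?\<phi> T) \<partial>gw_law p) =
     ennreal (pmf p k * ((1 + \<beta> * real k) * q ^ k)) + ennreal (pmf p k * (real k * q ^ (k - 1)) * \<beta>) * mean_trap_time h" for k
  proof -
    have "(\<integral>\<^sup>+T. ?I k T * (ennreal (trap_time \<beta> (Suc h) T) * ?\<phi> T) \<partial>gw_law p) =
      ennreal (1 + \<beta> * real k) * (\<integral>\<^sup>+T. ?I k T * (\<Prod>i<k. ?\<phi> (subtree [i] T)) \<partial>gw_law p) +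
      ennreal \<beta> * (\<Sum>i<k. \<integral>\<^sup>+T. ?I k T * (?\<psi> (subtree [i] T) * (\<Prod>j\<in>{..<k} - {i}. ?\<phi> (subtree [j] T))) \<partial>gw_law p)"
      unfolding pt by (rule nn_integral_affine_sum) measurable
    also have "(\<integral>\<^sup>+T. ?I k T * (\<Prod>i<k. ?\<phi> (subtree [i] T)) \<partial>gw_law p) = ennreal (pmf p k) * ennreal q ^ k"
      using nn_integral_branch_aux[of "\<lambda>_. ?\<phi>" p k k] by (simp add: q_nn del: nn_integral_indicator)
    also have "(\<Sum>i<k. \<integral>\<^sup>+T. ?I k T * (?\<psi> (subtree [i] T) * (\<Prod>j\<in>{..<k} - {i}. ?\<phi> (subtree [j] T))) \<partial>gw_law p)
      = (\<Sum>i<k. ennreal (pmf p k) * (mean_trap_time h * ennreal q ^ (k - 1)))"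
    proof (intro sum.cong refl)
      fix i assume "i \<in> {..<k}"
      then show "(\<integral>\<^sup>+T. ?I k T * (?\<psi> (subtree [i] T) * (\<Prod>j\<in>{..<k} - {i}. ?\<phi> (subtree [j] T))) \<partial>gw_law p) =
        ennreal (pmf p k) * (mean_trap_time h * ennreal q ^ (k - 1))"
        using nn_integral_branch_marked[of ?\<phi> p ?\<psi> i k] by (simp only: q_nn mean_trap_time_def lessThan_iff) simp
    qed
    also have "ennreal (1 + \<beta> * real k) * (ennreal (pmf p k) * ennreal q ^ k) = ennreal (pmf p k * ((1 + \<beta> * real k) * q ^ k))"
      using b0 q_pos by (simp add: ennreal_mult[symmetric] ennreal_power mult_ac del: ennreal_plus)
    also have "ennreal \<beta> * (\<Sum>i<k. ennreal (pmf p k) * (mean_trap_time h * ennreal q ^ (k - 1))) =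
      (ennreal \<beta> * (of_nat k * (ennreal (pmf p k) * ennreal q ^ (k - 1)))) * mean_trap_time h"
      by (simp add: mult_ac)
    also have "ennreal \<beta> * (of_nat k * (ennreal (pmf p k) * ennreal q ^ (k - 1))) = ennreal (pmf p k * (real k * q ^ (k - 1)) * \<beta>)"
      using b0 q_pos by (simp add: ennreal_mult[symmetric] ennreal_power ennreal_of_nat_eq_real_of_nat mult_ac)
    finally show ?thesis .
  qed
  have s1: "(\<lambda>k. pmf p k * ((1 + \<beta> * real k) * q ^ k)) sums (q * (1 + \<beta> * \<mu>))"
  proof -
    have "(\<lambda>k. pmf p k * q ^ k + (\<beta> * q) * (pmf p k * (real k * q ^ (k - 1)))) sums (q + (\<beta> * q) * \<mu>)"
      using q_range q_fix summable_sums[OF summable_gen[of q]]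
      by (intro sums_add sums_mult \<mu>_sums) (auto simp: gen_fun_def)
    moreover have "pmf p k * q ^ k + (\<beta> * q) * (pmf p k * (real k * q ^ (k - 1))) = pmf p k * ((1 + \<beta> * real k) * q ^ k)" for k
      by (cases k) (auto simp: algebra_simps)
    moreover have "q + (\<beta> * q) * \<mu> = q * (1 + \<beta> * \<mu>)" by (simp add: algebra_simps)
    ultimately show ?thesis by (simp only:)
  qed
  have s2: "(\<lambda>k. pmf p k * (real k * q ^ (k - 1)) * \<beta>) sums (\<mu> * \<beta>)"
    by (intro sums_mult2 \<mu>_sums)
  have "mean_trap_time (Suc h) = (\<Sum>k. \<integral>\<^sup>+T. ?I k T * (ennreal (trap_time \<beta> (Suc h) T) * ?\<phi> T) \<partial>gw_law p)"
    unfolding mean_trap_time_def by (rule nn_integral_by_offspring) measurable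
  also have "\<dots> = (\<Sum>k. ennreal (pmf p k * ((1 + \<beta> * real k) * q ^ k))) + (\<Sum>k. ennreal (pmf p k * (real k * q ^ (k - 1)) * \<beta>)) * mean_trap_time h"
    unfolding each by (simp add: suminf_add[symmetric] ennreal_suminf_multc)
  also have "(\<Sum>k. ennreal (pmf p k * ((1 + \<beta> * real k) * q ^ k))) = ennreal (q * (1 + \<beta> * \<mu>))"
    using s1 b0 q_pos by (subst suminf_ennreal2) (auto simp: sums_iff)
  also have "(\<Sum>k. ennreal (pmf p k * (real k * q ^ (k - 1)) * \<beta>)) = ennreal (\<beta> * \<mu>)"
    using s2 b0 q_pos by (subst suminf_ennreal2) (auto simp: sums_iff mult.commute)
  finally show ?thesis .
qed

lemma mean_trap_time_le: "mean_trap_time h \<le> ennreal (C3 * ((\<beta> * \<mu>) ^ h - 1))"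
proof (induction h)
  case 0
  then show ?case by (simp add: mean_trap_time_def)
next
  case (Suc h)
  have bm: "0 \<le> \<beta> * \<mu>" using \<beta>\<mu> by simp
  have p1: "1 \<le> (\<beta> * \<mu>) ^ h" using \<beta>\<mu> by (simp add: one_le_power)
  have "mean_trap_time (Suc h) \<le> ennreal (1 + \<beta> * \<mu>) + ennreal (\<beta> * \<mu>) * ennreal (C3 * ((\<beta> * \<mu>) ^ h - 1))"
    unfolding mean_trap_time_Suc using q_range bm Suc
    by (intro add_mono mult_left_mono ennreal_leI) (auto intro!: mult_left_le_one_le)
  also have "\<dots> = ennreal (1 + \<beta> * \<mu> + \<beta> * \<mu> * (C3 * ((\<beta> * \<mu>) ^ h - 1)))"
    using bm p1 C3_pos by (simp add: ennreal_mult[symmetric] ennreal_plus[symmetric] del: ennreal_plus)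
  also have "1 + \<beta> * \<mu> + \<beta> * \<mu> * (C3 * ((\<beta> * \<mu>) ^ h - 1)) = C3 * ((\<beta> * \<mu>) ^ Suc h - 1)"
  proof -
    have "C3 * (\<beta> * \<mu> - 1) = 1 + \<beta> * \<mu>" using \<beta>\<mu> by (simp add: C3_def)
    then show ?thesis by (simp add: algebra_simps)
  qed
  finally show ?case .
qed

lemma mean_offspring_nn: "(\<Sum>k. ennreal (pmf p k * real k)) = ennreal mean_offspring"
  using sums_mean by (subst suminf_ennreal2) (auto simp: sums_iff)

lemma mean_offspring_pos: "mean_offspring > 0" using mean_gt1 by simp

lemma nn_integral_deep_trap: "(\<integral>\<^sup>+T. indicator {T. deep_trap h T} T \<partial>gw_law p) \<le> ennreal (mean_offspring * trap_tail h)"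
proof -
  let ?\<psi> = "indicator {T. \<not> surv T \<and> alive h T} :: (nat list \<Rightarrow> nat) \<Rightarrow> ennreal"
  have "indicator {T. deep_trap h T} T \<le> (\<Sum>i<T []. ?\<psi> (subtree [i] T))" for T
  proof (cases "deep_trap h T")
    case True
    then obtain i where i: "i < T []" "\<not> surv (subtree [i] T)" "alive h (subtree [i] T)" by (auto simp: deep_trap_def)
    then have "1 \<le> ?\<psi> (subtree [i] T)" by simp
    also have "\<dots> \<le> (\<Sum>i<T []. ?\<psi> (subtree [i] T))"
      using i by (intro member_le_sum[where f = "\<lambda>i. ?\<psi> (subtree [i] T)"]) auto
    finally show ?thesis using True by simp
  qed simp
  then have "(\<integral>\<^sup>+T. indicator {T. deep_trap h T} T \<partial>gw_law p) \<le> (\<integral>\<^sup>+T. (\<Sum>i<T []. ?\<psi> (subtree [i] T)) \<partial>gw_law p)"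
    by (intro nn_integral_mono) auto
  also have "\<dots> = ennreal mean_offspring * (\<integral>\<^sup>+T. ?\<psi> T \<partial>gw_law p)"
    unfolding mean_offspring_nn[symmetric] by (rule nn_integral_sum_offspring) measurable
  also have "(\<integral>\<^sup>+T. ?\<psi> T \<partial>gw_law p) = ennreal (trap_tail h)"
    by (subst nn_integral_indicator) (auto intro!: sets_gw_Collect simp: emeasure_trap)
  finally show ?thesis using mean_offspring_pos trap_tail_nonneg by (simp add: ennreal_mult[symmetric])
qed

lemma nn_integral_green:
  "(\<integral>\<^sup>+T. ennreal (green \<beta> h T) \<partial>gw_law p) \<le> ennreal ((1 + \<beta> * mean_offspring + \<beta> * mean_offspring * (C3 * ((\<beta> * \<mu>) ^ h - 1))) / (\<beta> - 1))"
proof -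
  let ?\<psi> = "\<lambda>T. ennreal (trap_time \<beta> h T) * indicator {T. \<not> surv T} T"
  have b0: "\<beta> > 0" using \<beta>_gt_1 by simp
  let ?c = "1 / (\<beta> - 1)"
  have c0: "?c > 0" using \<beta>_gt_1 by simp
  have [measurable]: "(\<lambda>T. ?\<psi> (subtree u T)) \<in> borel_measurable (gw_law p)" for u
    by (rule measurable_compose[OF measurable_subtree]) measurable
  have [measurable]: "(\<lambda>T. \<Sum>i<T []. ?\<psi> (subtree [i] T)) \<in> borel_measurable (gw_law p)"
    by (rule measurable_compose_countable[where f = "\<lambda>k T. \<Sum>i<k. ?\<psi> (subtree [i] T)"]) measurable
  have [measurable]: "(\<lambda>T. \<Sum>i<T []. (1::ennreal)) \<in> borel_measurable (gw_law p)"
    by (rule measurable_compose_countable[where f = "\<lambda>k T. \<Sum>i<k. 1"]) measurable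
  have pt: "ennreal (green \<beta> h T) = ennreal ?c * (1 + ennreal \<beta> * ((\<Sum>i<T []. 1) + (\<Sum>i<T []. ?\<psi> (subtree [i] T))))" for T
  proof -
    have "(\<Sum>i<T []. ?\<psi> (subtree [i] T)) = (\<Sum>i<T []. ennreal (if surv (subtree [i] T) then 0 else trap_time \<beta> h (subtree [i] T)))"
      by (intro sum.cong) (auto simp: indicator_def)
    also have "\<dots> = ennreal (\<Sum>i<T []. if surv (subtree [i] T) then 0 else trap_time \<beta> h (subtree [i] T))"
      using trap_time_nonneg[OF b0] by (intro sum_ennreal) auto
    finally have 1: "(\<Sum>i<T []. ?\<psi> (subtree [i] T)) = ennreal (\<Sum>i<T []. if surv (subtree [i] T) then 0 else trap_time \<beta> h (subtree [i] T))" .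
    have 2: "(\<Sum>i<T []. 1 :: ennreal) = ennreal (real (T []))"
      by (simp add: ennreal_of_nat_eq_real_of_nat)
    have S: "0 \<le> (\<Sum>i<T []. if surv (subtree [i] T) then 0 else trap_time \<beta> h (subtree [i] T))"
      using trap_time_nonneg[OF b0] by (intro sum_nonneg) auto
    have "green \<beta> h T = ?c * (1 + \<beta> * (real (T []) + (\<Sum>i<T []. if surv (subtree [i] T) then 0 else trap_time \<beta> h (subtree [i] T))))"
      by (simp add: green_def algebra_simps add_divide_distrib)
    also have "ennreal \<dots> = ennreal ?c * (1 + ennreal \<beta> * (ennreal (real (T [])) +
        ennreal (\<Sum>i<T []. if surv (subtree [i] T) then 0 else trap_time \<beta> h (subtree [i] T))))"
      using S b0 c0 by (intro ennreal_affine) auto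
    finally show ?thesis unfolding 1 2 .
  qed
  have "(\<integral>\<^sup>+T. ennreal (green \<beta> h T) \<partial>gw_law p) =
    ennreal ?c * (1 + ennreal \<beta> * ((\<integral>\<^sup>+T. (\<Sum>i<T []. 1) \<partial>gw_law p) + (\<integral>\<^sup>+T. (\<Sum>i<T []. ?\<psi> (subtree [i] T)) \<partial>gw_law p)))"
    unfolding pt by (subst nn_integral_cmult, measurable, subst nn_integral_add, measurable, subst nn_integral_cmult, measurable,
      subst nn_integral_add, measurable) (simp add: G.emeasure_space_1[simplified])
  also have "(\<integral>\<^sup>+T. (\<Sum>i<T []. 1) \<partial>gw_law p) = ennreal mean_offspring"
    using nn_integral_sum_offspring[of "\<lambda>_. 1" p] G.emeasure_space_1 by (simp add: mean_offspring_nn)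
  also have "(\<integral>\<^sup>+T. (\<Sum>i<T []. ?\<psi> (subtree [i] T)) \<partial>gw_law p) = ennreal mean_offspring * mean_trap_time h"
    unfolding mean_offspring_nn[symmetric] mean_trap_time_def by (rule nn_integral_sum_offspring) measurable
  also have "ennreal ?c * (1 + ennreal \<beta> * (ennreal mean_offspring + ennreal mean_offspring * mean_trap_time h)) \<le>
    ennreal ?c * (1 + ennreal \<beta> * (ennreal mean_offspring + ennreal mean_offspring * ennreal (C3 * ((\<beta> * \<mu>) ^ h - 1))))"
    using mean_trap_time_le by (intro mult_left_mono add_left_mono) auto
  also have "\<dots> = ennreal ((1 + \<beta> * mean_offspring + \<beta> * mean_offspring * (C3 * ((\<beta> * \<mu>) ^ h - 1))) / (\<beta> - 1))"
  proof -
    have "1 \<le> (\<beta> * \<mu>) ^ h" using \<beta>\<mu> by (simp add: one_le_power)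
    then have Z: "0 \<le> C3 * ((\<beta> * \<mu>) ^ h - 1)" using C3_pos by simp
    have "ennreal ?c * (1 + ennreal \<beta> * (ennreal mean_offspring + ennreal mean_offspring * ennreal Z)) =
      ennreal ((1 + \<beta> * mean_offspring + \<beta> * mean_offspring * Z) / (\<beta> - 1))" if "0 \<le> Z" for Z
    proof -
      have "ennreal (?c * (1 + \<beta> * (mean_offspring + mean_offspring * Z))) = ennreal ?c * (1 + ennreal \<beta> * (ennreal mean_offspring + ennreal mean_offspring * ennreal Z))"
        using that b0 c0 mean_offspring_pos by (subst ennreal_affine) (auto simp: ennreal_mult)
      moreover have "?c * (1 + \<beta> * (mean_offspring + mean_offspring * Z)) = (1 + \<beta> * mean_offspring + \<beta> * mean_offspring * Z) / (\<beta> - 1)"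
        by (simp add: algebra_simps add_divide_distrib)
      ultimately show ?thesis by (simp only:)
    qed
    from this[OF Z] show ?thesis .
  qed
  finally show ?thesis .
qed

text \<open>The first summand pays for a deep trap, the second for the mean of \<open>green\<close>;
  its leading factor \<open>\<beta>\<close> comes from rounding the height up to an integer.\<close>

definition C4 :: real where "C4 = mean_offspring + \<beta> * (1 + \<beta> * mean_offspring + \<beta> * mean_offspring * C3) / (\<beta> - 1)"

lemma ex_height:
  assumes "x \<ge> 1"
  shows "\<exists>h::nat. x \<le> \<beta> ^ h \<and> \<beta> ^ h \<le> \<beta> * x"
proof -
  define h where "h = nat \<lceil>log \<beta> x\<rceil>"
  have b: "\<beta> > 1" "\<beta> > 0" using \<beta>_gt_1 by auto
  have l0: "0 \<le> log \<beta> x" using assms b by simp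
  have h: "log \<beta> x \<le> real h" "real h \<le> log \<beta> x + 1" unfolding h_def using l0 by linarith+
  have "x = \<beta> powr (log \<beta> x)" using assms b by simp
  also have "\<dots> \<le> \<beta> powr real h" using b h by (intro powr_mono) auto
  finally have 1: "x \<le> \<beta> ^ h" using b by (simp add: powr_realpow)
  have "\<beta> ^ h = \<beta> powr real h" using b by (simp add: powr_realpow)
  also have "\<dots> \<le> \<beta> powr (log \<beta> x + 1)" using b h by (intro powr_mono) auto
  also have "\<dots> = \<beta> * x" using assms b by (simp add: powr_add)
  finally show ?thesis using 1 by blast
qed

lemma \<mu>_power: "\<mu> ^ h = (\<beta> ^ h) powr (- \<gamma>)"
proof -
  have "\<mu> ^ h = \<mu> powr real h" using \<mu>_pos by (simp add: powr_realpow)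
  also have "\<dots> = (\<beta> powr real h) powr (- \<gamma>)" by (subst \<mu>_eq_powr) (simp add: powr_powr mult.commute)
  also have "\<beta> powr real h = \<beta> ^ h" using \<beta>_gt_1 by (simp add: powr_realpow)
  finally show ?thesis .
qed

text \<open>With \<open>\<beta> ^ h\<close> between \<open>t + 1\<close> and
  \<open>\<beta> * (t + 1)\<close>, both the probability of a deep trap and the mean of
  \<open>green\<close> divided by \<open>t + 1\<close> have order \<open>\<mu> ^ h\<close>, which is
  of order \<open>(t + 1) powr (- \<gamma>)\<close>.\<close>

lemma nn_integral_cluster_cost:
  "\<exists>h. (\<integral>\<^sup>+T. ennreal (cluster_cost \<beta> h t T) * indicator {T. surv T} T \<partial>gw_law p) \<le> ennreal (C4 * real (Suc t) powr (- \<gamma>))"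
proof -
  define x where "x = real (Suc t)"
  have x1: "x \<ge> 1" by (simp add: x_def)
  obtain h where h: "x \<le> \<beta> ^ h" "\<beta> ^ h \<le> \<beta> * x" using ex_height[OF x1] by blast
  have b: "\<beta> > 1" by (rule \<beta>_gt_1)
  have \<mu>h: "\<mu> ^ h \<le> x powr (- \<gamma>)"
    unfolding \<mu>_power using h x1 \<gamma>_range by (intro powr_mono2') auto
  have 1: "1 \<le> (\<beta> * \<mu>) ^ h" using \<beta>\<mu> by (simp add: one_le_power)
  have "(\<beta> * \<mu>) ^ h = \<beta> ^ h * \<mu> ^ h" by (rule power_mult_distrib)
  also have "\<dots> \<le> (\<beta> * x) * x powr (- \<gamma>)"
    using h \<mu>h b x1 \<mu>_pos by (intro mult_mono) auto
  finally have 2: "(\<beta> * \<mu>) ^ h / x \<le> \<beta> * x powr (- \<gamma>)"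
    using x1 by (simp add: pos_divide_le_eq mult_ac)
  let ?g = "(1 + \<beta> * mean_offspring + \<beta> * mean_offspring * (C3 * ((\<beta> * \<mu>) ^ h - 1))) / (\<beta> - 1)"
  have g0: "0 \<le> ?g" using b mean_offspring_pos C3_pos 1 by (intro divide_nonneg_nonneg add_nonneg_nonneg mult_nonneg_nonneg) auto
  have "ennreal (cluster_cost \<beta> h t T) * indicator {T. surv T} T \<le> indicator {T. deep_trap h T} T + ennreal (1 / x) * ennreal (green \<beta> h T)" for T
    using green_nonneg[OF b, of h T] x1
    by (auto simp: cluster_cost_def indicator_def x_def[symmetric] ennreal_mult[symmetric] simp del: of_nat_Suc)
  then have "(\<integral>\<^sup>+T. ennreal (cluster_cost \<beta> h t T) * indicator {T. surv T} T \<partial>gw_law p) \<le>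
    (\<integral>\<^sup>+T. indicator {T. deep_trap h T} T + ennreal (1 / x) * ennreal (green \<beta> h T) \<partial>gw_law p)"
    by (intro nn_integral_mono) auto
  also have "\<dots> = (\<integral>\<^sup>+T. indicator {T. deep_trap h T} T \<partial>gw_law p) + ennreal (1 / x) * (\<integral>\<^sup>+T. ennreal (green \<beta> h T) \<partial>gw_law p)"
    by (simp add: nn_integral_add nn_integral_cmult)
  also have "\<dots> \<le> ennreal (mean_offspring * trap_tail h) + ennreal (1 / x) * ennreal ?g"
    by (intro add_mono mult_left_mono nn_integral_deep_trap nn_integral_green) auto
  also have "\<dots> = ennreal (mean_offspring * trap_tail h + ?g / x)"
    using x1 g0 mean_offspring_pos trap_tail_nonneg by (intro ennreal_add_divide) auto
  also have "\<dots> \<le> ennreal (C4 * x powr (- \<gamma>))"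
  proof (rule ennreal_leI)
    have "mean_offspring * trap_tail h \<le> mean_offspring * x powr (- \<gamma>)"
      using trap_tail_le[of h] \<mu>h mean_offspring_pos by (intro mult_left_mono) auto
    moreover have "?g / x \<le> \<beta> * (1 + \<beta> * mean_offspring + \<beta> * mean_offspring * C3) / (\<beta> - 1) * x powr (- \<gamma>)"
    proof -
      have "(1 + \<beta> * mean_offspring) * 1 \<le> (1 + \<beta> * mean_offspring) * (\<beta> * \<mu>) ^ h" using 1 b mean_offspring_pos by (intro mult_left_mono) auto
      moreover have "\<beta> * mean_offspring * (C3 * ((\<beta> * \<mu>) ^ h - 1)) \<le> \<beta> * mean_offspring * (C3 * (\<beta> * \<mu>) ^ h)"
        using b mean_offspring_pos C3_pos by (intro mult_left_mono) auto
      ultimately have "1 + \<beta> * mean_offspring + \<beta> * mean_offspring * (C3 * ((\<beta> * \<mu>) ^ h - 1)) \<le> (1 + \<beta> * mean_offspring + \<beta> * mean_offspring * C3) * (\<beta> * \<mu>) ^ h"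
        by (simp add: algebra_simps)
      then have "?g \<le> (1 + \<beta> * mean_offspring + \<beta> * mean_offspring * C3) * (\<beta> * \<mu>) ^ h / (\<beta> - 1)"
        using b by (intro divide_right_mono) auto
      then have "?g / x \<le> (1 + \<beta> * mean_offspring + \<beta> * mean_offspring * C3) * (\<beta> * \<mu>) ^ h / (\<beta> - 1) / x"
        by (rule divide_right_mono) (use x1 in simp)
      also have "\<dots> = (1 + \<beta> * mean_offspring + \<beta> * mean_offspring * C3) / (\<beta> - 1) * ((\<beta> * \<mu>) ^ h / x)" by simp
      also have "\<dots> \<le> (1 + \<beta> * mean_offspring + \<beta> * mean_offspring * C3) / (\<beta> - 1) * (\<beta> * x powr (- \<gamma>))"
        using 2 b mean_offspring_pos C3_pos by (intro mult_left_mono divide_nonneg_nonneg add_nonneg_nonneg mult_nonneg_nonneg) auto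
      finally show ?thesis by (simp add: mult_ac)
    qed
    ultimately show "mean_offspring * trap_tail h + ?g / x \<le> C4 * x powr (- \<gamma>)"
      by (simp add: C4_def distrib_right)
  qed
  finally show ?thesis unfolding x_def by blast
qed

text \<open>A loss of at least \<open>d\<close> occurs when the root has \<open>k0\<close> children,
  child 0 is a trap reaching height \<open>h\<close> and child 1 survives. By independence this has
  probability \<open>pmf p k0 * trap_tail h * (1 - q)\<close>; everywhere else the level factor is
  bounded by one.\<close>

lemma nn_integral_level_factor:
  "\<exists>c>0. \<forall>n h. n \<ge> 1 \<longrightarrow> real n \<le> \<beta> ^ h \<longrightarrow>
     (\<integral>\<^sup>+T. ennreal (level_factor \<beta> (real n / (real n + 1)) (Suc h) T) * indicator {T. surv T} T \<partial>gw_law p)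
       \<le> ennreal ((1 - q) * (1 - c * \<mu> ^ h))"
proof -
  obtain c1 where c1: "c1 > 0" "\<And>h. c1 * \<mu> ^ h \<le> trap_tail h" using trap_tail_ge by blast
  obtain k0 where k0: "k0 \<ge> 2" "pmf p k0 > 0" using ex_big_offspring by blast
  have b: "\<beta> > 1" by (rule \<beta>_gt_1)
  \<comment> \<open>The weight of one child among \<open>k0\<close>, times the least loss in a trap
    of sufficient height.\<close>
  define d where "d = \<beta> / (1 + \<beta> * real k0) * ((\<beta> - 1) / (2 * \<beta> - 1))"
  have pos: "1 + \<beta> * real k0 > 0" using b by (simp add: add_pos_nonneg)
  have d0: "d > 0" unfolding d_def using b pos by (intro mult_pos_pos divide_pos_pos) auto
  define c where "c = d * pmf p k0 * c1"
  have c0: "c > 0" using d0 k0 c1 by (simp add: c_def)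
  have main: "(\<integral>\<^sup>+T. ennreal (level_factor \<beta> s (Suc h) T) * indicator {T. surv T} T \<partial>gw_law p)
       \<le> ennreal ((1 - q) * (1 - c * \<mu> ^ h))"
    if n: "n \<ge> 1" and h: "real n \<le> \<beta> ^ h" and s: "s = real n / (real n + 1)" for n :: nat and h s
  proof -
    have s01: "0 < s" "s \<le> 1" using n s by auto
    let ?I = "indicator {T. T [] = k0} :: (nat list \<Rightarrow> nat) \<Rightarrow> ennreal"
    let ?\<phi> = "\<lambda>i::nat. if i = 0 then indicator {T. \<not> surv T \<and> alive h T} else indicator {T. surv T} :: (nat list \<Rightarrow> nat) \<Rightarrow> ennreal"
    let ?\<eta> = "\<lambda>T. ?I T * (\<Prod>i<2. ?\<phi> i (subtree [i] T))"
    have \<phi>m [measurable]: "?\<phi> i \<in> borel_measurable (gw_law p)" for i by (cases "i = 0") auto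
    have [measurable]: "(\<lambda>T. ?\<phi> i (subtree u T)) \<in> borel_measurable (gw_law p)" for i u
      by (rule measurable_compose[OF measurable_subtree \<phi>m])
    have pt: "ennreal (level_factor \<beta> s (Suc h) T) * indicator {T. surv T} T + ennreal d * ?\<eta> T \<le> indicator {T. surv T} T" for T
    proof (cases "T [] = k0 \<and> \<not> surv (subtree [0] T) \<and> alive h (subtree [0] T) \<and> surv (subtree [1] T)")
      case True
      then have sv: "surv T" using k0 by (subst surv_iff) (auto intro!: exI[of _ "Suc 0"])
      have \<eta>1: "?\<eta> T = 1" using True by (simp add: numeral_2_eq_2)
      let ?r = "\<lambda>i. if surv (subtree [i] T) then 0 else 1 - trap_exit \<beta> s (Suc h) (subtree [i] T)"
      have r0: "0 \<le> ?r i" for i using trap_exit_bounds(1)[OF b s01, of "Suc h" "subtree [i] T"] by simp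
      have "(\<beta> - 1) / (2 * \<beta> - 1) \<le> ?r 0"
        using True one_minus_trap_exit_ge[OF b n s h, of "subtree [0] T"] by simp
      also have "\<dots> \<le> (\<Sum>i<T []. ?r i)"
        using True k0 r0 by (intro member_le_sum) auto
      finally have "d \<le> \<beta> / (1 + \<beta> * real k0) * (\<Sum>i<T []. ?r i)"
        unfolding d_def using b pos by (intro mult_left_mono) auto
      then have "level_factor \<beta> s (Suc h) T + d \<le> 1" using True by (simp add: level_factor_def)
      moreover have "0 \<le> level_factor \<beta> s (Suc h) T" by (rule level_factor_bounds[OF b s01])
      ultimately show ?thesis using sv \<eta>1 d0
        by (simp add: ennreal_plus[symmetric] del: ennreal_plus)
    next
      case False
      then have \<eta>0: "?\<eta> T = 0" by (auto simp: numeral_2_eq_2 indicator_def)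
      have "level_factor \<beta> s (Suc h) T \<le> 1" by (rule level_factor_bounds[OF b s01])
      then have "ennreal (level_factor \<beta> s (Suc h) T) \<le> 1" by simp
      then show ?thesis unfolding \<eta>0 by (simp add: indicator_def)
    qed
    have \<eta>m [measurable]: "?\<eta> \<in> borel_measurable (gw_law p)" by measurable
    have "(\<integral>\<^sup>+T. ?\<eta> T \<partial>gw_law p) = ennreal (pmf p k0) * (\<Prod>i<2. \<integral>\<^sup>+T. ?\<phi> i T \<partial>gw_law p)"
      by (rule nn_integral_branch_aux[OF \<phi>m])
    also have "(\<Prod>i<2. \<integral>\<^sup>+T. ?\<phi> i T \<partial>gw_law p) = ennreal (trap_tail h) * ennreal (1 - q)"
      by (simp add: numeral_2_eq_2 emeasure_trap emeasure_surv sets_gw_Collect)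
    finally have \<eta>: "(\<integral>\<^sup>+T. ?\<eta> T \<partial>gw_law p) = ennreal (pmf p k0 * (trap_tail h * (1 - q)))"
      using trap_tail_nonneg q_less_1 by (simp add: ennreal_mult)
    have "(\<integral>\<^sup>+T. ennreal (level_factor \<beta> s (Suc h) T) * indicator {T. surv T} T \<partial>gw_law p) + ennreal (d * (pmf p k0 * (trap_tail h * (1 - q)))) =
      (\<integral>\<^sup>+T. ennreal (level_factor \<beta> s (Suc h) T) * indicator {T. surv T} T \<partial>gw_law p) + (\<integral>\<^sup>+T. ennreal d * ?\<eta> T \<partial>gw_law p)"
      using \<eta> d0 trap_tail_nonneg q_less_1 by (subst nn_integral_cmult[OF \<eta>m]) (simp add: ennreal_mult)
    also have "\<dots> = (\<integral>\<^sup>+T. ennreal (level_factor \<beta> s (Suc h) T) * indicator {T. surv T} T + ennreal d * ?\<eta> T \<partial>gw_law p)"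
      by (rule nn_integral_add[symmetric]) measurable
    also have "\<dots> \<le> (\<integral>\<^sup>+T. indicator {T. surv T} T \<partial>gw_law p)"
      using pt by (rule nn_integral_mono)
    also have "\<dots> = ennreal (1 - q)"
      by (subst nn_integral_indicator) (auto intro!: sets_gw_Collect simp: emeasure_surv)
    finally have "(\<integral>\<^sup>+T. ennreal (level_factor \<beta> s (Suc h) T) * indicator {T. surv T} T \<partial>gw_law p)
      + ennreal (d * (pmf p k0 * (trap_tail h * (1 - q)))) \<le> ennreal (1 - q)" .
    then have "(\<integral>\<^sup>+T. ennreal (level_factor \<beta> s (Suc h) T) * indicator {T. surv T} T \<partial>gw_law p)
      \<le> ennreal (1 - q - d * (pmf p k0 * (trap_tail h * (1 - q))))"
      by (rule ennreal_add_le_diff) (use d0 trap_tail_nonneg q_less_1 in auto)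
    also have "\<dots> \<le> ennreal ((1 - q) * (1 - c * \<mu> ^ h))"
    proof (rule ennreal_leI)
      have "(1 - q) * (d * pmf p k0) * (c1 * \<mu> ^ h) \<le> (1 - q) * (d * pmf p k0) * trap_tail h"
        using c1 d0 q_less_1 by (intro mult_left_mono) auto
      then show "1 - q - d * (pmf p k0 * (trap_tail h * (1 - q))) \<le> (1 - q) * (1 - c * \<mu> ^ h)"
        by (simp add: c_def algebra_simps)
    qed
    finally show ?thesis .
  qed
  then show ?thesis using c0 by blast
qed

end

section \<open>Averaged estimates\<close>

text \<open>Bernoulli's inequality for \<open>1 / x\<close>. Polynomial decay suffices later, since
  \<open>m\<close> will be of the order of a power of the time.\<close>

lemma power_le_inverse_linear:
  fixes x :: real
  assumes "0 < x" "x < 1" "m \<ge> 1"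
  shows "x ^ m \<le> 1 / (real m * (1 / x - 1))"
proof -
  have y: "1 / x - 1 > 0" using assms by (simp add: field_simps)
  have "real m * (1 / x - 1) \<le> 1 + real m * (1 / x - 1)" by simp
  also have "\<dots> \<le> (1 + (1 / x - 1)) ^ m" using assms y by (intro Bernoulli_inequality) auto
  also have "\<dots> = 1 / x ^ m" by (simp add: power_one_over)
  finally have "real m * (1 / x - 1) \<le> 1 / x ^ m" .
  moreover have "0 < real m * (1 / x - 1)" using y assms by simp
  moreover have "0 < x ^ m" using assms by simp
  moreover have "b \<le> 1 / a" if "a \<le> 1 / b" "0 < a" "0 < b" for a b :: real
    using that by (simp add: field_simps)
  ultimately show ?thesis by blast
qed

text \<open>The linear bound for \<open>sqrt x\<close>, squared, absorbs the extra factor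
  \<open>m\<close>.\<close>

lemma power_le_inverse_square:
  fixes x :: real
  assumes "0 < x" "x < 1" "m \<ge> 1"
  shows "real m * x ^ m \<le> 1 / (1 / sqrt x - 1)\<^sup>2 / real m"
proof -
  have s: "0 < sqrt x" "sqrt x < 1" using assms by auto
  have y: "1 / sqrt x - 1 > 0" using s by (simp add: field_simps)
  have "(sqrt x ^ m)\<^sup>2 = ((sqrt x)\<^sup>2) ^ m" by (simp only: power_mult[symmetric] mult.commute)
  then have "x ^ m = (sqrt x ^ m)\<^sup>2" using assms by simp
  also have "\<dots> \<le> (1 / (real m * (1 / sqrt x - 1)))\<^sup>2"
    using power_le_inverse_linear[OF s assms(3)] s by (intro power_mono) auto
  finally have "real m * x ^ m \<le> real m * (1 / (real m * (1 / sqrt x - 1)))\<^sup>2"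
    by (intro mult_left_mono) auto
  also have "\<dots> = 1 / (1 / sqrt x - 1)\<^sup>2 / real m"
  proof -
    have "real m * (1 / (real m * y))\<^sup>2 = 1 / y\<^sup>2 / real m" for y
      using assms(3) by (simp add: power2_eq_square)
    then show ?thesis .
  qed
  finally show ?thesis .
qed

text \<open>Multiply by \<open>(1 + \<rho>) ^ m\<close>, which is at least
  \<open>1 + m * \<rho>\<close>; the product is a power of
  \<open>1 - \<rho>\<^sup>2\<close>.\<close>

lemma one_minus_power_le:
  fixes \<rho> :: real
  assumes "0 < \<rho>" "\<rho> \<le> 1" "m \<ge> 1"
  shows "(1 - \<rho>) ^ m \<le> 1 / (real m * \<rho>)"
proof -
  have "(1 - \<rho>) ^ m * (1 + real m * \<rho>) \<le> (1 - \<rho>) ^ m * (1 + \<rho>) ^ m"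
    using assms by (intro mult_left_mono Bernoulli_inequality) auto
  also have "\<dots> = (1 - \<rho>\<^sup>2) ^ m" by (simp add: power_mult_distrib[symmetric] algebra_simps power2_eq_square)
  also have "\<dots> \<le> 1" using assms by (intro power_le_one) (auto simp: power_le_one)
  finally have 1: "(1 - \<rho>) ^ m * (1 + real m * \<rho>) \<le> 1" .
  have "(1 - \<rho>) ^ m * (real m * \<rho>) \<le> (1 - \<rho>) ^ m * (1 + real m * \<rho>)"
    using assms by (intro mult_left_mono) auto
  with 1 have "(1 - \<rho>) ^ m * (real m * \<rho>) \<le> 1" by linarith
  moreover have "0 < real m * \<rho>" using assms by simp
  ultimately show ?thesis by (simp add: pos_le_divide_eq)
qed

lemma backbone_level_not_surv: "\<not> surv T \<Longrightarrow> backbone_level T l = {}"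
  using backbone_take[of _ T 0] by (auto simp: backbone_level_def level_def)

context biased_gw
begin

section \<open>From quenched to averaged bounds\<close>

lemma gw_law_surv_eq: "gw_law_surv p = uniform_measure (gw_law p) {T. surv T}"
  by (simp add: gw_law_surv_def surv_iff_infinite)

lemma prob_space_gw_surv: "prob_space (gw_law_surv p)"
  unfolding gw_law_surv_eq using emeasure_surv q_less_1
  by (intro prob_space_uniform_measure) auto

sublocale A: prob_space "annealed p"
proof -
  interpret N: prob_space noise_law by (rule prob_space_noise)
  interpret S: prob_space "gw_law_surv p" by (rule prob_space_gw_surv)
  interpret pair_prob_space "gw_law_surv p" noise_law ..
  show "prob_space (annealed p)" unfolding annealed_def by unfold_locales
qed

lemma space_annealed [simp]: "space (annealed p) = UNIV"
  by (simp add: annealed_def space_pair_measure gw_law_surv_def)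

text \<open>Fubini, with the conditioning on survival written as division by \<open>1 - q\<close>.
  This is why the bounds under the unconditioned law are carried in the form
  \<open>(1 - q) * c\<close>.\<close>

lemma annealed_prob_le:
  assumes E [measurable]: "Measurable.pred (annealed p) (\<lambda>\<omega>. E (fst \<omega>) (snd \<omega>))"
    and le: "\<And>T. surv T \<Longrightarrow> (\<integral>\<^sup>+U. (if E T U then 1 else 0) \<partial>noise_law) \<le> b T"
    and B: "(\<integral>\<^sup>+T. b T * indicator {T. surv T} T \<partial>gw_law p) \<le> ennreal ((1 - q) * c)" and c: "0 \<le> c"
  shows "measure (annealed p) {\<omega>. E (fst \<omega>) (snd \<omega>)} \<le> c"
proof -
  interpret N: prob_space noise_law by (rule prob_space_noise)
  have S: "{T. surv T} \<in> sets (gw_law p)" by (rule sets_gw_Collect) measurable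
  let ?f = "\<lambda>\<omega>. if E (fst \<omega>) (snd \<omega>) then 1 else 0 :: ennreal"
  have sets: "{\<omega>. E (fst \<omega>) (snd \<omega>)} \<in> sets (annealed p)" using E by (simp add: pred_def)
  have f: "?f \<in> borel_measurable (gw_law_surv p \<Otimes>\<^sub>M noise_law)"
    unfolding annealed_def[symmetric] by measurable
  have f': "?f \<in> borel_measurable (gw_law p \<Otimes>\<^sub>M noise_law)"
    using f by (simp add: gw_law_surv_eq cong: measurable_cong_sets sets_pair_measure_cong)
  have g: "(\<lambda>T. \<integral>\<^sup>+U. ?f (T, U) \<partial>noise_law) \<in> borel_measurable (gw_law p)"
    using N.borel_measurable_nn_integral_fst[OF f'] by simp
  have "emeasure (annealed p) {\<omega>. E (fst \<omega>) (snd \<omega>)} = (\<integral>\<^sup>+\<omega>. indicator {\<omega>. E (fst \<omega>) (snd \<omega>)} \<omega> \<partial>annealed p)"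
    using sets by simp
  also have "\<dots> = (\<integral>\<^sup>+\<omega>. ?f \<omega> \<partial>annealed p)"
    by (intro nn_integral_cong) (auto simp: indicator_def)
  also have "\<dots> = (\<integral>\<^sup>+T. \<integral>\<^sup>+U. ?f (T, U) \<partial>noise_law \<partial>gw_law_surv p)"
    unfolding annealed_def by (rule N.nn_integral_fst[OF f, symmetric])
  also have "\<dots> = (\<integral>\<^sup>+T. (\<integral>\<^sup>+U. ?f (T, U) \<partial>noise_law) * indicator {T. surv T} T \<partial>gw_law p) / emeasure (gw_law p) {T. surv T}"
    unfolding gw_law_surv_eq by (rule nn_integral_uniform_measure[OF g S])
  also have "\<dots> \<le> ennreal ((1 - q) * c) / ennreal (1 - q)"
    unfolding emeasure_surv
  proof (rule divide_right_mono_ennreal)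
    have "(\<integral>\<^sup>+T. (\<integral>\<^sup>+U. ?f (T, U) \<partial>noise_law) * indicator {T. surv T} T \<partial>gw_law p) \<le>
      (\<integral>\<^sup>+T. b T * indicator {T. surv T} T \<partial>gw_law p)"
      using le by (intro nn_integral_mono) (auto simp: indicator_def)
    with B show "(\<integral>\<^sup>+T. (\<integral>\<^sup>+U. ?f (T, U) \<partial>noise_law) * indicator {T. surv T} T \<partial>gw_law p) \<le> ennreal ((1 - q) * c)"
      by simp
  qed
  also have "\<dots> = ennreal c" using q_less_1 c by (simp add: divide_ennreal)
  finally show ?thesis using c by (simp add: A.emeasure_eq_measure)
qed

lemma nn_integral_hits_level:
  "(\<integral>\<^sup>+T. (\<Sum>u\<in>backbone_level T l. ennreal (hit_prob \<beta> 1 T {u} {} n [])) \<partial>gw_law p) \<le> ennreal (\<beta> / (\<beta> - 1) * (1 - q))"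
proof -
  have b: "\<beta> > 1" by (rule \<beta>_gt_1)
  have S: "{T. surv T} \<in> sets (gw_law p)" by (rule sets_gw_Collect) measurable
  have "(\<Sum>u\<in>backbone_level T l. ennreal (hit_prob \<beta> 1 T {u} {} n [])) \<le> ennreal (\<beta> / (\<beta> - 1)) * indicator {T. surv T} T" for T
  proof (cases "surv T")
    case True
    have "(\<Sum>u\<in>backbone_level T l. ennreal (hit_prob \<beta> 1 T {u} {} n [])) = ennreal (\<Sum>u\<in>backbone_level T l. hit_prob \<beta> 1 T {u} {} n [])"
      using b by (intro sum_ennreal hit_prob_nonneg) auto
    also have "\<dots> \<le> ennreal (\<beta> / (\<beta> - 1))" by (intro ennreal_leI sum_hit_prob_backbone_level_le b True)
    finally show ?thesis using True by simp
  qed (simp add: backbone_level_not_surv)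
  then have "(\<integral>\<^sup>+T. (\<Sum>u\<in>backbone_level T l. ennreal (hit_prob \<beta> 1 T {u} {} n [])) \<partial>gw_law p) \<le>
    (\<integral>\<^sup>+T. ennreal (\<beta> / (\<beta> - 1)) * indicator {T. surv T} T \<partial>gw_law p)"
    by (rule nn_integral_mono)
  also have "\<dots> = ennreal (\<beta> / (\<beta> - 1)) * ennreal (1 - q)"
    using S by (subst nn_integral_cmult_indicator) (auto simp: emeasure_surv)
  also have "\<dots> = ennreal (\<beta> / (\<beta> - 1) * (1 - q))" using b q_less_1 by (intro ennreal_mult[symmetric]) auto
  finally show ?thesis .
qed

text \<open>The index set is random, so the sum is rewritten as an integral over the counting
  measure on the countable set of all vertices.\<close>

lemma measurable_sum_backbone_level:
  fixes f :: "nat list \<Rightarrow> (nat list \<Rightarrow> nat) \<Rightarrow> ennreal"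
  assumes [measurable]: "\<And>u. f u \<in> borel_measurable (gw_law p)"
  shows "(\<lambda>T. \<Sum>u\<in>backbone_level T l. f u T) \<in> borel_measurable (gw_law p)"
proof -
  have eq: "(\<Sum>u\<in>backbone_level T l. f u T) = (\<integral>\<^sup>+u. f u T * indicator {T. u \<in> backbone_level T l} T \<partial>count_space UNIV)" for T
  proof -
    have "(\<integral>\<^sup>+u. f u T * indicator {T. u \<in> backbone_level T l} T \<partial>count_space UNIV) = (\<Sum>u\<in>backbone_level T l. f u T * indicator {T. u \<in> backbone_level T l} T)"
      by (rule nn_integral_count_space'[OF finite_backbone_level]) (auto simp: indicator_def)
    also have "\<dots> = (\<Sum>u\<in>backbone_level T l. f u T)" by (intro sum.cong) auto
    finally show ?thesis ..
  qed
  have [measurable]: "Measurable.pred (gw_law p) (\<lambda>T. u \<in> backbone_level T l)" for u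
    unfolding backbone_level_def level_def mem_Collect_eq by measurable
  interpret C: sigma_finite_measure "count_space (UNIV :: nat list set)"
    by (rule sigma_finite_measure_count_space)
  have "(\<lambda>(u, T). f u T * indicator {T. u \<in> backbone_level T l} T) \<in> borel_measurable (count_space UNIV \<Otimes>\<^sub>M gw_law p)"
    by (rule measurable_pair_measure_countable1) (auto intro!: borel_measurable_times_ennreal)
  from measurable_compose[OF measurable_pair_swap' this]
  have "(\<lambda>(T, u). f u T * indicator {T. u \<in> backbone_level T l} T) \<in> borel_measurable (gw_law p \<Otimes>\<^sub>M count_space UNIV)"
    by (simp add: case_prod_beta')
  then show ?thesis unfolding eq by (rule C.borel_measurable_nn_integral)
qed

text \<open>The survival probability on the left of the cross identity cancels the
  \<open>1 - q\<close> in the mean number of hits, so the constant per level stays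
  \<open>\<beta> / (\<beta> - 1)\<close>.\<close>

lemma nn_integral_level_le:
  assumes F[measurable]: "F \<in> borel_measurable (gw_law p)"
    and B: "(\<integral>\<^sup>+T. F T * indicator {T. surv T} T \<partial>gw_law p) \<le> ennreal B" and B0: "0 \<le> B"
  shows "(\<integral>\<^sup>+T. (\<Sum>u\<in>backbone_level T l. ennreal (hit_prob \<beta> 1 T {u} {} n []) * F (subtree u T)) \<partial>gw_law p) \<le> ennreal (\<beta> / (\<beta> - 1) * B)"
proof -
  have b: "\<beta> > 1" by (rule \<beta>_gt_1)
  let ?L = "\<integral>\<^sup>+T. (\<Sum>u\<in>backbone_level T l. ennreal (hit_prob \<beta> 1 T {u} {} n []) * F (subtree u T)) \<partial>gw_law p"
  have "?L * ennreal (1 - q) = ?L * emeasure (gw_law p) {T. surv T}" by (simp add: emeasure_surv)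
  also have "\<dots> = (\<integral>\<^sup>+T. (\<Sum>u\<in>backbone_level T l. ennreal (hit_prob \<beta> 1 T {u} {} n [])) \<partial>gw_law p) * (\<integral>\<^sup>+T. F T * indicator {T. surv T} T \<partial>gw_law p)"
  proof (rule nn_integral_sum_level_cross)
    show "ennreal (hit_prob \<beta> 1 T {u} {} n []) = ennreal (hit_prob \<beta> 1 T' {u} {} n [])" if "agree_off u T T'" for u T T'
      using hit_prob_agree_off[OF that, of "[]"] by simp
  qed measurable
  also have "\<dots> \<le> ennreal (\<beta> / (\<beta> - 1) * (1 - q)) * ennreal B"
    by (intro mult_mono nn_integral_hits_level B) auto
  also have "\<dots> = ennreal (\<beta> / (\<beta> - 1) * (1 - q) * B)" using b B0 q_less_1 by (intro ennreal_mult[symmetric]) auto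
  finally have "?L \<le> ennreal (\<beta> / (\<beta> - 1) * (1 - q) * B / (1 - q))"
    by (rule ennreal_le_divideI) (use q_less_1 in simp)
  then show ?thesis using q_less_1 by simp
qed

lemma nn_integral_levels_le:
  assumes F[measurable]: "F \<in> borel_measurable (gw_law p)"
    and B: "(\<integral>\<^sup>+T. F T * indicator {T. surv T} T \<partial>gw_law p) \<le> ennreal B" and B0: "0 \<le> B"
  shows "(\<integral>\<^sup>+T. (\<Sum>l<m. \<Sum>u\<in>backbone_level T l. ennreal (hit_prob \<beta> 1 T {u} {} n []) * F (subtree u T)) * indicator {T. surv T} T \<partial>gw_law p)
    \<le> ennreal (real m * (\<beta> / (\<beta> - 1) * B))"
proof -
  have b: "\<beta> > 1" by (rule \<beta>_gt_1)
  have Fs: "(\<lambda>T. F (subtree u T)) \<in> borel_measurable (gw_law p)" for u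
    by (rule measurable_compose[OF measurable_subtree F])
  have "(\<integral>\<^sup>+T. (\<Sum>l<m. \<Sum>u\<in>backbone_level T l. ennreal (hit_prob \<beta> 1 T {u} {} n []) * F (subtree u T)) * indicator {T. surv T} T \<partial>gw_law p)
    \<le> (\<integral>\<^sup>+T. (\<Sum>l<m. \<Sum>u\<in>backbone_level T l. ennreal (hit_prob \<beta> 1 T {u} {} n []) * F (subtree u T)) \<partial>gw_law p)"
    by (intro nn_integral_mono) (auto simp: indicator_def)
  also have "\<dots> = (\<Sum>l<m. \<integral>\<^sup>+T. (\<Sum>u\<in>backbone_level T l. ennreal (hit_prob \<beta> 1 T {u} {} n []) * F (subtree u T)) \<partial>gw_law p)"
    using Fs by (intro nn_integral_sum measurable_sum_backbone_level) measurable
  also have "\<dots> \<le> (\<Sum>l<m. ennreal (\<beta> / (\<beta> - 1) * B))"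
    by (intro sum_mono nn_integral_level_le assms)
  also have "\<dots> = ennreal (real m * (\<beta> / (\<beta> - 1) * B))"
  proof -
    have "(\<Sum>l<m. ennreal z) = ennreal (real m * z)" if "0 \<le> z" for z
      using that by (simp add: ennreal_mult ennreal_of_nat_eq_real_of_nat)
    then show ?thesis using b B0 by simp
  qed
  finally show ?thesis .
qed

lemma prob_slow:
  "\<exists>C>0. \<forall>m t. measure (annealed p) {\<omega>. \<forall>k\<le>t. backbone_height (fst \<omega>) (walk_from \<beta> (fst \<omega>) [] (snd \<omega>) k) < m}
     \<le> C * real m * real (Suc t) powr (- \<gamma>)"
proof -
  have b: "\<beta> > 1" by (rule \<beta>_gt_1)
  have C4: "C4 > 0" unfolding C4_def using mean_offspring_pos b C3_pos
    by (intro add_pos_nonneg divide_nonneg_nonneg mult_nonneg_nonneg add_nonneg_nonneg) auto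
  define C where "C = \<beta> / (\<beta> - 1) * C4 / (1 - q)"
  have C0: "C > 0" unfolding C_def using b C4 q_less_1 by (intro divide_pos_pos mult_pos_pos) auto
  have "measure (annealed p) {\<omega>. \<forall>k\<le>t. backbone_height (fst \<omega>) (walk_from \<beta> (fst \<omega>) [] (snd \<omega>) k) < m}
     \<le> C * real m * real (Suc t) powr (- \<gamma>)" for m t
  proof -
    obtain h where h: "(\<integral>\<^sup>+T. ennreal (cluster_cost \<beta> h t T) * indicator {T. surv T} T \<partial>gw_law p) \<le> ennreal (C4 * real (Suc t) powr (- \<gamma>))"
      using nn_integral_cluster_cost by blast
    let ?b = "\<lambda>T. \<Sum>l<m. \<Sum>u\<in>backbone_level T l. ennreal (hit_prob \<beta> 1 T {u} {} t []) * ennreal (cluster_cost \<beta> h t (subtree u T))"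
    have "measure (annealed p) {\<omega>. (\<lambda>T U. \<forall>k\<le>t. backbone_height T (walk_from \<beta> T [] U k) < m) (fst \<omega>) (snd \<omega>)} \<le> C * real m * real (Suc t) powr (- \<gamma>)"
    proof (rule annealed_prob_le[where b = ?b])
      have "(\<integral>\<^sup>+T. ?b T * indicator {T. surv T} T \<partial>gw_law p) \<le> ennreal (real m * (\<beta> / (\<beta> - 1) * (C4 * real (Suc t) powr (- \<gamma>))))"
        using C4 by (intro nn_integral_levels_le[where F = "\<lambda>T. ennreal (cluster_cost \<beta> h t T)"] h) auto
      also have "real m * (\<beta> / (\<beta> - 1) * (C4 * real (Suc t) powr (- \<gamma>))) = (1 - q) * (C * real m * real (Suc t) powr (- \<gamma>))"
        using q_less_1 by (simp add: C_def)
      finally show "(\<integral>\<^sup>+T. ?b T * indicator {T. surv T} T \<partial>gw_law p) \<le> ennreal ((1 - q) * (C * real m * real (Suc t) powr (- \<gamma>)))" .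
      show "(\<integral>\<^sup>+U. (if \<forall>k\<le>t. backbone_height T (walk_from \<beta> T [] U k) < m then 1 else 0) \<partial>noise_law) \<le> ?b T" if "surv T" for T
        by (rule quenched_slow[OF b that])
    qed (use C0 in \<open>measurable, auto\<close>)
    then show ?thesis by simp
  qed
  with C0 show ?thesis by blast
qed

text \<open>Used to pass from the backbone height to the distance from the root: on the complement,
  a distance of \<open>2 * m\<close> or more forces backbone height at least
  \<open>m\<close>.\<close>

lemma prob_deep_trap:
  "\<exists>C>0. \<forall>m n. m \<ge> 1 \<longrightarrow> measure (annealed p) {\<omega>. \<exists>k\<le>n. 2 * m \<le> length (walk_from \<beta> (fst \<omega>) [] (snd \<omega>) k)
       \<and> backbone_height (fst \<omega>) (walk_from \<beta> (fst \<omega>) [] (snd \<omega>) k) < m} \<le> C / real m"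
proof -
  have b: "\<beta> > 1" by (rule \<beta>_gt_1)
  define D where "D = \<beta> / (\<beta> - 1) * mean_offspring / (1 - q)"
  have D0: "D > 0" unfolding D_def using b mean_offspring_pos q_less_1 by (intro divide_pos_pos mult_pos_pos) auto
  define C where "C = D * (1 / (1 / sqrt \<mu> - 1)\<^sup>2)"
  have "sqrt \<mu> \<noteq> 1" using \<mu>_less_1 by simp
  then have C0: "C > 0" unfolding C_def using D0 \<mu>_pos by simp
  have "measure (annealed p) {\<omega>. \<exists>k\<le>n. 2 * m \<le> length (walk_from \<beta> (fst \<omega>) [] (snd \<omega>) k)
       \<and> backbone_height (fst \<omega>) (walk_from \<beta> (fst \<omega>) [] (snd \<omega>) k) < m} \<le> C / real m" if m: "m \<ge> 1" for m n
  proof -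
    let ?b = "\<lambda>T. \<Sum>l<m. \<Sum>u\<in>backbone_level T l. ennreal (hit_prob \<beta> 1 T {u} {} n []) * indicator {T. deep_trap m T} (subtree u T)"
    have "measure (annealed p) {\<omega>. (\<lambda>T U. \<exists>k\<le>n. 2 * m \<le> length (walk_from \<beta> T [] U k) \<and> backbone_height T (walk_from \<beta> T [] U k) < m) (fst \<omega>) (snd \<omega>)}
      \<le> D * real m * \<mu> ^ m"
    proof (rule annealed_prob_le[where b = ?b])
      have "(\<integral>\<^sup>+T. indicator {T. deep_trap m T} T * indicator {T. surv T} T \<partial>gw_law p) \<le> (\<integral>\<^sup>+T. indicator {T. deep_trap m T} T \<partial>gw_law p)"
        by (intro nn_integral_mono) (auto simp: indicator_def)
      also have "\<dots> \<le> ennreal (mean_offspring * trap_tail m)" by (rule nn_integral_deep_trap)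
      also have "\<dots> \<le> ennreal (mean_offspring * \<mu> ^ m)" using trap_tail_le mean_offspring_pos by (intro ennreal_leI mult_left_mono) auto
      finally have "(\<integral>\<^sup>+T. ?b T * indicator {T. surv T} T \<partial>gw_law p) \<le> ennreal (real m * (\<beta> / (\<beta> - 1) * (mean_offspring * \<mu> ^ m)))"
        using mean_offspring_pos \<mu>_pos by (intro nn_integral_levels_le) auto
      also have "real m * (\<beta> / (\<beta> - 1) * (mean_offspring * \<mu> ^ m)) = (1 - q) * (D * real m * \<mu> ^ m)"
        using q_less_1 by (simp add: D_def)
      finally show "(\<integral>\<^sup>+T. ?b T * indicator {T. surv T} T \<partial>gw_law p) \<le> ennreal ((1 - q) * (D * real m * \<mu> ^ m))" .
      show "(\<integral>\<^sup>+U. (if \<exists>k\<le>n. 2 * m \<le> length (walk_from \<beta> T [] U k) \<and> backbone_height T (walk_from \<beta> T [] U k) < m then 1 else 0) \<partial>noise_law) \<le> ?b T" if "surv T" for T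
        by (rule quenched_deep_trap[OF b that])
    qed (use D0 \<mu>_pos in \<open>measurable, auto\<close>)
    also have "D * real m * \<mu> ^ m = D * (real m * \<mu> ^ m)" by simp
    also have "\<dots> \<le> D * (1 / (1 / sqrt \<mu> - 1)\<^sup>2 / real m)"
      using D0 power_le_inverse_square[OF \<mu>_pos \<mu>_less_1 m] by (intro mult_left_mono) auto
    also have "\<dots> = C / real m" by (simp add: C_def)
    finally show ?thesis by simp
  qed
  with C0 show ?thesis by blast
qed

text \<open>Used to turn a height reached at some earlier time into a lower bound at the present
  time.\<close>

lemma prob_return:
  "\<exists>C>0. \<forall>m n. m \<ge> 1 \<longrightarrow> measure (annealed p) {\<omega>. \<exists>k\<le>n. \<exists>j\<le>k. 2 * m \<le> backbone_height (fst \<omega>) (walk_from \<beta> (fst \<omega>) [] (snd \<omega>) j)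
       \<and> backbone_height (fst \<omega>) (walk_from \<beta> (fst \<omega>) [] (snd \<omega>) k) < m} \<le> C / real m"
proof -
  have b: "\<beta> > 1" by (rule \<beta>_gt_1)
  have "measure (annealed p) {\<omega>. \<exists>k\<le>n. \<exists>j\<le>k. 2 * m \<le> backbone_height (fst \<omega>) (walk_from \<beta> (fst \<omega>) [] (snd \<omega>) j)
       \<and> backbone_height (fst \<omega>) (walk_from \<beta> (fst \<omega>) [] (snd \<omega>) k) < m} \<le> 1 / (\<beta> - 1) / real m" if m: "m \<ge> 1" for m n
  proof -
    have "measure (annealed p) {\<omega>. (\<lambda>T U. \<exists>k\<le>n. \<exists>j\<le>k. 2 * m \<le> backbone_height T (walk_from \<beta> T [] U j) \<and> backbone_height T (walk_from \<beta> T [] U k) < m) (fst \<omega>) (snd \<omega>)}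
      \<le> (1 / \<beta>) ^ m"
    proof (rule annealed_prob_le[where b = "\<lambda>_. ennreal ((1 / \<beta>) ^ m)"])
      have S: "{T. surv T} \<in> sets (gw_law p)" by (rule sets_gw_Collect) measurable
      show "(\<integral>\<^sup>+T. ennreal ((1 / \<beta>) ^ m) * indicator {T. surv T} T \<partial>gw_law p) \<le> ennreal ((1 - q) * (1 / \<beta>) ^ m)"
        using S b q_less_1 by (subst nn_integral_cmult_indicator) (auto simp: emeasure_surv ennreal_mult[symmetric] mult.commute)
      show "(\<integral>\<^sup>+U. (if \<exists>k\<le>n. \<exists>j\<le>k. 2 * m \<le> backbone_height T (walk_from \<beta> T [] U j) \<and> backbone_height T (walk_from \<beta> T [] U k) < m then 1 else 0) \<partial>noise_law)
        \<le> ennreal ((1 / \<beta>) ^ m)" if "surv T" for T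
        by (rule quenched_return[OF b that m])
    qed (use b in \<open>measurable, auto\<close>)
    also have "(1 / \<beta>) ^ m \<le> 1 / (real m * (1 / (1 / \<beta>) - 1))"
      using b m by (intro power_le_inverse_linear) auto
    finally show ?thesis by (simp add: mult.commute)
  qed
  then show ?thesis using b by (intro exI[of _ "1 / (\<beta> - 1)"]) auto
qed

text \<open>Every level costs one factor. Reaching level \<open>m + 1\<close> is bounded by first
  entrances to level \<open>m\<close> times level factors, independence separates the two, and the
  disjoint first entrances add up to reaching level \<open>m\<close>.\<close>

lemma nn_integral_killed_reach:
  assumes n: "n \<ge> 1" and s: "s = real n / (real n + 1)"
    and K: "(\<integral>\<^sup>+T. ennreal (level_factor \<beta> s h T) * indicator {T. surv T} T \<partial>gw_law p) \<le> ennreal ((1 - q) * \<rho>)" and \<rho>: "0 \<le> \<rho>"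
  shows "(\<integral>\<^sup>+T. ennreal (hit_prob \<beta> s T {w. m \<le> backbone_height T w} {} N []) * indicator {T. surv T} T \<partial>gw_law p) \<le> ennreal ((1 - q) * \<rho> ^ m)"
proof (induction m)
  case 0
  have S: "{T. surv T} \<in> sets (gw_law p)" by (rule sets_gw_Collect) measurable
  then show ?case by (simp add: emeasure_surv)
next
  case (Suc m)
  have b: "\<beta> > 1" "\<beta> > 0" using \<beta>_gt_1 by auto
  have s01: "0 < s" "s \<le> 1" "0 \<le> s" using n s by auto
  let ?H = "\<lambda>u T. ennreal (hit_prob \<beta> s T {u} (backbone_level T m - {u}) N [])"
  \<comment> \<open>With \<open>length u\<close> in place of \<open>m\<close> the hitting factor is
    independent of the subtree of \<open>u\<close> for every \<open>u\<close>, not only on the level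
    in question.\<close>
  let ?H' = "\<lambda>u T. ennreal (hit_prob \<beta> s T {u} (backbone_level T (length u) - {u}) N [])"
  let ?F = "\<lambda>T. ennreal (level_factor \<beta> s h T)"
  let ?L = "\<integral>\<^sup>+T. (\<Sum>u\<in>backbone_level T m. ?H' u T * ?F (subtree u T)) \<partial>gw_law p"
  have HH: "?H' u T = ?H u T" if "u \<in> backbone_level T m" for u T using bblD[OF that] by simp
  have "(\<integral>\<^sup>+T. ennreal (hit_prob \<beta> s T {w. Suc m \<le> backbone_height T w} {} N []) * indicator {T. surv T} T \<partial>gw_law p) \<le> ?L"
  proof (rule nn_integral_mono)
    fix T
    show "ennreal (hit_prob \<beta> s T {w. Suc m \<le> backbone_height T w} {} N []) * indicator {T. surv T} T \<le> (\<Sum>u\<in>backbone_level T m. ?H' u T * ?F (subtree u T))"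
    proof (cases "surv T")
      case True
      have "ennreal (hit_prob \<beta> s T {w. Suc m \<le> backbone_height T w} {} N []) \<le>
        ennreal (\<Sum>u\<in>backbone_level T m. level_factor \<beta> s h (subtree u T) * hit_prob \<beta> s T {u} (backbone_level T m - {u}) N [])"
        by (intro ennreal_leI killed_hit_next_level_root b s01 True)
      also have "\<dots> = (\<Sum>u\<in>backbone_level T m. ?H u T * ?F (subtree u T))"
        using level_factor_bounds[OF b(1) s01(1,2)] hit_prob_nonneg[OF b(2) s01(3)]
        by (subst sum_ennreal[symmetric]) (auto simp: ennreal_mult mult.commute)
      also have "\<dots> = (\<Sum>u\<in>backbone_level T m. ?H' u T * ?F (subtree u T))"
        using HH by (intro sum.cong) auto
      finally show ?thesis using True by simp
    qed simp
  qed
  also have "?L \<le> ennreal ((1 - q) * \<rho> ^ m * ((1 - q) * \<rho>) / (1 - q))"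
  proof (rule ennreal_le_divideI)
    have "?L * ennreal (1 - q) = ?L * emeasure (gw_law p) {T. surv T}" by (simp add: emeasure_surv)
    also have "\<dots> = (\<integral>\<^sup>+T. (\<Sum>u\<in>backbone_level T m. ?H' u T) \<partial>gw_law p) * (\<integral>\<^sup>+T. ?F T * indicator {T. surv T} T \<partial>gw_law p)"
    proof (rule nn_integral_sum_level_cross)
      show "?H' u T = ?H' u T'" if a: "agree_off u T T'" for u T T'
        using hit_prob_agree_off[OF a, of "[]"] backbone_level_agree_off[OF a] by simp
    qed measurable
    also have "\<dots> \<le> ennreal ((1 - q) * \<rho> ^ m) * ennreal ((1 - q) * \<rho>)"
    proof (intro mult_mono K)
      have "(\<Sum>u\<in>backbone_level T m. ?H' u T) \<le> ennreal (hit_prob \<beta> s T {w. m \<le> backbone_height T w} {} N []) * indicator {T. surv T} T" for T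
      proof (cases "surv T")
        case True
        have "(\<Sum>u\<in>backbone_level T m. ?H' u T) = (\<Sum>u\<in>backbone_level T m. ?H u T)" using HH by (intro sum.cong) auto
        also have "\<dots> = ennreal (\<Sum>u\<in>backbone_level T m. hit_prob \<beta> s T {u} (backbone_level T m - {u}) N [])"
          using hit_prob_nonneg[OF b(2) s01(3)] by (intro sum_ennreal) auto
        also have "\<dots> \<le> ennreal (hit_prob \<beta> s T {w. m \<le> backbone_height T w} {} N [])"
          using True by (intro ennreal_leI killed_first_hit_sum_le b s01 True)
            (auto simp: backbone_level_def level_def)
        finally show ?thesis using True by simp
      qed (simp add: backbone_level_not_surv)
      then have "(\<integral>\<^sup>+T. (\<Sum>u\<in>backbone_level T m. ?H' u T) \<partial>gw_law p) \<le>
        (\<integral>\<^sup>+T. ennreal (hit_prob \<beta> s T {w. m \<le> backbone_height T w} {} N []) * indicator {T. surv T} T \<partial>gw_law p)"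
        by (rule nn_integral_mono)
      with Suc show "(\<integral>\<^sup>+T. (\<Sum>u\<in>backbone_level T m. ?H' u T) \<partial>gw_law p) \<le> ennreal ((1 - q) * \<rho> ^ m)"
        by (rule order_trans[rotated])
    qed auto
    also have "\<dots> = ennreal ((1 - q) * \<rho> ^ m * ((1 - q) * \<rho>))"
      using q_less_1 \<rho> by (intro ennreal_mult[symmetric]) auto
    finally show "?L * ennreal (1 - q) \<le> ennreal ((1 - q) * \<rho> ^ m * ((1 - q) * \<rho>))" .
  qed (use q_less_1 in simp)
  also have "(1 - q) * \<rho> ^ m * ((1 - q) * \<rho>) / (1 - q) = (1 - q) * \<rho> ^ Suc m"
    using q_less_1 by simp
  finally show ?case .
qed

lemma prob_fast:
  "\<exists>C>0. \<forall>m n. m \<ge> 1 \<longrightarrow> n \<ge> 1 \<longrightarrow> measure (annealed p) {\<omega>. \<exists>k\<le>n. m \<le> backbone_height (fst \<omega>) (walk_from \<beta> (fst \<omega>) [] (snd \<omega>) k)}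
     \<le> C * real n powr \<gamma> / real m"
proof -
  have b: "\<beta> > 1" by (rule \<beta>_gt_1)
  obtain c where c: "c > 0" "\<And>n h. n \<ge> 1 \<Longrightarrow> real n \<le> \<beta> ^ h \<Longrightarrow>
     (\<integral>\<^sup>+T. ennreal (level_factor \<beta> (real n / (real n + 1)) (Suc h) T) * indicator {T. surv T} T \<partial>gw_law p)
       \<le> ennreal ((1 - q) * (1 - c * \<mu> ^ h))"
    using nn_integral_level_factor by blast
  \<comment> \<open>Capped so that \<open>\<rho>\<close> is at most one and its complement can serve
    as the factor per level.\<close>
  define c' where "c' = min c 1"
  have c': "c' > 0" "c' \<le> 1" "c' \<le> c" using c by (auto simp: c'_def)
  define C where "C = 3 / (c' * \<mu>)"
  have C0: "C > 0" using c' \<mu>_pos by (simp add: C_def)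
  have "measure (annealed p) {\<omega>. \<exists>k\<le>n. m \<le> backbone_height (fst \<omega>) (walk_from \<beta> (fst \<omega>) [] (snd \<omega>) k)} \<le> C * real n powr \<gamma> / real m"
    if m: "m \<ge> 1" and n: "n \<ge> 1" for m n
  proof -
    obtain h where h: "real n \<le> \<beta> ^ h" "\<beta> ^ h \<le> \<beta> * real n" using ex_height[of "real n"] n by auto
    define \<rho> where "\<rho> = c' * \<mu> ^ h"
    have \<mu>1: "0 < \<mu> ^ h" "\<mu> ^ h \<le> 1" using \<mu>_pos \<mu>_less_1 by (auto intro: power_le_one)
    have "c' * \<mu> ^ h \<le> 1 * 1" using \<mu>1 c' by (intro mult_mono) auto
    then have \<rho>: "0 < \<rho>" "\<rho> \<le> 1" using c' \<mu>1 by (auto simp: \<rho>_def)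
    let ?s = "real n / (real n + 1)"
    let ?b = "\<lambda>T. 3 * ennreal (hit_prob \<beta> ?s T {w. m \<le> backbone_height T w} {} n [])"
    have "c' * \<mu> ^ h \<le> c * \<mu> ^ h" using c' \<mu>1 by (intro mult_right_mono) auto
    then have "(1 - q) * (1 - c * \<mu> ^ h) \<le> (1 - q) * (1 - \<rho>)"
      using q_less_1 by (intro mult_left_mono) (auto simp: \<rho>_def)
    then have K: "(\<integral>\<^sup>+T. ennreal (level_factor \<beta> ?s (Suc h) T) * indicator {T. surv T} T \<partial>gw_law p) \<le> ennreal ((1 - q) * (1 - \<rho>))"
      using c(2)[OF n h(1)] by (meson ennreal_leI order_trans)
    have "measure (annealed p) {\<omega>. (\<lambda>T U. \<exists>k\<le>n. m \<le> backbone_height T (walk_from \<beta> T [] U k)) (fst \<omega>) (snd \<omega>)} \<le> 3 * (1 - \<rho>) ^ m"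
    proof (rule annealed_prob_le[where b = ?b])
      have "(\<integral>\<^sup>+T. ?b T * indicator {T. surv T} T \<partial>gw_law p) =
        3 * (\<integral>\<^sup>+T. ennreal (hit_prob \<beta> ?s T {w. m \<le> backbone_height T w} {} n []) * indicator {T. surv T} T \<partial>gw_law p)"
        unfolding mult.assoc by (rule nn_integral_cmult) measurable
      also have "\<dots> \<le> 3 * ennreal ((1 - q) * (1 - \<rho>) ^ m)"
        using \<rho> by (intro mult_left_mono nn_integral_killed_reach[OF n refl K]) auto
      also have "\<dots> = ennreal ((1 - q) * (3 * (1 - \<rho>) ^ m))"
        using q_less_1 \<rho> by (simp add: ennreal_mult mult_ac)
      finally show "(\<integral>\<^sup>+T. ?b T * indicator {T. surv T} T \<partial>gw_law p) \<le> ennreal ((1 - q) * (3 * (1 - \<rho>) ^ m))" .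
      show "(\<integral>\<^sup>+U. (if \<exists>k\<le>n. m \<le> backbone_height T (walk_from \<beta> T [] U k) then 1 else 0) \<partial>noise_law) \<le> ?b T" for T
        by (rule quenched_reach[OF b n])
    qed (use \<rho> in \<open>measurable, auto\<close>)
    also have "3 * (1 - \<rho>) ^ m \<le> 3 * (1 / (real m * \<rho>))"
      using one_minus_power_le[OF \<rho> m] by simp
    also have "\<dots> \<le> C * real n powr \<gamma> / real m"
    proof -
      have "\<mu> * real n powr (- \<gamma>) = (\<beta> * real n) powr (- \<gamma>)"
        using b n by (subst \<mu>_eq_powr) (simp add: powr_mult)
      also have "\<dots> \<le> \<mu> ^ h"
        unfolding \<mu>_power using h b n \<gamma>_range by (intro powr_mono2') auto
      finally have "c' * \<mu> * real n powr (- \<gamma>) \<le> \<rho>"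
        unfolding \<rho>_def using c' by (simp add: mult.assoc)
      moreover have "0 < c' * \<mu> * real n powr (- \<gamma>)" using c' \<mu>_pos n by simp
      ultimately have "1 / \<rho> \<le> 1 / (c' * \<mu> * real n powr (- \<gamma>))"
        by (intro frac_le) auto
      also have "\<dots> = real n powr \<gamma> / (c' * \<mu>)"
        by (simp add: powr_minus field_simps)
      finally have "3 / real m * (1 / \<rho>) \<le> 3 / real m * (real n powr \<gamma> / (c' * \<mu>))"
        by (intro mult_left_mono) auto
      then show ?thesis by (simp add: C_def mult_ac)
    qed
    finally show ?thesis by simp
  qed
  with C0 show ?thesis by blast
qed

end

section \<open>Tightness and the almost sure exponent\<close>

text \<open>The half-open interval starts at -1 so that it contains the value zero, and the tail is
  taken at \<open>e / 2\<close> because tightness asks for a strict inequality.\<close>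

lemma (in prob_space) tight_nonneg:
  assumes Y: "\<And>n. random_variable borel (Y n)" and Y0: "\<And>n \<omega>. 0 \<le> Y n \<omega>"
    and tail: "\<And>e. e > 0 \<Longrightarrow> \<exists>K>0. \<forall>n. prob {\<omega> \<in> space M. Y n \<omega> > K} \<le> e"
  shows "tight (\<lambda>n. distr M borel (Y n))"
  unfolding tight_def
proof (intro conjI allI impI)
  show "real_distribution (distr M borel (Y n))" for n using Y by simp
  fix e :: real assume e: "e > 0"
  obtain K where K: "K > 0" "\<And>n. prob {\<omega> \<in> space M. Y n \<omega> > K} \<le> e / 2"
    using tail[of "e / 2"] e by auto
  have "measure (distr M borel (Y n)) {-1<..K} > 1 - e" for n
  proof -
    note [measurable] = Y[of n]
    have "measure (distr M borel (Y n)) {-1<..K} = prob (Y n -` {-1<..K} \<inter> space M)"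
      by (rule measure_distr) (auto simp: Y)
    also have "Y n -` {-1<..K} \<inter> space M = space M - {\<omega> \<in> space M. Y n \<omega> > K}"
    proof -
      have "-1 < Y n \<omega>" for \<omega> using Y0[of n \<omega>] by linarith
      then show ?thesis by auto
    qed
    also have "prob \<dots> = 1 - prob {\<omega> \<in> space M. Y n \<omega> > K}"
      by (rule prob_compl) measurable
    finally show ?thesis using K(2)[of n] e by linarith
  qed
  then show "\<exists>a b. a < b \<and> (\<forall>n. measure (distr M borel (Y n)) {a<..b} > 1 - e)"
    using K(1) by (intro exI[of _ "-1"] exI[of _ K]) auto
qed

lemma (in prob_space) AE_eventually_not:
  assumes B[measurable]: "\<And>i. {\<omega> \<in> space M. B i \<omega>} \<in> events"
    and le: "\<And>i. prob {\<omega> \<in> space M. B i \<omega>} \<le> C * r ^ i" and r: "0 \<le> r" "r < 1"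
  shows "AE \<omega> in M. eventually (\<lambda>i. \<not> B i \<omega>) sequentially"
proof -
  have "AE x in M. eventually (\<lambda>n. x \<in> space M - {\<omega> \<in> space M. B n \<omega>}) sequentially"
  proof (rule borel_cantelli_AE1)
    show "summable (\<lambda>n. prob {\<omega> \<in> space M. B n \<omega>})"
    proof (rule summable_comparison_test')
      show "summable (\<lambda>i. C * r ^ i)" using r by (intro summable_mult summable_geometric) simp
      show "norm (prob {\<omega> \<in> space M. B n \<omega>}) \<le> C * r ^ n" for n
        using le[of n] by simp
    qed
  qed (auto simp: emeasure_eq_measure)
  then show ?thesis
  proof eventually_elim
    case (elim x)
    then show ?case by (rule eventually_mono) auto
  qed
qed

lemma length_walk_step_le: "length (walk_step \<beta> T w r) \<le> Suc (length w)"
  by (auto simp: walk_step_def Let_def)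

text \<open>The distance grows by at most one per step, so no level is skipped.\<close>

lemma hits_level_before:
  assumes "N \<le> length (walk_from \<beta> T [] U k)"
  shows "\<exists>j\<le>k. length (walk_from \<beta> T [] U j) = N"
  using assms
proof (induction k)
  case (Suc k)
  show ?case
  proof (cases "N \<le> length (walk_from \<beta> T [] U k)")
    case True
    with Suc.IH show ?thesis by (auto intro: le_SucI)
  next
    case False
    with Suc.prems length_walk_step_le[of \<beta> T "walk_from \<beta> T [] U k" "U k"]
    have "length (walk_from \<beta> T [] U (Suc k)) = N" by simp
    then show ?thesis by blast
  qed
qed simp

lemma X_eq_walk_from: "X \<beta> \<omega> n = walk_from \<beta> (fst \<omega>) [] (snd \<omega>) n"
  by (simp add: X_def walk_eq_walk_from)

lemma hit_time_le:
  assumes "N \<le> length (X \<beta> \<omega> k)"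
  shows "hit_time \<beta> \<omega> N \<le> k"
proof -
  obtain j where "j \<le> k" "length (X \<beta> \<omega> j) = N"
    using hits_level_before assms unfolding X_eq_walk_from by blast
  then show ?thesis unfolding hit_time_def by (auto intro: order_trans[OF Least_le])
qed

lemma measurable_X [measurable]: "(\<lambda>\<omega>. X \<beta> \<omega> n) \<in> annealed p \<rightarrow>\<^sub>M count_space UNIV"
  unfolding X_eq_walk_from by measurable

lemma measurable_hit_time [measurable]: "(\<lambda>\<omega>. hit_time \<beta> \<omega> n) \<in> annealed p \<rightarrow>\<^sub>M count_space UNIV"
proof -
  have [measurable]: "(\<lambda>\<omega>. length (X \<beta> \<omega> i)) \<in> annealed p \<rightarrow>\<^sub>M count_space UNIV" for i
    by (rule measurable_compose[OF measurable_X]) simp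
  show ?thesis unfolding hit_time_def by measurable
qed

lemma measurable_backbone_height_X [measurable]: "(\<lambda>\<omega>. backbone_height (fst \<omega>) (X \<beta> \<omega> n)) \<in> annealed p \<rightarrow>\<^sub>M count_space UNIV"
  unfolding X_eq_walk_from by measurable

lemma measurable_length_X [measurable]: "(\<lambda>\<omega>. length (X \<beta> \<omega> n)) \<in> annealed p \<rightarrow>\<^sub>M count_space UNIV"
  by (rule measurable_compose[OF measurable_X]) simp

lemma ceil_bounds:
  fixes x :: real
  assumes "x \<ge> 1"
  shows "nat \<lceil>x\<rceil> \<ge> 1" "x \<le> real (nat \<lceil>x\<rceil>)" "real (nat \<lceil>x\<rceil>) \<le> 2 * x"
  using assms by linarith+

lemma ex_dyadic:
  fixes n :: nat
  assumes "n \<ge> 1"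
  shows "\<exists>i. 2 ^ i \<le> n \<and> n < 2 ^ Suc i"
proof -
  have "\<exists>i. n < 2 ^ i" by (metis less_exp)
  define j where "j = (LEAST i. n < 2 ^ i)"
  have j: "n < 2 ^ j" unfolding j_def using \<open>\<exists>i. n < 2 ^ i\<close> by (rule LeastI_ex)
  with assms have "j \<noteq> 0" by (intro notI) auto
  then obtain i where i: "j = Suc i" by (cases j) auto
  have "\<not> n < 2 ^ i" using not_less_Least[of i "\<lambda>i. n < 2 ^ i"] i by (simp add: j_def)
  with j i show ?thesis by (intro exI[of _ i]) auto
qed

context biased_gw
begin

abbreviation "height_at \<omega> k \<equiv> backbone_height (fst \<omega>) (X \<beta> \<omega> k)"

text \<open>If the backbone height reaches \<open>Suc n\<close> by time \<open>t\<close>, so does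
  the distance, and the level has been hit. The value 0 assigned to a level that is never hit does
  not exceed \<open>K\<close>, so it cannot produce a large hitting time.\<close>

lemma tight_hit_time:
  "tight (\<lambda>n. distr (annealed p) borel
            (\<lambda>\<omega>. real (hit_time \<beta> \<omega> (Suc n)) / real (Suc n) powr (1 / \<gamma>)))"
proof (rule A.tight_nonneg)
  fix e :: real assume e: "e > 0"
  obtain C where C: "C > 0" "\<And>m t. measure (annealed p) {\<omega>. \<forall>k\<le>t. height_at \<omega> k < m} \<le> C * real m * real (Suc t) powr (- \<gamma>)"
    using prob_slow unfolding X_eq_walk_from by blast
  \<comment> \<open>Solves \<open>C * K powr (- \<gamma>) = e\<close>, the bound that remains after
    the powers of \<open>Suc n\<close> cancel.\<close>
  define K where "K = (C / e) powr (1 / \<gamma>)"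
  have K0: "K > 0" using C e by (simp add: K_def)
  have "K powr (- \<gamma>) = e / C"
    using C e \<gamma>_range by (simp add: K_def powr_powr powr_minus)
  then have CK: "C * K powr (- \<gamma>) = e" using C by simp
  have "measure (annealed p) {\<omega> \<in> space (annealed p). real (hit_time \<beta> \<omega> (Suc n)) / real (Suc n) powr (1 / \<gamma>) > K} \<le> e" for n
  proof -
    let ?N = "real (Suc n)"
    let ?x = "K * ?N powr (1 / \<gamma>)"
    have x0: "?x > 0" using K0 by simp
    define t where "t = nat \<lfloor>?x\<rfloor>"
    have t: "real t \<le> ?x" "?x \<le> real (Suc t)" using x0 unfolding t_def by linarith+
    have "{\<omega> \<in> space (annealed p). real (hit_time \<beta> \<omega> (Suc n)) / ?N powr (1 / \<gamma>) > K} \<subseteq> {\<omega>. \<forall>k\<le>t. height_at \<omega> k < Suc n}"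
    proof safe
      fix a b k assume h: "K < real (hit_time \<beta> (a, b) (Suc n)) / ?N powr (1 / \<gamma>)" and k: "k \<le> t"
      show "height_at (a, b) k < Suc n"
      proof (rule ccontr)
        assume "\<not> ?thesis"
        then have "Suc n \<le> length (X \<beta> (a, b) k)" using backbone_height_le_length[of a "X \<beta> (a, b) k"] by simp
        then have "hit_time \<beta> (a, b) (Suc n) \<le> t" using hit_time_le k by (meson le_trans)
        then have "real (hit_time \<beta> (a, b) (Suc n)) \<le> ?x" using t(1) by (meson of_nat_mono order_trans)
        with h show False by (simp add: pos_less_divide_eq)
      qed
    qed
    moreover have "{\<omega> \<in> space (annealed p). \<forall>k\<le>t. height_at \<omega> k < Suc n} \<in> sets (annealed p)" by measurable
    ultimately have "measure (annealed p) {\<omega> \<in> space (annealed p). real (hit_time \<beta> \<omega> (Suc n)) / ?N powr (1 / \<gamma>) > K}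
      \<le> measure (annealed p) {\<omega>. \<forall>k\<le>t. height_at \<omega> k < Suc n}"
      by (intro A.finite_measure_mono) auto
    also have "\<dots> \<le> C * ?N * real (Suc t) powr (- \<gamma>)" by (rule C(2))
    also have "\<dots> \<le> C * ?N * ?x powr (- \<gamma>)"
      using t x0 C \<gamma>_range by (intro mult_left_mono powr_mono2') auto
    also have "?x powr (- \<gamma>) = K powr (- \<gamma>) * ?N powr (- 1)"
      using K0 \<gamma>_range by (simp add: powr_mult powr_powr)
    also have "C * ?N * (K powr (- \<gamma>) * ?N powr (- 1)) = C * K powr (- \<gamma>)"
    proof -
      have "C * x * (k * x powr (- 1)) = C * k" if "x > 0" for x k :: real
        using that by (simp add: powr_minus_divide)
      then show ?thesis by simp
    qed
    also have "\<dots> = e" by (rule CK)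
    finally show ?thesis .
  qed
  then show "\<exists>K>0. \<forall>n. measure (annealed p) {\<omega> \<in> space (annealed p). real (hit_time \<beta> \<omega> (Suc n)) / real (Suc n) powr (1 / \<gamma>) > K} \<le> e"
    using K0 by blast
qed auto

text \<open>A large distance means a large backbone height or a deep trap; the threshold
  \<open>m\<close> is about half the distance in question, and both events have probability of order
  \<open>1 / K\<close>.\<close>

lemma tight_distance:
  "tight (\<lambda>n. distr (annealed p) borel
            (\<lambda>\<omega>. real (length (X \<beta> \<omega> (Suc n))) / real (Suc n) powr \<gamma>))"
proof (rule A.tight_nonneg)
  fix e :: real assume e: "e > 0"
  obtain C where C: "C > 0" "\<And>m n. m \<ge> 1 \<Longrightarrow> n \<ge> 1 \<Longrightarrow> measure (annealed p) {\<omega>. \<exists>k\<le>n. m \<le> height_at \<omega> k} \<le> C * real n powr \<gamma> / real m"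
    using prob_fast unfolding X_eq_walk_from by blast
  obtain D where D: "D > 0" "\<And>m n. m \<ge> 1 \<Longrightarrow> measure (annealed p) {\<omega>. \<exists>k\<le>n. 2 * m \<le> length (X \<beta> \<omega> k) \<and> height_at \<omega> k < m} \<le> D / real m"
    using prob_deep_trap unfolding X_eq_walk_from by blast
  \<comment> \<open>The lower bound 4 makes \<open>m\<close> positive and keeps the rounding loss
    below a factor two.\<close>
  define K where "K = max 4 (4 * (C + D) / e)"
  have K: "K \<ge> 4" "4 * (C + D) \<le> K * e"
  proof -
    have "4 * (C + D) / e \<le> K" by (simp add: K_def)
    then show "4 * (C + D) \<le> K * e" using e by (simp add: pos_divide_le_eq)
  qed (simp add: K_def)
  have "measure (annealed p) {\<omega> \<in> space (annealed p). real (length (X \<beta> \<omega> (Suc n))) / real (Suc n) powr \<gamma> > K} \<le> e" for n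
  proof -
    let ?N = "Suc n"
    define y where "y = real ?N powr \<gamma>"
    have y1: "y \<ge> 1" unfolding y_def using \<gamma>_range by (intro ge_one_powr_ge_zero) auto
    have "4 * 1 \<le> K * y" using K y1 by (intro mult_mono) auto
    define m where "m = nat \<lfloor>K * y / 2\<rfloor>"
    have m: "2 * real m \<le> K * y" "K * y / 4 \<le> real m" "m \<ge> 1"
      using \<open>4 * 1 \<le> K * y\<close> unfolding m_def by linarith+
    let ?E1 = "{\<omega>. \<exists>k\<le>?N. m \<le> height_at \<omega> k}" and ?E2 = "{\<omega>. \<exists>k\<le>?N. 2 * m \<le> length (X \<beta> \<omega> k) \<and> height_at \<omega> k < m}"
    have "{\<omega> \<in> space (annealed p). \<exists>k\<le>?N. m \<le> height_at \<omega> k} \<in> sets (annealed p)" by measurable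
    then have s1: "?E1 \<in> sets (annealed p)" by simp
    have "{\<omega> \<in> space (annealed p). \<exists>k\<le>?N. 2 * m \<le> length (X \<beta> \<omega> k) \<and> height_at \<omega> k < m} \<in> sets (annealed p)" by measurable
    then have s2: "?E2 \<in> sets (annealed p)" by simp
    have "{\<omega> \<in> space (annealed p). real (length (X \<beta> \<omega> ?N)) / real ?N powr \<gamma> > K} \<subseteq> ?E1 \<union> ?E2"
    proof safe
      fix a b assume h: "K < real (length (X \<beta> (a, b) ?N)) / real ?N powr \<gamma>"
        and no: "\<not> (\<exists>k\<le>?N. 2 * m \<le> length (X \<beta> (a, b) k) \<and> height_at (a, b) k < m)"
      have "K < real (length (X \<beta> (a, b) ?N)) / y" using h unfolding y_def .
      then have "K * y < real (length (X \<beta> (a, b) ?N))" using y1 by (simp add: pos_less_divide_eq)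
      with m(1) have "2 * m \<le> length (X \<beta> (a, b) ?N)" by linarith
      with no have "m \<le> height_at (a, b) ?N" by (meson le_refl not_less)
      then show "\<exists>k\<le>?N. m \<le> height_at (a, b) k" by blast
    qed
    then have "measure (annealed p) {\<omega> \<in> space (annealed p). real (length (X \<beta> \<omega> ?N)) / real ?N powr \<gamma> > K} \<le> measure (annealed p) (?E1 \<union> ?E2)"
      using s1 s2 by (intro A.finite_measure_mono) auto
    also have "\<dots> \<le> measure (annealed p) ?E1 + measure (annealed p) ?E2"
      by (rule measure_Un_le[OF s1 s2])
    also have "\<dots> \<le> C * y / real m + D / real m"
      unfolding y_def using m by (intro add_mono C(2) D(2)) auto
    also have "\<dots> \<le> (C + D) * y / real m"
      using D y1 m by (simp add: add_divide_distrib[symmetric] divide_right_mono distrib_right)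
    also have "\<dots> \<le> (C + D) * y / (K * y / 4)"
      using m C D y1 K by (intro divide_left_mono mult_pos_pos) auto
    also have "\<dots> = 4 * (C + D) / K" using y1 by simp
    also have "\<dots> \<le> e" using K by (simp add: pos_divide_le_eq mult.commute)
    finally show ?thesis .
  qed
  then show "\<exists>K>0. \<forall>n. measure (annealed p) {\<omega> \<in> space (annealed p). real (length (X \<beta> \<omega> (Suc n))) / real (Suc n) powr \<gamma> > K} \<le> e"
    using K(1) by (intro exI[of _ K]) auto
qed auto

text \<open>The four bad events concern all times up to a power of two, so excluding them along
  powers of two controls every \<open>n\<close> between \<open>2 ^ i\<close> and
  \<open>2 ^ Suc i\<close>. The upper bound is read off at scale \<open>Suc i\<close>. For the lower
  one, height \<open>2 * m i\<close> is reached by time \<open>2 ^ i\<close>, and no fall below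
  \<open>m i\<close> follows up to time \<open>2 ^ Suc i\<close>; the return events are summable
  because \<open>\<epsilon> < \<gamma>\<close>.\<close>

lemma AE_eventually_bounds:
  assumes eps: "0 < \<epsilon>" "\<epsilon> < \<gamma>"
  shows "AE \<omega> in annealed p. eventually (\<lambda>n. (real n / 2) powr (\<gamma> - \<epsilon>) \<le> real (length (X \<beta> \<omega> n))
     \<and> real (length (X \<beta> \<omega> n)) \<le> 4 * (2 * real n) powr (\<gamma> + \<epsilon>)) sequentially"
proof -
  obtain C1 where C1: "C1 > 0" "\<And>m t. measure (annealed p) {\<omega>. \<forall>k\<le>t. height_at \<omega> k < m} \<le> C1 * real m * real (Suc t) powr (- \<gamma>)"
    using prob_slow unfolding X_eq_walk_from by blast
  obtain C2 where C2: "C2 > 0" "\<And>m n. m \<ge> 1 \<Longrightarrow> n \<ge> 1 \<Longrightarrow> measure (annealed p) {\<omega>. \<exists>k\<le>n. m \<le> height_at \<omega> k} \<le> C2 * real n powr \<gamma> / real m"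
    using prob_fast unfolding X_eq_walk_from by blast
  obtain C3 where C3: "C3 > 0" "\<And>m n. m \<ge> 1 \<Longrightarrow> measure (annealed p) {\<omega>. \<exists>k\<le>n. 2 * m \<le> length (X \<beta> \<omega> k) \<and> height_at \<omega> k < m} \<le> C3 / real m"
    using prob_deep_trap unfolding X_eq_walk_from by blast
  obtain C4 where C4: "C4 > 0" "\<And>m n. m \<ge> 1 \<Longrightarrow> measure (annealed p) {\<omega>. \<exists>k\<le>n. \<exists>j\<le>k. 2 * m \<le> height_at \<omega> j \<and> height_at \<omega> k < m} \<le> C4 / real m"
    using prob_return unfolding X_eq_walk_from by blast
  define M where "M i = nat \<lceil>((2::real) ^ i) powr (\<gamma> + \<epsilon>)\<rceil>" for i
  define m where "m i = nat \<lceil>((2::real) ^ i) powr (\<gamma> - \<epsilon>)\<rceil>" for i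
  have z1: "1 \<le> ((2::real) ^ i) powr a" if "0 \<le> a" for i a
    using that by (intro ge_one_powr_ge_zero) auto
  have M: "M i \<ge> 1" "((2::real) ^ i) powr (\<gamma> + \<epsilon>) \<le> real (M i)" "real (M i) \<le> 2 * ((2::real) ^ i) powr (\<gamma> + \<epsilon>)" for i
    unfolding M_def by (rule ceil_bounds, rule z1, use eps in simp)+
  have m: "m i \<ge> 1" "((2::real) ^ i) powr (\<gamma> - \<epsilon>) \<le> real (m i)" "real (m i) \<le> 2 * ((2::real) ^ i) powr (\<gamma> - \<epsilon>)" for i
    unfolding m_def by (rule ceil_bounds, rule z1, use eps in simp)+
  have pw: "((2::real) ^ i) powr a = (2 powr a) ^ i" for i a
    by (simp add: powr_realpow[symmetric] powr_powr mult.commute)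
  have r: "0 \<le> 2 powr (- \<epsilon>)" "2 powr (- \<epsilon>) < (1::real)" "0 \<le> 2 powr (- (\<gamma> - \<epsilon>))" "2 powr (- (\<gamma> - \<epsilon>)) < (1::real)"
    using eps by (auto intro!: powr_less_one)
  have "AE \<omega> in annealed p. eventually (\<lambda>i. \<not> (\<exists>k\<le>2 ^ i. M i \<le> height_at \<omega> k)) sequentially"
  proof (rule A.AE_eventually_not[OF _ _ r(1,2)])
    show "measure (annealed p) {\<omega> \<in> space (annealed p). \<exists>k\<le>2 ^ i. M i \<le> height_at \<omega> k} \<le> C2 * (2 powr (- \<epsilon>)) ^ i" for i
    proof -
      have "measure (annealed p) {\<omega>. \<exists>k\<le>2 ^ i. M i \<le> height_at \<omega> k} \<le> C2 * real (2 ^ i) powr \<gamma> / real (M i)"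
        using M(1) by (intro C2) auto
      also have "\<dots> \<le> C2 * real (2 ^ i) powr \<gamma> / ((2::real) ^ i) powr (\<gamma> + \<epsilon>)"
        using M C2 by (intro divide_left_mono) (auto intro!: mult_pos_pos less_le_trans[OF _ M(2)])
      also have "\<dots> = C2 * (2 powr (- \<epsilon>)) ^ i"
        unfolding pw[symmetric] by (simp add: powr_add powr_minus field_simps)
      finally show ?thesis by simp
    qed
  qed measurable
  moreover have "AE \<omega> in annealed p. eventually (\<lambda>i. \<not> (\<exists>k\<le>2 ^ i. 2 * M i \<le> length (X \<beta> \<omega> k) \<and> height_at \<omega> k < M i)) sequentially"
  proof (rule A.AE_eventually_not[OF _ _ r(1,2)])
    show "measure (annealed p) {\<omega> \<in> space (annealed p). \<exists>k\<le>2 ^ i. 2 * M i \<le> length (X \<beta> \<omega> k) \<and> height_at \<omega> k < M i} \<le> C3 * (2 powr (- \<epsilon>)) ^ i" for i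
    proof -
      have "((2::real) ^ i) powr \<epsilon> \<le> (2 ^ i) powr (\<gamma> + \<epsilon>)" using \<gamma>_range by (intro powr_mono) auto
      then have e: "((2::real) ^ i) powr \<epsilon> \<le> real (M i)" using M(2)[of i] by linarith
      have "measure (annealed p) {\<omega>. \<exists>k\<le>2 ^ i. 2 * M i \<le> length (X \<beta> \<omega> k) \<and> height_at \<omega> k < M i} \<le> C3 / real (M i)"
        using M(1) by (intro C3) auto
      also have "\<dots> \<le> C3 / ((2::real) ^ i) powr \<epsilon>"
        using e C3 by (intro frac_le) auto
      also have "\<dots> = C3 * (2 powr (- \<epsilon>)) ^ i"
        unfolding pw[symmetric] by (simp add: powr_minus field_simps)
      finally show ?thesis by simp
    qed
  qed measurable
  moreover have "AE \<omega> in annealed p. eventually (\<lambda>i. \<not> (\<forall>k\<le>2 ^ i. height_at \<omega> k < 2 * m i)) sequentially"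
  proof (rule A.AE_eventually_not[OF _ _ r(1,2)])
    show "measure (annealed p) {\<omega> \<in> space (annealed p). \<forall>k\<le>2 ^ i. height_at \<omega> k < 2 * m i} \<le> (4 * C1) * (2 powr (- \<epsilon>)) ^ i" for i
    proof -
      have "measure (annealed p) {\<omega>. \<forall>k\<le>2 ^ i. height_at \<omega> k < 2 * m i} \<le> C1 * real (2 * m i) * real (Suc (2 ^ i)) powr (- \<gamma>)"
        by (rule C1)
      also have "\<dots> \<le> C1 * (4 * ((2::real) ^ i) powr (\<gamma> - \<epsilon>)) * ((2::real) ^ i) powr (- \<gamma>)"
        using C1 m(3)[of i] \<gamma>_range by (intro mult_mono powr_mono2') auto
      also have "\<dots> = (4 * C1) * (2 powr (- \<epsilon>)) ^ i"
        unfolding pw[symmetric] by (simp add: powr_diff powr_minus field_simps)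
      finally show ?thesis by simp
    qed
  qed measurable
  moreover have "AE \<omega> in annealed p. eventually (\<lambda>i. \<not> (\<exists>k\<le>2 ^ Suc i. \<exists>j\<le>k. 2 * m i \<le> height_at \<omega> j \<and> height_at \<omega> k < m i)) sequentially"
  proof (rule A.AE_eventually_not[OF _ _ r(3,4)])
    show "measure (annealed p) {\<omega> \<in> space (annealed p). \<exists>k\<le>2 ^ Suc i. \<exists>j\<le>k. 2 * m i \<le> height_at \<omega> j \<and> height_at \<omega> k < m i} \<le> C4 * (2 powr (- (\<gamma> - \<epsilon>))) ^ i" for i
    proof -
      have "measure (annealed p) {\<omega>. \<exists>k\<le>2 ^ Suc i. \<exists>j\<le>k. 2 * m i \<le> height_at \<omega> j \<and> height_at \<omega> k < m i} \<le> C4 / real (m i)"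
        using m(1) by (intro C4) auto
      also have "\<dots> \<le> C4 / ((2::real) ^ i) powr (\<gamma> - \<epsilon>)"
        using m(2) C4 by (intro frac_le) auto
      also have "\<dots> = C4 * (2 powr (- (\<gamma> - \<epsilon>))) ^ i"
        unfolding pw[symmetric] by (simp add: powr_minus powr_diff field_simps)
      finally show ?thesis by simp
    qed
  qed measurable
  ultimately show ?thesis
  proof eventually_elim
    case (elim \<omega>)
    from eventually_conj[OF eventually_conj[OF elim(1,2)] eventually_conj[OF elim(3,4)]]
    obtain i0 where H: "\<forall>i\<ge>i0. (\<not> (\<exists>k\<le>2 ^ i. M i \<le> height_at \<omega> k) \<and>
        \<not> (\<exists>k\<le>2 ^ i. 2 * M i \<le> length (X \<beta> \<omega> k) \<and> height_at \<omega> k < M i)) \<and>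
        \<not> (\<forall>k\<le>2 ^ i. height_at \<omega> k < 2 * m i) \<and>
        \<not> (\<exists>k\<le>2 ^ Suc i. \<exists>j\<le>k. 2 * m i \<le> height_at \<omega> j \<and> height_at \<omega> k < m i)"
      unfolding eventually_sequentially by (elim exE)
    note i0 = H[rule_format, THEN conjunct1, THEN conjunct1] H[rule_format, THEN conjunct1, THEN conjunct2]
      H[rule_format, THEN conjunct2, THEN conjunct1] H[rule_format, THEN conjunct2, THEN conjunct2]
    show ?case
      unfolding eventually_sequentially
    proof (intro exI[of _ "2 ^ i0"] allI impI)
      fix n :: nat assume n: "2 ^ i0 \<le> n"
      have "1 \<le> n" using n by (metis one_le_numeral one_le_power order_trans)
      then obtain i where i: "2 ^ i \<le> n" "n < 2 ^ Suc i" using ex_dyadic by blast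
      have "i0 < Suc i" using n i(2) by (metis order_le_less_trans power_less_imp_less_exp one_less_numeral_iff semiring_norm(76))
      then have ii: "i0 \<le> i" by simp
      have ni: "(2::real) ^ i \<le> real n" "real n \<le> 2 ^ Suc i"
        using i by (metis of_nat_le_iff of_nat_numeral of_nat_power less_imp_le)+
      obtain j where j: "j \<le> 2 ^ i" "2 * m i \<le> height_at \<omega> j" using i0(3)[OF ii] by (auto simp: not_less)
      have "j \<le> n" "n \<le> 2 ^ Suc i" using j i by auto
      then have "m i \<le> height_at \<omega> n" using i0(4)[OF ii] j(2) by (meson not_less)
      then have "m i \<le> length (X \<beta> \<omega> n)" using backbone_height_le_length[of "fst \<omega>" "X \<beta> \<omega> n"] by simp
      moreover have "(real n / 2) powr (\<gamma> - \<epsilon>) \<le> ((2::real) ^ i) powr (\<gamma> - \<epsilon>)"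
        using eps ni by (intro powr_mono2) auto
      ultimately have lo: "(real n / 2) powr (\<gamma> - \<epsilon>) \<le> real (length (X \<beta> \<omega> n))"
        using m(2)[of i] by linarith
      have si: "i0 \<le> Suc i" using ii by simp
      have "height_at \<omega> n < M (Suc i)" using i0(1)[OF si] i(2) by (meson less_imp_le not_less)
      then have "length (X \<beta> \<omega> n) < 2 * M (Suc i)" using i0(2)[OF si] i(2) by (meson less_imp_le not_less)
      moreover have "((2::real) ^ Suc i) powr (\<gamma> + \<epsilon>) \<le> (2 * real n) powr (\<gamma> + \<epsilon>)"
        using eps \<gamma>_range ni by (intro powr_mono2) auto
      ultimately have "real (length (X \<beta> \<omega> n)) \<le> 4 * (2 * real n) powr (\<gamma> + \<epsilon>)"
        using M(3)[of "Suc i"] by linarith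
      with lo show "(real n / 2) powr (\<gamma> - \<epsilon>) \<le> real (length (X \<beta> \<omega> n)) \<and>
         real (length (X \<beta> \<omega> n)) \<le> 4 * (2 * real n) powr (\<gamma> + \<epsilon>)" by simp
    qed
  qed
qed

lemma AE_log_exponent:
  "AE \<omega> in annealed p. (\<lambda>n. ln (real (length (X \<beta> \<omega> n))) / ln (real n)) \<longlonglongrightarrow> \<gamma>"
proof -
  \<comment> \<open>A countable sequence tending to zero, so that the exceptional null sets can be
    united; the shift by 2 keeps it strictly below \<open>\<gamma>\<close>.\<close>
  define \<epsilon> where "\<epsilon> j = \<gamma> / real (j + 2)" for j :: nat
  have eps: "0 < \<epsilon> j" "\<epsilon> j < \<gamma>" for j
    using \<gamma>_range by (auto simp: \<epsilon>_def pos_divide_less_eq)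
  have "AE \<omega> in annealed p. \<forall>j. eventually (\<lambda>n. (real n / 2) powr (\<gamma> - \<epsilon> j) \<le> real (length (X \<beta> \<omega> n))
     \<and> real (length (X \<beta> \<omega> n)) \<le> 4 * (2 * real n) powr (\<gamma> + \<epsilon> j)) sequentially"
    unfolding AE_all_countable using AE_eventually_bounds[OF eps] by blast
  then show ?thesis
  proof eventually_elim
    case (elim \<omega>)
    let ?L = "\<lambda>n. real (length (X \<beta> \<omega> n))"
    have eps_lim: "\<epsilon> \<longlonglongrightarrow> 0" unfolding \<epsilon>_def by real_asymp
    have key: "eventually (\<lambda>n. (\<gamma> - \<epsilon> j) * (ln (real n) - ln 2) / ln (real n) \<le> ln (?L n) / ln (real n)
       \<and> ln (?L n) / ln (real n) \<le> (ln 4 + (\<gamma> + \<epsilon> j) * (ln 2 + ln (real n))) / ln (real n)) sequentially" for j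
      using elim[rule_format, of j] eventually_gt_at_top[of 1]
    proof eventually_elim
      case (elim n)
      have n: "real n > 1" "ln (real n) > 0" using elim by auto
      have lo: "0 < (real n / 2) powr (\<gamma> - \<epsilon> j)" using n by simp
      then have L: "0 < ?L n" using elim by linarith
      have "(\<gamma> - \<epsilon> j) * (ln (real n) - ln 2) = ln ((real n / 2) powr (\<gamma> - \<epsilon> j))"
        using n by (simp add: ln_powr ln_div)
      also have "\<dots> \<le> ln (?L n)" using elim lo L by (subst ln_le_cancel_iff) auto
      finally have 1: "(\<gamma> - \<epsilon> j) * (ln (real n) - ln 2) \<le> ln (?L n)" .
      have "ln (?L n) \<le> ln (4 * (2 * real n) powr (\<gamma> + \<epsilon> j))"
        using elim L n by (subst ln_le_cancel_iff) auto
      also have "\<dots> = ln 4 + (\<gamma> + \<epsilon> j) * (ln 2 + ln (real n))"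
        using n by (simp add: ln_mult ln_powr)
      finally show ?case using 1 n by (auto intro!: divide_right_mono)
    qed
    show ?case
    proof (rule order_tendstoI)
      fix a assume a: "a < \<gamma>"
      have "eventually (\<lambda>j. \<epsilon> j < \<gamma> - a) sequentially" using order_tendstoD(2)[OF eps_lim, of "\<gamma> - a"] a by simp
      then obtain j where j: "\<epsilon> j < \<gamma> - a" by (auto simp: eventually_sequentially)
      have "(\<lambda>n. (\<gamma> - \<epsilon> j) * (ln (real n) - ln 2) / ln (real n)) \<longlonglongrightarrow> \<gamma> - \<epsilon> j"
        by real_asymp
      then have "eventually (\<lambda>n. a < (\<gamma> - \<epsilon> j) * (ln (real n) - ln 2) / ln (real n)) sequentially"
        using j by (intro order_tendstoD(1)) auto
      then show "eventually (\<lambda>n. a < ln (?L n) / ln (real n)) sequentially"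
        using key[of j] by eventually_elim linarith
    next
      fix a assume a: "\<gamma> < a"
      have "eventually (\<lambda>j. \<epsilon> j < a - \<gamma>) sequentially" using order_tendstoD(2)[OF eps_lim, of "a - \<gamma>"] a by simp
      then obtain j where j: "\<epsilon> j < a - \<gamma>" by (auto simp: eventually_sequentially)
      have "(\<lambda>n. (ln 4 + (\<gamma> + \<epsilon> j) * (ln 2 + ln (real n))) / ln (real n)) \<longlonglongrightarrow> \<gamma> + \<epsilon> j"
        by real_asymp
      then have "eventually (\<lambda>n. (ln 4 + (\<gamma> + \<epsilon> j) * (ln 2 + ln (real n))) / ln (real n) < a) sequentially"
        using j by (intro order_tendstoD(2)) auto
      then show "eventually (\<lambda>n. ln (?L n) / ln (real n) < a) sequentially"
        using key[of j] by eventually_elim linarith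
    qed
  qed
qed

end

theorem theorem1:
  fixes p :: "nat pmf" and q \<beta> \<gamma> :: real
  assumes p0: "pmf p 0 > 0"
    and mean_int: "integrable (measure_pmf p) real"
    and mean_gt1: "measure_pmf.expectation p real > 1"
    and second_moment: "integrable (measure_pmf p) (\<lambda>k. real k ^ 2)"
    and q_range: "q \<in> {0..1}" and q_fix: "gen_fun p q = q"
    and q_least: "\<And>s. s \<in> {0..1} \<Longrightarrow> gen_fun p s = s \<Longrightarrow> q \<le> s"
    and beta: "\<beta> > 1 / gen_fun_deriv p q"
    and gamma: "\<gamma> = - ln (gen_fun_deriv p q) / ln \<beta>"
  shows "tight (\<lambda>n. distr (annealed p) borel
            (\<lambda>\<omega>. real (hit_time \<beta> \<omega> (Suc n)) / real (Suc n) powr (1 / \<gamma>)))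
       \<and> tight (\<lambda>n. distr (annealed p) borel
            (\<lambda>\<omega>. real (length (X \<beta> \<omega> (Suc n))) / real (Suc n) powr \<gamma>))
       \<and> (AE \<omega> in annealed p.
           (\<lambda>n. ln (real (length (X \<beta> \<omega> n))) / ln (real n)) \<longlonglongrightarrow> \<gamma>)"
proof -
  interpret biased_gw p q \<beta> \<gamma> by unfold_locales fact+
  show ?thesis using tight_hit_time tight_distance AE_log_exponent by blast
qed

end
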